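(* Let $W$ be the binary erasure multiple access channel, with inputs $X,Y\in\{0,1\}$ and output $Z=X+Y\in\{0,1,2\}$ (real addition). Then its capacity region $\mathcal{C}$ of communication with adversary identification equals its (non-adversarial) MAC capacity region $\mathcal{C}_{\mathrm{MAC}}$.
   Context: Let $\mathcal{X}=\mathcal{Y}=\{0,1\}$ and $\mathcal{Z}=\{0,1,2\}$; $W^n$ denotes the $n$-fold product channel. $\mathcal{C}_{\mathrm{MAC}}$ is the usual capacity region of a two-user discrete memoryless MAC (both users honest, vanishing average error probability). **Codes.** An $(N_{\mathsf{A}},N_{\mathsf{B}},n)$ deterministic adversary identifying code consists of message sets $\mathcal{M}_i=\{1,\dots,N_i\}$, $i\in\{\mathsf{A},\mathsf{B}\}$, deterministic encoders $f_{\mathsf{A}}:\mathcal{M}_{\mathsf{A}}\to\mathcal{X}^n$, $f_{\mathsf{B}}:\mathcal{M}_{\mathsf{B}}\to\mathcal{Y}^n$, and a deterministic decoder $\phi:\mathcal{Z}^n\to(\mathcal{M}_{\mathsf{A}}\times\mathcal{M}_{\mathsf{B}})\cup\{\mathbf{a},\mathbf{b}\}$, where the output symbol $\mathbf{a}$ (resp. $\mathbf{b}$) declares user $\mathsf{A}$ (resp. $\mathsf{B}$) to be adversarial. **Error probability.** $P_{e,\mathrm{hon}}=\frac{1}{N_{\mathsf{A}}N_{\mathsf{B}}}\sum_{m_{\mathsf{A}},m_{\mathsf{B}}}W^n(\{z:\phi(z)\ne(m_{\mathsf{A}},m_{\mathsf{B}})\}\mid f_{\mathsf{A}}(m_{\mathsf{A}}),f_{\mathsf{B}}(m_{\mathsf{B}}))$;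 $P_{e,\mathrm{mal}\,\mathsf{A}}=\max_{x\in\mathcal{X}^n}\frac{1}{N_{\mathsf{B}}}\sum_{m_{\mathsf{B}}}W^n(\{z:\phi(z)\notin(\mathcal{M}_{\mathsf{A}}\times\{m_{\mathsf{B}}\})\cup\{\mathbf{a}\}\}\mid x,f_{\mathsf{B}}(m_{\mathsf{B}}))$; $P_{e,\mathrm{mal}\,\mathsf{B}}=\max_{y\in\mathcal{Y}^n}\frac{1}{N_{\mathsf{A}}}\sum_{m_{\mathsf{A}}}W^n(\{z:\phi(z)\notin(\{m_{\mathsf{A}}\}\times\mathcal{M}_{\mathsf{B}})\cup\{\mathbf{b}\}\}\mid f_{\mathsf{A}}(m_{\mathsf{A}}),y)$. The average probability of error is $P_e=\max\{P_{e,\mathrm{hon}},P_{e,\mathrm{mal}\,\mathsf{A}},P_{e,\mathrm{mal}\,\mathsf{B}}\}$. **Capacity region.** $(R_{\mathsf{A}},R_{\mathsf{B}})$ (nonnegative reals) is achievable if there is a sequence of $(\lfloor 2^{nR_{\mathsf{A}}}\rfloor,\lfloor 2^{nR_{\mathsf{B}}}\rfloor,n)$ adversary identifying codes, $n=1,2,\dots$, with $P_e\to0$. $\mathcal{C}\subseteq\mathbb{R}^2$ is the closure of the set of achievable pairs. *)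

theory Defs
  imports "HOL-Probability.Probability"
begin

definition inputs :: "nat set" where
  "inputs = {0, 1}"

definition outputs :: "nat set" where
  "outputs = {0, 1, 2}"

text \<open>A word over an alphabet is an extensional function: it is \<open>undefined\<close> outside \<open>{..<n}\<close>.\<close>

type_synonym word = "nat \<Rightarrow> nat"

definition words :: "nat set \<Rightarrow> nat \<Rightarrow> word set" where
  "words A n = {..<n} \<rightarrow>\<^sub>E A"

text \<open>\<open>W x y\<close> is the output distribution for the inputs \<open>x\<close>, \<open>y\<close>. Only \<open>x, y \<in> inputs\<close> matter,
  and for these the distribution is meant to be supported on \<open>outputs\<close>.\<close>

type_synonym channel = "nat \<Rightarrow> nat \<Rightarrow> nat pmf"

text \<open>The default value \<open>undefined\<close> makes the outputs of the product channel extensional as well.\<close>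

definition product_channel :: "channel \<Rightarrow> nat \<Rightarrow> word \<Rightarrow> word \<Rightarrow> word pmf" where
  "product_channel W n x y = Pi_pmf {..<n} undefined (\<lambda>i. W (x i) (y i))"

definition erasure_mac :: channel where
  "erasure_mac x y = return_pmf (x + y)"

definition num_messages :: "real \<Rightarrow> nat \<Rightarrow> nat" where
  "num_messages R n = nat \<lfloor>2 powr (real n * R)\<rfloor>"


datatype decision = Messages "nat \<times> nat" | Adversary_A | Adversary_B

definition adv_id_code ::
  "nat \<Rightarrow> nat \<Rightarrow> nat \<Rightarrow> (nat \<Rightarrow> word) \<Rightarrow> (nat \<Rightarrow> word) \<Rightarrow> (word \<Rightarrow> decision) \<Rightarrow> bool" where
  "adv_id_code N\<^sub>A N\<^sub>B n f\<^sub>A f\<^sub>B \<phi> \<longleftrightarrow>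
     f\<^sub>A \<in> {1..N\<^sub>A} \<rightarrow> words inputs n \<and>
     f\<^sub>B \<in> {1..N\<^sub>B} \<rightarrow> words inputs n \<and>
     \<phi> \<in> words outputs n \<rightarrow> Messages ` ({1..N\<^sub>A} \<times> {1..N\<^sub>B}) \<union> {Adversary_A, Adversary_B}"

definition err_honest ::
  "channel \<Rightarrow> nat \<Rightarrow> nat \<Rightarrow> nat \<Rightarrow> (nat \<Rightarrow> word) \<Rightarrow> (nat \<Rightarrow> word) \<Rightarrow> (word \<Rightarrow> decision) \<Rightarrow> real" where
  "err_honest W N\<^sub>A N\<^sub>B n f\<^sub>A f\<^sub>B \<phi> =
     1 / (real N\<^sub>A * real N\<^sub>B) *
       (\<Sum>m\<^sub>A\<in>{1..N\<^sub>A}. \<Sum>m\<^sub>B\<in>{1..N\<^sub>B}.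
          measure_pmf.prob (product_channel W n (f\<^sub>A m\<^sub>A) (f\<^sub>B m\<^sub>B))
            {z \<in> words outputs n. \<phi> z \<noteq> Messages (m\<^sub>A, m\<^sub>B)})"

definition err_malicious_A ::
  "channel \<Rightarrow> nat \<Rightarrow> nat \<Rightarrow> nat \<Rightarrow> (nat \<Rightarrow> word) \<Rightarrow> (word \<Rightarrow> decision) \<Rightarrow> real" where
  "err_malicious_A W N\<^sub>A N\<^sub>B n f\<^sub>B \<phi> =
     (MAX x\<in>words inputs n.
        1 / real N\<^sub>B *
          (\<Sum>m\<^sub>B\<in>{1..N\<^sub>B}.
             measure_pmf.prob (product_channel W n x (f\<^sub>B m\<^sub>B))
               {z \<in> words outputs n. \<phi> z \<notin> Messages ` ({1..N\<^sub>A} \<times> {m\<^sub>B}) \<union> {Adversary_A}}))"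

definition err_malicious_B ::
  "channel \<Rightarrow> nat \<Rightarrow> nat \<Rightarrow> nat \<Rightarrow> (nat \<Rightarrow> word) \<Rightarrow> (word \<Rightarrow> decision) \<Rightarrow> real" where
  "err_malicious_B W N\<^sub>A N\<^sub>B n f\<^sub>A \<phi> =
     (MAX y\<in>words inputs n.
        1 / real N\<^sub>A *
          (\<Sum>m\<^sub>A\<in>{1..N\<^sub>A}.
             measure_pmf.prob (product_channel W n (f\<^sub>A m\<^sub>A) y)
               {z \<in> words outputs n. \<phi> z \<notin> Messages ` ({m\<^sub>A} \<times> {1..N\<^sub>B}) \<union> {Adversary_B}}))"

definition err_adv_id ::
  "channel \<Rightarrow> nat \<Rightarrow> nat \<Rightarrow> nat \<Rightarrow> (nat \<Rightarrow> word) \<Rightarrow> (nat \<Rightarrow> word) \<Rightarrow> (word \<Rightarrow> decision) \<Rightarrow> real" where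
  "err_adv_id W N\<^sub>A N\<^sub>B n f\<^sub>A f\<^sub>B \<phi> =
     Max {err_honest W N\<^sub>A N\<^sub>B n f\<^sub>A f\<^sub>B \<phi>,
          err_malicious_A W N\<^sub>A N\<^sub>B n f\<^sub>B \<phi>,
          err_malicious_B W N\<^sub>A N\<^sub>B n f\<^sub>A \<phi>}"

definition adv_id_achievable :: "channel \<Rightarrow> real \<Rightarrow> real \<Rightarrow> bool" where
  "adv_id_achievable W R\<^sub>A R\<^sub>B \<longleftrightarrow>
     0 \<le> R\<^sub>A \<and> 0 \<le> R\<^sub>B \<and>
     (\<exists>f\<^sub>A f\<^sub>B \<phi>.
        (\<forall>n\<ge>1. adv_id_code (num_messages R\<^sub>A n) (num_messages R\<^sub>B n) n (f\<^sub>A n) (f\<^sub>B n) (\<phi> n)) \<and>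
        (\<lambda>n. err_adv_id W (num_messages R\<^sub>A n) (num_messages R\<^sub>B n) n (f\<^sub>A n) (f\<^sub>B n) (\<phi> n))
          \<longlonglongrightarrow> 0)"

definition adv_id_capacity_region :: "channel \<Rightarrow> (real \<times> real) set" where
  "adv_id_capacity_region W = closure {(R\<^sub>A, R\<^sub>B). adv_id_achievable W R\<^sub>A R\<^sub>B}"


definition mac_code ::
  "nat \<Rightarrow> nat \<Rightarrow> nat \<Rightarrow> (nat \<Rightarrow> word) \<Rightarrow> (nat \<Rightarrow> word) \<Rightarrow> (word \<Rightarrow> nat \<times> nat) \<Rightarrow> bool" where
  "mac_code N\<^sub>A N\<^sub>B n f\<^sub>A f\<^sub>B \<phi> \<longleftrightarrow>
     f\<^sub>A \<in> {1..N\<^sub>A} \<rightarrow> words inputs n \<and>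
     f\<^sub>B \<in> {1..N\<^sub>B} \<rightarrow> words inputs n \<and>
     \<phi> \<in> words outputs n \<rightarrow> {1..N\<^sub>A} \<times> {1..N\<^sub>B}"

definition err_mac ::
  "channel \<Rightarrow> nat \<Rightarrow> nat \<Rightarrow> nat \<Rightarrow> (nat \<Rightarrow> word) \<Rightarrow> (nat \<Rightarrow> word) \<Rightarrow> (word \<Rightarrow> nat \<times> nat) \<Rightarrow> real" where
  "err_mac W N\<^sub>A N\<^sub>B n f\<^sub>A f\<^sub>B \<phi> =
     1 / (real N\<^sub>A * real N\<^sub>B) *
       (\<Sum>m\<^sub>A\<in>{1..N\<^sub>A}. \<Sum>m\<^sub>B\<in>{1..N\<^sub>B}.
          measure_pmf.prob (product_channel W n (f\<^sub>A m\<^sub>A) (f\<^sub>B m\<^sub>B))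
            {z \<in> words outputs n. \<phi> z \<noteq> (m\<^sub>A, m\<^sub>B)})"

definition mac_achievable :: "channel \<Rightarrow> real \<Rightarrow> real \<Rightarrow> bool" where
  "mac_achievable W R\<^sub>A R\<^sub>B \<longleftrightarrow>
     0 \<le> R\<^sub>A \<and> 0 \<le> R\<^sub>B \<and>
     (\<exists>f\<^sub>A f\<^sub>B \<phi>.
        (\<forall>n\<ge>1. mac_code (num_messages R\<^sub>A n) (num_messages R\<^sub>B n) n (f\<^sub>A n) (f\<^sub>B n) (\<phi> n)) \<and>
        (\<lambda>n. err_mac W (num_messages R\<^sub>A n) (num_messages R\<^sub>B n) n (f\<^sub>A n) (f\<^sub>B n) (\<phi> n))
          \<longlonglongrightarrow> 0)"

definition mac_capacity_region :: "channel \<Rightarrow> (real \<times> real) set" where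
  "mac_capacity_region W = closure {(R\<^sub>A, R\<^sub>B). mac_achievable W R\<^sub>A R\<^sub>B}"

end

theory Submission
  imports Defs "HOL-Real_Asymp.Real_Asymp"
begin

text \<open>
  One inclusion only reinterprets accusations as messages. For the other one, the sum-rate converse
  bounds the non-adversarial region by \<open>R\<^sub>A \<le> 1\<close>, \<open>R\<^sub>B \<le> 1\<close>, \<open>R\<^sub>A + R\<^sub>B \<le> 3 / 2\<close>: the code letters of the two
  users have independent distributions, and the cross entropy of \<open>X + Y\<close> relative to \<open>(1 - r, 1, r) / 2\<close>
  with \<open>r = (P (X = 1) + P (Y = 1)) / 2\<close> is at most \<open>3 / 2\<close>.

  The interior of this region is reached by a recursion. Both users send \<open>n\<close> uncoded bits. If \<open>A\<close> sends an
  arbitrary \<open>x\<close> and \<open>B\<close> a uniform \<open>y\<close>, then the set of erasures \<open>{i. x i \<noteq> y i}\<close> is uniform, so about \<open>n / 2\<close>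
  linear hash bits of \<open>y\<close>, taken blockwise, determine \<open>y\<close> on most blocks. If instead \<open>B\<close> is dishonest and
  claims a hash value that its word does not have in many blocks, then with high probability some block has no
  word consistent with the output, which exposes \<open>B\<close>. In every case both words are known up to few blocks,
  and short colours of the words repair the rest; a colour that cannot be matched exposes its sender.
  The hash is sent by a code of the previous stage while \<open>A\<close> sends further bits, the colours by a
  low-rate code. If the cost of \<open>\<alpha>\<close> bits of \<open>A\<close> and \<open>1 / 2\<close> bit of \<open>B\<close> is \<open>\<gamma>\<close> channel uses, then
  \<open>1 + \<alpha>\<close> and \<open>1\<close> bits cost \<open>1 + \<gamma>\<close> uses, and iterating converges to the corner point \<open>(1, 1 / 2)\<close>.
\<close>

subsection \<open>Codes that only name the tags of the messages\<close>

text \<open>The hash is taken blockwise because of a lying \<open>B\<close>. With one hash for the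
  whole word, the argument exposing a false claim would need \<open>A\<close> to send exactly the
  word of \<open>B\<close>, an event of probability 2^-n. A block of fixed length l agrees with the
  uniform block of \<open>A\<close> with probability 2^-l; the output then has no erasure, reveals
  the block and contradicts the claim. More than T false blocks thus survive with probability at
  most (1 - 2^-l)^T, which vanishes as T grows. The price is that each block hash fails with a small
  constant probability, so decoding is correct only up to a small fraction of the blocks. This is
  why colours are needed: they properly colour the graph joining words that differ in few blocks.

  Only \<open>B\<close> is hashed, since a known block of \<open>B\<close> can be subtracted from
  the output to give the block of \<open>A\<close>.

  The recursion is forced by the sum rate. If \<open>A\<close> were idle while the hash is sent, 2n
  bits would cost about 3n/2 uses, a sum rate of 4/3; only when \<open>A\<close> uses the hash phase
  as well does the sum rate rise towards 3/2.\<close>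

datatype ('a, 'b) verdict = Msg 'a 'b | Blame_A | Blame_B

definition recv :: "bool list \<Rightarrow> bool list \<Rightarrow> nat list" where
  "recv x y = map2 (\<lambda>a b. of_bool a + of_bool b) x y"

text \<open>The suffix names the user who may be dishonest, and the second argument is the message
  of the other, honest user. A verdict may say anything about the message of the suspect.\<close>

definition safe_A :: "('a, 'b) verdict \<Rightarrow> 'b \<Rightarrow> bool" where
  "safe_A v b \<longleftrightarrow> v = Blame_A \<or> (\<exists>a. v = Msg a b)"

definition safe_B :: "('a, 'b) verdict \<Rightarrow> 'a \<Rightarrow> bool" where
  "safe_B v a \<longleftrightarrow> v = Blame_B \<or> (\<exists>b. v = Msg a b)"

text \<open>The honest error is not part of \<open>tag_code\<close>: if both users are honest, a verdict that is safe for both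
  possible adversaries is the correct pair. Encoders see a message only through its tag, so an error bound
  for tags that are nearly uniform carries over.\<close>

definition tag_code ::
  "'a set \<Rightarrow> 'b set \<Rightarrow> ('a \<Rightarrow> 's) \<Rightarrow> ('b \<Rightarrow> 't) \<Rightarrow> nat \<Rightarrow> real \<Rightarrow> bool" where
  "tag_code MA MB sA sB n e \<longleftrightarrow> (\<exists>fA fB (d :: nat list \<Rightarrow> ('s, 't) verdict).
     (\<forall>a\<in>MA. length (fA (sA a)) = n) \<and> (\<forall>b\<in>MB. length (fB (sB b)) = n) \<and>
     (\<forall>x. length x = n \<longrightarrow>
        real (card {b\<in>MB. \<not> safe_A (d (recv x (fB (sB b)))) (sB b)}) \<le> e * real (card MB)) \<and>
     (\<forall>y. length y = n \<longrightarrow>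
        real (card {a\<in>MA. \<not> safe_B (d (recv (fA (sA a)) y)) (sA a)}) \<le> e * real (card MA)))"

abbreviation id_code :: "'a set \<Rightarrow> 'b set \<Rightarrow> nat \<Rightarrow> real \<Rightarrow> bool" where
  "id_code MA MB n e \<equiv> tag_code MA MB (\<lambda>a. a) (\<lambda>b. b) n e"

lemma safe_simps [simp]:
  "safe_A Blame_A b" "\<not> safe_A Blame_B b" "safe_A (Msg a b') b \<longleftrightarrow> b' = b"
  "safe_B Blame_B a" "\<not> safe_B Blame_A a" "safe_B (Msg a' b) a \<longleftrightarrow> a' = a"
  by (auto simp: safe_A_def safe_B_def)

lemma length_recv [simp]: "length (recv x y) = min (length x) (length y)"
  by (simp add: recv_def)

lemma nth_recv:
  "i < length x \<Longrightarrow> i < length y \<Longrightarrow> recv x y ! i = of_bool (x ! i) + of_bool (y ! i)"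
  by (simp add: recv_def)

lemma take_recv: "take n (recv x y) = recv (take n x) (take n y)"
  by (simp add: recv_def take_map take_zip)

lemma drop_recv: "drop n (recv x y) = recv (drop n x) (drop n y)"
  by (simp add: recv_def drop_map drop_zip)

lemma recv_commute: "recv x y = recv y x"
proof (rule nth_equalityI)
  show "length (recv x y) = length (recv y x)" by simp
  fix i assume "i < length (recv x y)"
  then show "recv x y ! i = recv y x ! i" by (simp add: nth_recv)
qed

lemma recv_inject:
  assumes "recv x y = recv x' y'" "length x = n" "length x' = n" "length y = n" "length y' = n" "y = y'"
  shows "x = x'"
proof (rule nth_equalityI)
  show "length x = length x'" using assms by simp
  fix i assume i: "i < length x"
  have "recv x y ! i = recv x' y' ! i" using assms by simp
  then show "x ! i = x' ! i" using i assms
    by (auto simp: nth_recv of_bool_def split: if_splits)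
qed

lemma tag_codeI:
  fixes fA :: "'s \<Rightarrow> bool list" and d :: "nat list \<Rightarrow> ('s, 't) verdict"
  assumes "\<And>a. a \<in> MA \<Longrightarrow> length (fA (sA a)) = n" "\<And>b. b \<in> MB \<Longrightarrow> length (fB (sB b)) = n"
    "\<And>x. length x = n \<Longrightarrow>
       real (card {b\<in>MB. \<not> safe_A (d (recv x (fB (sB b)))) (sB b)}) \<le> e * real (card MB)"
    "\<And>y. length y = n \<Longrightarrow>
       real (card {a\<in>MA. \<not> safe_B (d (recv (fA (sA a)) y)) (sA a)}) \<le> e * real (card MA)"
  shows "tag_code MA MB sA sB n e"
  unfolding tag_code_def using assms by blast

lemma tag_codeE:
  assumes "tag_code MA MB (sA :: 'a \<Rightarrow> 's) (sB :: 'b \<Rightarrow> 't) n e"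
  obtains fA fB and d :: "nat list \<Rightarrow> ('s, 't) verdict" where
    "\<And>a. a \<in> MA \<Longrightarrow> length (fA (sA a)) = n" "\<And>b. b \<in> MB \<Longrightarrow> length (fB (sB b)) = n"
    "\<And>x. length x = n \<Longrightarrow>
       real (card {b\<in>MB. \<not> safe_A (d (recv x (fB (sB b)))) (sB b)}) \<le> e * real (card MB)"
    "\<And>y. length y = n \<Longrightarrow>
       real (card {a\<in>MA. \<not> safe_B (d (recv (fA (sA a)) y)) (sA a)}) \<le> e * real (card MA)"
  using assms unfolding tag_code_def by blast

lemma tag_code_mono:
  assumes "tag_code MA MB sA sB n e" "e \<le> e'"
  shows "tag_code MA MB sA sB n e'"
proof -
  have le: "e * real k \<le> e' * real k" for k using assms(2) by (simp add: mult_right_mono)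
  obtain fA fB d where c: "\<And>a. a \<in> MA \<Longrightarrow> length (fA (sA a)) = n" "\<And>b. b \<in> MB \<Longrightarrow> length (fB (sB b)) = n"
    "\<And>x. length x = n \<Longrightarrow>
       real (card {b\<in>MB. \<not> safe_A (d (recv x (fB (sB b)))) (sB b)}) \<le> e * real (card MB)"
    "\<And>y. length y = n \<Longrightarrow>
       real (card {a\<in>MA. \<not> safe_B (d (recv (fA (sA a)) y)) (sA a)}) \<le> e * real (card MA)"
    using assms(1) by (rule tag_codeE) auto
  show ?thesis
    by (rule tag_codeI[OF c(1,2) order_trans[OF c(3) le] order_trans[OF c(4) le]])
qed

primrec swap_verdict :: "('a, 'b) verdict \<Rightarrow> ('b, 'a) verdict" where
  "swap_verdict (Msg a b) = Msg b a"
| "swap_verdict Blame_A = Blame_B"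
| "swap_verdict Blame_B = Blame_A"

lemma safe_swap [simp]:
  "safe_B (swap_verdict v) b \<longleftrightarrow> safe_A v b" "safe_A (swap_verdict v) a \<longleftrightarrow> safe_B v a"
  by (cases v; simp)+

lemma tag_code_swap:
  assumes "tag_code MA MB sA sB n e"
  shows "tag_code MB MA sB sA n e"
proof -
  obtain fA fB d where c: "\<And>a. a \<in> MA \<Longrightarrow> length (fA (sA a)) = n" "\<And>b. b \<in> MB \<Longrightarrow> length (fB (sB b)) = n"
    "\<And>x. length x = n \<Longrightarrow>
       real (card {b\<in>MB. \<not> safe_A (d (recv x (fB (sB b)))) (sB b)}) \<le> e * real (card MB)"
    "\<And>y. length y = n \<Longrightarrow>
       real (card {a\<in>MA. \<not> safe_B (d (recv (fA (sA a)) y)) (sA a)}) \<le> e * real (card MA)"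
    using assms(1) by (rule tag_codeE) auto
  show ?thesis
  proof (rule tag_codeI[of MB fB sB n MA fA sA "\<lambda>z. swap_verdict (d z)"])
    fix x :: "bool list" assume "length x = n"
    from c(4)[OF this]
    show "real (card {a\<in>MA. \<not> safe_A (swap_verdict (d (recv x (fA (sA a))))) (sA a)}) \<le> e * real (card MA)"
      by (simp only: safe_swap recv_commute[of x])
  next
    fix y :: "bool list" assume "length y = n"
    from c(3)[OF this]
    show "real (card {b\<in>MB. \<not> safe_B (swap_verdict (d (recv (fB (sB b)) y))) (sB b)}) \<le> e * real (card MB)"
      by (simp only: safe_swap recv_commute[of y])
  qed (use c(1,2) in auto)
qed

text \<open>The bad elements of \<open>M\<close> fill the fibres over the bad elements of
  \<open>P\<close>, and no fibre exceeds its fair share card M / card P by more than the factor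
  \<open>C\<close>. Hence the bad fraction grows by at most that factor.\<close>

lemma card_preimage_le:
  fixes C e :: real
  assumes "finite M" "finite P" "s \<in> M \<rightarrow> P"
    and fib: "\<And>p. p \<in> P \<Longrightarrow> real (card {a\<in>M. s a = p}) * real (card P) \<le> C * real (card M)"
    and bad: "real (card {p\<in>P. Q p}) \<le> e * real (card P)"
    and "0 \<le> C"
  shows "real (card {a\<in>M. Q (s a)}) \<le> C * e * real (card M)"
proof (cases "P = {}")
  case True
  then have "M = {}" using assms(3) by auto
  then show ?thesis by simp
next
  case False
  then have pos: "real (card P) > 0" using assms(2) by (simp add: card_gt_0_iff)
  have "{a\<in>M. Q (s a)} = (\<Union>p\<in>{p\<in>P. Q p}. {a\<in>M. s a = p})" using assms(3) by auto
  then have "card {a\<in>M. Q (s a)} \<le> (\<Sum>p\<in>{p\<in>P. Q p}. card {a\<in>M. s a = p})"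
    using assms(2) by (simp add: card_UN_le)
  then have "real (card {a\<in>M. Q (s a)}) \<le> (\<Sum>p\<in>{p\<in>P. Q p}. real (card {a\<in>M. s a = p}))"
    unfolding of_nat_sum[symmetric] of_nat_le_iff .
  also have "\<dots> \<le> (\<Sum>p\<in>{p\<in>P. Q p}. C * real (card M) / real (card P))"
    by (rule sum_mono) (use fib pos in \<open>simp add: field_simps\<close>)
  also have "\<dots> = real (card {p\<in>P. Q p}) * (C * real (card M) / real (card P))" by simp
  also have "\<dots> \<le> e * real (card P) * (C * real (card M) / real (card P))"
    by (rule mult_right_mono[OF bad]) (use assms(6) in auto)
  also have "\<dots> = C * e * real (card M)" using pos by simp
  finally show ?thesis .
qed

text \<open>This is how a code for uniform messages transmits a function of a longer message: the
  tag of a uniform message has at most \<open>C\<close> times the uniform probability at each point,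
  so the error is multiplied by at most \<open>C\<close>.\<close>

lemma tag_code_pull:
  fixes C e :: real
  assumes code: "id_code PA PB n e" and fin: "finite MA" "finite MB" "finite PA" "finite PB"
    and maps: "sA \<in> MA \<rightarrow> PA" "sB \<in> MB \<rightarrow> PB" and "0 \<le> C"
    and fibA: "\<And>p. p \<in> PA \<Longrightarrow> real (card {a\<in>MA. sA a = p}) * real (card PA) \<le> C * real (card MA)"
    and fibB: "\<And>p. p \<in> PB \<Longrightarrow> real (card {b\<in>MB. sB b = p}) * real (card PB) \<le> C * real (card MB)"
  shows "tag_code MA MB sA sB n (C * e)"
proof -
  obtain fA fB d where c:
    "\<forall>a\<in>PA. length (fA a) = n" "\<forall>b\<in>PB. length (fB b) = n"
    "\<forall>x. length x = n \<longrightarrow>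
        real (card {b\<in>PB. \<not> safe_A (d (recv x (fB b))) b}) \<le> e * real (card PB)"
    "\<forall>y. length y = n \<longrightarrow>
        real (card {a\<in>PA. \<not> safe_B (d (recv (fA a) y)) a}) \<le> e * real (card PA)"
    using code unfolding tag_code_def by blast
  show ?thesis unfolding tag_code_def
  proof (intro exI[of _ fA] exI[of _ fB] exI[of _ d] conjI ballI allI impI)
    fix a assume "a \<in> MA" then show "length (fA (sA a)) = n" using c(1) maps by auto
  next
    fix b assume "b \<in> MB" then show "length (fB (sB b)) = n" using c(2) maps by auto
  next
    fix x :: "bool list" assume "length x = n"
    then show "real (card {b\<in>MB. \<not> safe_A (d (recv x (fB (sB b)))) (sB b)}) \<le> C * e * real (card MB)"
      using card_preimage_le[OF fin(2,4) maps(2) fibB, of "\<lambda>b. \<not> safe_A (d (recv x (fB b))) b" e]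
        c(3) \<open>0 \<le> C\<close> by auto
  next
    fix y :: "bool list" assume "length y = n"
    then show "real (card {a\<in>MA. \<not> safe_B (d (recv (fA (sA a)) y)) (sA a)}) \<le> C * e * real (card MA)"
      using card_preimage_le[OF fin(1,3) maps(1) fibA, of "\<lambda>a. \<not> safe_B (d (recv (fA a) y)) a" e]
        c(4) \<open>0 \<le> C\<close> by auto
  qed
qed

fun join_verdict :: "('a, 'b) verdict \<Rightarrow> ('c, 'd) verdict \<Rightarrow> ('a \<times> 'c, 'b \<times> 'd) verdict" where
  "join_verdict (Msg a b) (Msg c d) = Msg (a, c) (b, d)"
| "join_verdict Blame_A _ = Blame_A"
| "join_verdict Blame_B _ = Blame_B"
| "join_verdict (Msg a b) Blame_A = Blame_A"
| "join_verdict (Msg a b) Blame_B = Blame_B"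

lemma safe_join:
  "safe_A v b \<Longrightarrow> safe_A w d \<Longrightarrow> safe_A (join_verdict v w) (b, d)"
  "safe_B v a \<Longrightarrow> safe_B w c \<Longrightarrow> safe_B (join_verdict v w) (a, c)"
  by (cases v; cases w; simp)+

lemma card_bad_Un:
  fixes e e' :: real
  assumes "finite M" "\<And>m. m \<in> M \<Longrightarrow> P m \<Longrightarrow> Q m \<or> R m"
    "real (card {m\<in>M. Q m}) \<le> e * real (card M)" "real (card {m\<in>M. R m}) \<le> e' * real (card M)"
  shows "real (card {m\<in>M. P m}) \<le> (e + e') * real (card M)"
proof -
  have "card {m\<in>M. P m} \<le> card ({m\<in>M. Q m} \<union> {m\<in>M. R m})"
    using assms(1,2) by (intro card_mono) auto
  also have "\<dots> \<le> card {m\<in>M. Q m} + card {m\<in>M. R m}" by (rule card_Un_le)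
  finally show ?thesis using assms(3,4) by (simp add: algebra_simps)
qed

text \<open>Outside the union of the two bad sets both verdicts are safe against the same adversary.
  Any blame among them is then correct, so the precedence in \<open>join_verdict\<close> does no
  harm.\<close>

lemma tag_code_join:
  assumes "tag_code MA MB sA sB n e" "tag_code MA MB tA tB n' e'" "finite MA" "finite MB"
  shows "tag_code MA MB (\<lambda>a. (sA a, tA a)) (\<lambda>b. (sB b, tB b)) (n + n') (e + e')"
proof -
  obtain fA fB d where c:
    "\<forall>a\<in>MA. length (fA (sA a)) = n" "\<forall>b\<in>MB. length (fB (sB b)) = n"
    "\<forall>x. length x = n \<longrightarrow>
        real (card {b\<in>MB. \<not> safe_A (d (recv x (fB (sB b)))) (sB b)}) \<le> e * real (card MB)"
    "\<forall>y. length y = n \<longrightarrow>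
        real (card {a\<in>MA. \<not> safe_B (d (recv (fA (sA a)) y)) (sA a)}) \<le> e * real (card MA)"
    using assms(1) unfolding tag_code_def by blast
  obtain gA gB d' where c':
    "\<forall>a\<in>MA. length (gA (tA a)) = n'" "\<forall>b\<in>MB. length (gB (tB b)) = n'"
    "\<forall>x. length x = n' \<longrightarrow>
        real (card {b\<in>MB. \<not> safe_A (d' (recv x (gB (tB b)))) (tB b)}) \<le> e' * real (card MB)"
    "\<forall>y. length y = n' \<longrightarrow>
        real (card {a\<in>MA. \<not> safe_B (d' (recv (gA (tA a)) y)) (tA a)}) \<le> e' * real (card MA)"
    using assms(2) unfolding tag_code_def by blast
  let ?f = "\<lambda>(s, t). fA s @ gA t" and ?g = "\<lambda>(s, t). fB s @ gB t"
  let ?d = "\<lambda>z. join_verdict (d (take n z)) (d' (drop n z))"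
  show ?thesis unfolding tag_code_def
  proof (intro exI[of _ ?f] exI[of _ ?g] exI[of _ ?d] conjI ballI allI impI)
    fix a assume "a \<in> MA" then show "length (?f (sA a, tA a)) = n + n'" using c c' by simp
  next
    fix b assume "b \<in> MB" then show "length (?g (sB b, tB b)) = n + n'" using c c' by simp
  next
    fix x :: "bool list" assume l: "length x = n + n'"
    show "real (card {b\<in>MB. \<not> safe_A (?d (recv x (?g (sB b, tB b)))) (sB b, tB b)}) \<le> (e + e') * real (card MB)"
      by (rule card_bad_Un[OF assms(4) _ c(3)[rule_format, of "take n x"] c'(3)[rule_format, of "drop n x"]])
         (use c(2) c'(2) l in \<open>auto simp: take_recv drop_recv dest: safe_join(1)\<close>)
  next
    fix y :: "bool list" assume l: "length y = n + n'"
    show "real (card {a\<in>MA. \<not> safe_B (?d (recv (?f (sA a, tA a)) y)) (sA a, tA a)}) \<le> (e + e') * real (card MA)"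
      by (rule card_bad_Un[OF assms(3) _ c(4)[rule_format, of "take n y"] c'(4)[rule_format, of "drop n y"]])
         (use c(1) c'(1) l in \<open>auto simp: take_recv drop_recv dest: safe_join(2)\<close>)
  qed
qed

lemma card_fst_fibre:
  assumes "finite A" "finite B" "p \<in> A"
  shows "card {x \<in> A \<times> B. fst x = p} = card B"
proof -
  have "{x \<in> A \<times> B. fst x = p} = {p} \<times> B" using assms by auto
  then show ?thesis by (simp add: card_cartesian_product)
qed

lemma card_snd_fibre:
  assumes "finite A" "finite B" "p \<in> B"
  shows "card {x \<in> A \<times> B. snd x = p} = card A"
proof -
  have "{x \<in> A \<times> B. snd x = p} = A \<times> {p}" using assms by auto
  then show ?thesis by (simp add: card_cartesian_product)
qed

lemma id_code_times:
  assumes "id_code MA MB n e" "id_code MA' MB' n' e'"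
    and fin: "finite MA" "finite MB" "finite MA'" "finite MB'"
  shows "id_code (MA \<times> MA') (MB \<times> MB') (n + n') (e + e')"
proof -
  have 1: "tag_code (MA \<times> MA') (MB \<times> MB') fst fst n (1 * e)"
    by (rule tag_code_pull[OF assms(1)]) (use fin in \<open>auto simp: card_fst_fibre card_cartesian_product\<close>)
  have 2: "tag_code (MA \<times> MA') (MB \<times> MB') snd snd n' (1 * e')"
    by (rule tag_code_pull[OF assms(2)]) (use fin in \<open>auto simp: card_snd_fibre card_cartesian_product\<close>)
  show ?thesis using tag_code_join[OF 1 2] fin by simp
qed

lemma id_code_relabel:
  assumes code: "id_code PA PB n e" and g: "bij_betw g MA PA" and h: "bij_betw h MB PB"
    and fin: "finite PA" "finite PB"
  shows "id_code MA MB n e"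
proof -
  obtain fA fB d where c:
    "\<forall>a\<in>PA. length (fA a) = n" "\<forall>b\<in>PB. length (fB b) = n"
    "\<forall>x. length x = n \<longrightarrow>
        real (card {b\<in>PB. \<not> safe_A (d (recv x (fB b))) b}) \<le> e * real (card PB)"
    "\<forall>y. length y = n \<longrightarrow>
        real (card {a\<in>PA. \<not> safe_B (d (recv (fA a) y)) a}) \<le> e * real (card PA)"
    using code unfolding tag_code_def by blast
  let ?f = "\<lambda>a. fA (g a)" and ?g = "\<lambda>b. fB (h b)"
  let ?d = "\<lambda>z. map_verdict (inv_into MA g) (inv_into MB h) (d z)"
  have gi: "inv_into MA g (g a) = a" if "a \<in> MA" for a
    using g that by (simp add: bij_betw_def)
  have hi: "inv_into MB h (h a) = a" if "a \<in> MB" for a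
    using h that by (simp add: bij_betw_def)
  have sA: "safe_A v (h b) \<Longrightarrow> safe_A (map_verdict (inv_into MA g) (inv_into MB h) v) b" if "b \<in> MB" for v b
    using hi[OF that] by (cases v) auto
  have sB: "safe_B v (g a) \<Longrightarrow> safe_B (map_verdict (inv_into MA g) (inv_into MB h) v) a" if "a \<in> MA" for v a
    using gi[OF that] by (cases v) auto
  have le: "real (card {b\<in>M. R b}) \<le> e * real (card M)"
    if "bij_betw k M P" "finite P" "real (card {p\<in>P. S p}) \<le> e * real (card P)"
      "\<And>b. b \<in> M \<Longrightarrow> R b \<Longrightarrow> S (k b)"
    for k :: "'x \<Rightarrow> 'y" and M P R S
  proof -
    have "card {b\<in>M. R b} \<le> card {p\<in>P. S p}"
    proof (rule card_inj_on_le[of k])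
      show "inj_on k {b\<in>M. R b}" using that(1) by (auto simp: bij_betw_def inj_on_def)
      show "k ` {b\<in>M. R b} \<subseteq> {p\<in>P. S p}" using that(1,4) by (auto simp: bij_betw_def)
    qed (use that(2) in auto)
    then show ?thesis using that(3) bij_betw_same_card[OF that(1)] by simp
  qed
  show ?thesis
  proof (rule tag_codeI[of MA ?f _ n MB ?g _ ?d])
    fix a assume "a \<in> MA" then show "length (?f a) = n" using c g by (auto simp: bij_betw_def)
  next
    fix b assume "b \<in> MB" then show "length (?g b) = n" using c h by (auto simp: bij_betw_def)
  next
    fix x :: "bool list" assume "length x = n"
    then show "real (card {b\<in>MB. \<not> safe_A (?d (recv x (?g b))) b}) \<le> e * real (card MB)"
      by (intro le[OF h fin(2), of "\<lambda>b. \<not> safe_A (d (recv x (fB b))) b"] c(3)[rule_format]) (use sA in blast)+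
  next
    fix y :: "bool list" assume "length y = n"
    then show "real (card {a\<in>MA. \<not> safe_B (?d (recv (?f a) y)) a}) \<le> e * real (card MA)"
      by (intro le[OF g fin(1), of "\<lambda>a. \<not> safe_B (d (recv (fA a) y)) a"] c(4)[rule_format]) (use sB in blast)+
  qed
qed

lemma id_code_card:
  assumes "id_code PA PB n e" "finite PA" "finite PB" "finite MA" "finite MB"
    "card MA = card PA" "card MB = card PB"
  shows "id_code MA MB n e"
proof -
  obtain g where "bij_betw g MA PA" using finite_same_card_bij assms by blast
  moreover obtain h where "bij_betw h MB PB" using finite_same_card_bij assms by blast
  ultimately show ?thesis using id_code_relabel assms by blast
qed

text \<open>The error is an average over the messages, so the bad ones could all lie in the subset
  that is kept; keeping at least half of the messages at most doubles the error. The decoder is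
  unchanged and may still name discarded messages.\<close>

lemma id_code_subset:
  assumes code: "id_code PA PB n e" and fin: "finite PA" "finite PB" and "MA \<subseteq> PA" "MB \<subseteq> PB"
    and half: "card PA \<le> 2 * card MA" "card PB \<le> 2 * card MB" and "0 \<le> e"
  shows "id_code MA MB n (2 * e)"
proof -
  obtain fA fB d where c:
    "\<forall>a\<in>PA. length (fA a) = n" "\<forall>b\<in>PB. length (fB b) = n"
    "\<forall>x. length x = n \<longrightarrow>
        real (card {b\<in>PB. \<not> safe_A (d (recv x (fB b))) b}) \<le> e * real (card PB)"
    "\<forall>y. length y = n \<longrightarrow>
        real (card {a\<in>PA. \<not> safe_B (d (recv (fA a) y)) a}) \<le> e * real (card PA)"
    using code unfolding tag_code_def by blast
  have sub: "real (card {m\<in>M. Q m}) \<le> 2 * e * real (card M)"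
    if "real (card {m\<in>P. Q m}) \<le> e * real (card P)" "M \<subseteq> P" "finite P" "card P \<le> 2 * card M"
    for M P and Q
  proof -
    have "card {m\<in>M. Q m} \<le> card {m\<in>P. Q m}" using that by (intro card_mono) auto
    moreover have "e * real (card P) \<le> e * (2 * real (card M))"
      using that(4) \<open>0 \<le> e\<close> by (intro mult_left_mono) linarith+
    ultimately show ?thesis using that(1) by (simp add: algebra_simps)
  qed
  show ?thesis
  proof (rule tag_codeI[of MA fA _ n MB fB _ d])
    fix x :: "bool list" assume "length x = n"
    then show "real (card {b\<in>MB. \<not> safe_A (d (recv x (fB b))) b}) \<le> 2 * e * real (card MB)"
      using sub[OF c(3)[rule_format] assms(5) fin(2) half(2)] by blast
  next
    fix y :: "bool list" assume "length y = n"
    then show "real (card {a\<in>MA. \<not> safe_B (d (recv (fA a) y)) a}) \<le> 2 * e * real (card MA)"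
      using sub[OF c(4)[rule_format] assms(4) fin(1) half(1)] by blast
  qed (use c(1,2) assms(4,5) in auto)
qed

lemma id_code_trivial: "id_code {a} {b} n 0"
  unfolding tag_code_def
  by (intro exI[of _ "\<lambda>_. replicate n False"] exI[of _ "\<lambda>_. replicate n False"] exI[of _ "\<lambda>_. Msg a b"])
     auto

text \<open>Only the sizes of the message sets matter, and with powers of two the product of codes
  becomes addition in all parameters.\<close>

definition bit_code :: "nat \<Rightarrow> nat \<Rightarrow> nat \<Rightarrow> real \<Rightarrow> bool" where
  "bit_code k l n e \<longleftrightarrow> id_code {..<2 ^ k :: nat} {..<2 ^ l :: nat} n e"

lemma bit_code_iff:
  assumes "finite MA" "finite MB" "card MA = 2 ^ k" "card MB = 2 ^ l"
  shows "bit_code k l n e \<longleftrightarrow> id_code MA MB n e"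
  unfolding bit_code_def
  using assms id_code_card[of MA MB n e "{..<2^k :: nat}" "{..<2^l :: nat}"]
    id_code_card[of "{..<2^k :: nat}" "{..<2^l :: nat}" n e MA MB] by auto

lemma bit_code_mono: "bit_code k l n e \<Longrightarrow> e \<le> e' \<Longrightarrow> bit_code k l n e'"
  unfolding bit_code_def by (rule tag_code_mono)

lemma bit_code_swap: "bit_code k l n e \<Longrightarrow> bit_code l k n e"
  unfolding bit_code_def by (rule tag_code_swap)

lemma bit_code_zero: "bit_code 0 0 n 0"
  by (subst bit_code_iff[of "{0 :: nat}" "{0 :: nat}"]) (simp_all add: id_code_trivial)

lemma bit_code_add:
  assumes "bit_code k l n e" "bit_code k' l' n' e'"
  shows "bit_code (k + k') (l + l') (n + n') (e + e')"
  using id_code_times[OF assms[unfolded bit_code_def]]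
  by (subst bit_code_iff[of "{..<2 ^ k} \<times> {..<2 ^ k'}" "{..<2 ^ l} \<times> {..<2 ^ l'}"])
     (auto simp: card_cartesian_product power_add)

lemma bit_code_pad:
  assumes "bit_code k l n e" "n \<le> n'"
  shows "bit_code k l n' e"
  using bit_code_add[OF assms(1) bit_code_zero[of "n' - n"]] assms(2) by simp

subsection \<open>Colourings and balanced tags\<close>

text \<open>Vertices are coloured one at a time; at most \<open>D\<close> colours are taken by
  neighbours, so one of the \<open>D\<close> + 1 colours is free.\<close>

lemma greedy_colouring:
  fixes R :: "'a \<Rightarrow> 'a \<Rightarrow> bool"
  assumes "finite V" "\<And>u v. R u v \<Longrightarrow> R v u" "\<And>v. v \<in> V \<Longrightarrow> card {u\<in>V. R v u} \<le> D"
  shows "\<exists>g :: 'a \<Rightarrow> nat. (\<forall>v\<in>V. g v \<le> D) \<and> (\<forall>u\<in>V. \<forall>v\<in>V. R u v \<and> u \<noteq> v \<longrightarrow> g u \<noteq> g v)"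
  using assms(1,3)
proof (induction V rule: finite_induct)
  case empty
  then show ?case by simp
next
  case (insert a V)
  have "card {u\<in>V. R v u} \<le> D" if "v \<in> V" for v
  proof -
    have "card {u\<in>V. R v u} \<le> card {u\<in>insert a V. R v u}" using insert.hyps by (intro card_mono) auto
    also have "\<dots> \<le> D" using insert.prems that by simp
    finally show ?thesis .
  qed
  then obtain g :: "'a \<Rightarrow> nat" where g: "\<forall>v\<in>V. g v \<le> D" "\<forall>u\<in>V. \<forall>v\<in>V. R u v \<and> u \<noteq> v \<longrightarrow> g u \<noteq> g v"
    using insert.IH by auto
  have "card (g ` {u\<in>V. R a u}) \<le> card {u\<in>V. R a u}" using insert.hyps by (simp add: card_image_le)
  also have "\<dots> \<le> card {u\<in>insert a V. R a u}" using insert.hyps by (intro card_mono) auto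
  also have "\<dots> \<le> D" using insert.prems by simp
  finally have "card (g ` {u\<in>V. R a u}) < card {..D}" by simp
  then have "\<not> {..D} \<subseteq> g ` {u\<in>V. R a u}"
    using card_mono[of "g ` {u\<in>V. R a u}" "{..D}"] insert.hyps(1) by auto
  then obtain c where c: "c \<le> D" "c \<notin> g ` {u\<in>V. R a u}"
    by auto
  show ?case
  proof (intro exI[of _ "g(a := c)"] conjI ballI impI)
    fix v assume "v \<in> insert a V" then show "(g(a := c)) v \<le> D" using g c by auto
  next
    fix u v assume "u \<in> insert a V" "v \<in> insert a V" "R u v \<and> u \<noteq> v"
    then show "(g(a := c)) u \<noteq> (g(a := c)) v" using g(2) c(2) assms(2)[of u v] by auto
  qed
qed

text \<open>A code has small error only for uniform messages, so a hash must be refined to an almost uniform tag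
  before it can be sent.\<close>

lemma balanced_refinement:
  fixes c :: "'a \<Rightarrow> 'c"
  assumes "finite M" "c ` M \<subseteq> C" "finite C" "2 * card C \<le> p" "p \<le> card M"
  obtains s :: "'a \<Rightarrow> nat" where "s \<in> M \<rightarrow> {..<p}" "\<And>a b. a \<in> M \<Longrightarrow> b \<in> M \<Longrightarrow> s a = s b \<Longrightarrow> c a = c b"
    "\<And>v. card {a\<in>M. s a = v} * p \<le> 3 * card M"
proof (cases "M = {}")
  case True
  then show ?thesis using that[of "\<lambda>_. 0"] by simp
next
  case False
  obtain e where e: "bij_betw e C {0..<card C}" using ex_bij_betw_finite_nat[OF assms(3)] by blast
  define k where "k a = e (c a)" for a
  have kc: "k a = k b \<Longrightarrow> c a = c b" if "a \<in> M" "b \<in> M" for a b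
    using that assms(2) e unfolding k_def bij_betw_def inj_on_def by blast
  have kQ: "k a < card C" if "a \<in> M" for a
  proof -
    have "e (c a) \<in> e ` C" using that assms(2) by auto
    then show ?thesis using e unfolding k_def bij_betw_def by simp
  qed
  obtain ys where ys: "set ys = M" "distinct ys" using finite_distinct_list[OF assms(1)] by blast
  define xs where "xs = sort_key k ys"
  have xs: "set xs = M" "distinct xs" "sorted (map k xs)" by (auto simp: xs_def ys)
  have len: "length xs = card M" using xs distinct_card by metis
  have "bij_betw ((!) xs) {..<length xs} M" using bij_betw_nth[OF xs(2)] xs(1) by auto
  then have "\<exists>i<card M. xs ! i = a" if "a \<in> M" for a
    using that len unfolding bij_betw_def by (metis imageE lessThan_iff)
  then obtain pos where pos: "\<And>a. a \<in> M \<Longrightarrow> pos a < card M" "\<And>a. a \<in> M \<Longrightarrow> xs ! pos a = a"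
    by metis
  have kmono: "k a \<le> k b" if "a \<in> M" "b \<in> M" "pos a \<le> pos b" for a b
    using sorted_nth_mono[OF xs(3) that(3)] pos that len by simp
  have "card C > 0" using False assms(2,3) by (metis card_gt_0_iff image_is_empty subset_empty)
  then have p: "p > 0" using assms(4) by linarith
  \<comment> \<open>This is 2 * card M / p rounded up. Positions then fall into intervals with index
    below p / 2, which leaves the other half of the tags to the at most p / 2 classes. Rounding
    costs less than one \<open>p\<close>, so t * p \<le> 3 * card M, the origin of the constant
    3.\<close>
  define t where "t = (2 * card M + (p - 1)) div p"
  have "t * p + (2 * card M + (p - 1)) mod p = 2 * card M + (p - 1)" by (simp add: t_def)
  moreover have "(2 * card M + (p - 1)) mod p \<le> p - 1" using p by (metis Suc_pred' less_Suc_eq_le mod_less_divisor)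
  ultimately have t: "2 * card M \<le> t * p" "t * p \<le> 2 * card M + p" by linarith+
  have "t > 0" using t(1) p assms(5) by (metis gr0I mult_zero_left mult_0_right not_le order_less_le_trans nat_0_less_mult_iff zero_less_numeral)
  \<comment> \<open>Both summands are monotone in the position, so the sum determines both.\<close>
  define s where "s a = k a + pos a div t" for a
  have both: "k a = k b \<and> pos a div t = pos b div t" if "a \<in> M" "b \<in> M" "s a = s b" for a b
    using that
  proof (induction "pos a" "pos b" arbitrary: a b rule: linorder_wlog)
    case le
    then have "k a \<le> k b" "pos a div t \<le> pos b div t" using kmono by (auto simp: div_le_mono)
    then show ?case using le unfolding s_def by linarith
  next
    case sym
    then show ?case by metis
  qed
  show ?thesis
  proof (rule that[of s])
    show "s \<in> M \<rightarrow> {..<p}"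
    proof
      fix a assume a: "a \<in> M"
      have "(pos a div t) * (2 * card M) \<le> (pos a div t) * (t * p)" using t by simp
      also have "\<dots> = (pos a div t * t) * p" by simp
      also have "\<dots> \<le> pos a * p" by simp
      also have "\<dots> < card M * p" using pos(1)[OF a] p by simp
      finally have "card M * (2 * (pos a div t)) < card M * p" by (simp add: mult_ac)
      then have "2 * (pos a div t) < p" by (metis mult_less_cancel1)
      then show "s a \<in> {..<p}" using kQ[OF a] assms(4) unfolding s_def by simp
    qed
    show "c a = c b" if "a \<in> M" "b \<in> M" "s a = s b" for a b using both[OF that] kc that by blast
    show "card {a\<in>M. s a = v} * p \<le> 3 * card M" for v
    proof (cases "{a\<in>M. s a = v} = {}")
      case True
      show ?thesis by (simp only: True) simp
    next
      case False
      then obtain a0 where a0: "a0 \<in> M" "s a0 = v" by blast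
      have "card {a\<in>M. s a = v} \<le> card {pos a0 div t * t..<pos a0 div t * t + t}"
      proof (rule card_inj_on_le[of pos])
        show "inj_on pos {a\<in>M. s a = v}"
          using pos(2) by (intro inj_onI) (metis (mono_tags) mem_Collect_eq)
        show "pos ` {a\<in>M. s a = v} \<subseteq> {pos a0 div t * t..<pos a0 div t * t + t}"
        proof safe
          fix a assume "a \<in> M" "v = s a"
          then have "pos a div t = pos a0 div t" using both[of a a0] a0 by simp
          then show "pos a \<in> {pos a0 div t * t..<pos a0 div t * t + t}"
            using div_mult_mod_eq[of "pos a" t] mod_less_divisor[OF \<open>t > 0\<close>, of "pos a"]
            unfolding atLeastLessThan_iff by (metis le_add1 nat_add_left_cancel_less)
        qed
      qed simp
      then have "card {a\<in>M. s a = v} \<le> t" by simp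
      then have "card {a\<in>M. s a = v} * p \<le> t * p" by simp
      then show ?thesis using t(2) assms(5) by linarith
    qed
  qed
qed

section \<open>Hamming distance between words of blocks\<close>

definition hdist :: "nat \<Rightarrow> (nat \<Rightarrow> 'x) \<Rightarrow> (nat \<Rightarrow> 'x) \<Rightarrow> nat" where
  "hdist K xs ys = card {j. j < K \<and> xs j \<noteq> ys j}"

lemma hdist_commute: "hdist K xs ys = hdist K ys xs"
  by (simp add: hdist_def eq_commute)

lemma hdist_triangle: "hdist K xs zs \<le> hdist K xs ys + hdist K ys zs"
proof -
  have "{j. j < K \<and> xs j \<noteq> zs j} \<subseteq> {j. j < K \<and> xs j \<noteq> ys j} \<union> {j. j < K \<and> ys j \<noteq> zs j}" by auto
  then have "hdist K xs zs \<le> card ({j. j < K \<and> xs j \<noteq> ys j} \<union> {j. j < K \<and> ys j \<noteq> zs j})"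
    unfolding hdist_def by (intro card_mono) auto
  then show ?thesis unfolding hdist_def using card_Un_le order_trans by blast
qed

text \<open>A word in the ball is determined by the set of places where it differs from the centre
  and by its entries there.\<close>

lemma card_hdist_ball:
  assumes "finite X" "X \<noteq> {}" "xs \<in> {..<K} \<rightarrow>\<^sub>E X"
  shows "card {ys \<in> {..<K} \<rightarrow>\<^sub>E X. hdist K xs ys \<le> t} \<le> card {D. D \<subseteq> {..<K} \<and> card D \<le> t} * card X ^ t"
proof -
  let ?Ds = "{D. D \<subseteq> {..<K} \<and> card D \<le> t}"
  let ?B = "\<lambda>D. PiE {..<K} (\<lambda>j. if j \<in> D then X else {xs j})"
  have finD: "finite ?Ds" by (rule finite_subset[of _ "Pow {..<K}"]) auto
  have q: "card X \<ge> 1" using assms by (simp add: Suc_leI card_gt_0_iff)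
  have "{ys \<in> {..<K} \<rightarrow>\<^sub>E X. hdist K xs ys \<le> t} \<subseteq> (\<Union>D\<in>?Ds. ?B D)"
  proof
    fix ys assume ys: "ys \<in> {ys \<in> {..<K} \<rightarrow>\<^sub>E X. hdist K xs ys \<le> t}"
    have "{j. j < K \<and> xs j \<noteq> ys j} \<in> ?Ds" using ys by (auto simp: hdist_def)
    moreover have "ys \<in> ?B {j. j < K \<and> xs j \<noteq> ys j}" using ys by (auto simp: PiE_iff)
    ultimately show "ys \<in> (\<Union>D\<in>?Ds. ?B D)" by blast
  qed
  then have "card {ys \<in> {..<K} \<rightarrow>\<^sub>E X. hdist K xs ys \<le> t} \<le> card (\<Union>D\<in>?Ds. ?B D)"
    using finD assms(1) by (intro card_mono) (auto intro!: finite_PiE)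
  also have "\<dots> \<le> (\<Sum>D\<in>?Ds. card (?B D))" by (rule card_UN_le[OF finD])
  also have "\<dots> \<le> (\<Sum>D\<in>?Ds. card X ^ t)"
  proof (rule sum_mono)
    fix D assume D: "D \<in> ?Ds"
    have "card (?B D) = (\<Prod>j<K. if j \<in> D then card X else 1)" by (simp add: card_PiE if_distrib cong: if_cong)
    also have "\<dots> = (\<Prod>j\<in>{..<K} \<inter> D. card X)" by (subst prod.inter_restrict) auto
    also have "\<dots> = card X ^ card ({..<K} \<inter> D)" by simp
    also have "\<dots> = card X ^ card D" using D by (simp add: Int_absorb1)
    also have "\<dots> \<le> card X ^ t" using D q by (intro power_increasing) auto
    finally show "card (?B D) \<le> card X ^ t" .
  qed
  also have "\<dots> = card ?Ds * card X ^ t" by simp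
  finally show ?thesis .
qed

text \<open>This bound is for fixed \<open>t\<close>, where it is polynomial in \<open>K\<close>. If
  \<open>t\<close> grows with \<open>K\<close>, the cruder 2^K below suffices, because
  \<open>K\<close> counts blocks and is small compared with the number of bits.\<close>

lemma card_small_subsets_le_power: "card {D. D \<subseteq> {..<K} \<and> card D \<le> t} \<le> (K + 1) ^ t"
proof -
  have "{D. D \<subseteq> {..<K} \<and> card D \<le> t} \<subseteq> (\<lambda>l. set l \<inter> {..<K}) ` {l. set l \<subseteq> {..K} \<and> length l = t}"
  proof
    fix D assume D: "D \<in> {D. D \<subseteq> {..<K} \<and> card D \<le> t}"
    then have "finite D" using finite_subset by blast
    then obtain l where l: "set l = D" "distinct l" using finite_distinct_list by blast
    \<comment> \<open>The out-of-range entry \<open>K\<close> pads every list to length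
      \<open>t\<close> and disappears on intersecting with {..<K}.\<close>
    let ?l = "l @ replicate (t - card D) K"
    have "length ?l = t" using l D distinct_card by fastforce
    moreover have "set ?l \<subseteq> {..K}" using l D by auto
    moreover have "D = set ?l \<inter> {..<K}" using l D by auto
    ultimately show "D \<in> (\<lambda>l. set l \<inter> {..<K}) ` {l. set l \<subseteq> {..K} \<and> length l = t}" by blast
  qed
  then have "card {D. D \<subseteq> {..<K} \<and> card D \<le> t} \<le> card {l. set l \<subseteq> {..K} \<and> length l = t}"
    by (rule surj_card_le[rotated]) (simp add: finite_lists_length_eq)
  then show ?thesis by (simp add: card_lists_length_eq)
qed

lemma card_small_subsets_le_exp: "card {D. D \<subseteq> {..<K} \<and> card D \<le> t} \<le> 2 ^ K"
proof -
  have "card {D. D \<subseteq> {..<K} \<and> card D \<le> t} \<le> card (Pow {..<K})" by (intro card_mono) auto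
  then show ?thesis by (simp add: card_Pow)
qed

subsection \<open>Linear hashes\<close>

definition blocks :: "nat \<Rightarrow> bool list set" where
  "blocks l = {x. length x = l}"

lemma blocks_eq: "blocks l = {x. set x \<subseteq> UNIV \<and> length x = l}"
  by (simp add: blocks_def)

lemma finite_blocks [simp]: "finite (blocks l)"
  unfolding blocks_eq by (rule finite_lists_length_eq) simp

lemma card_blocks [simp]: "card (blocks l) = 2 ^ l"
  unfolding blocks_eq by (subst card_lists_length_eq) auto

lemma blocks_nonempty [simp]: "blocks l \<noteq> {}"
  using card_blocks[of l] by (metis card.empty power_not_zero zero_neq_numeral)

text \<open>Toggling one fixed element of \<open>D\<close> in \<open>S\<close> changes the parity of
  the intersection, which pairs the even sets with the odd ones.\<close>

lemma card_even_meet: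
  assumes "finite L" "D \<subseteq> L" "D \<noteq> {}"
  shows "2 * card {S\<in>Pow L. even (card (S \<inter> D))} = 2 ^ card L"
proof -
  obtain i where i: "i \<in> D" using assms(3) by blast
  let ?t = "\<lambda>S. if i \<in> S then S - {i} else insert i S"
  have fin: "finite (S \<inter> D)" if "S \<subseteq> L" for S using that assms finite_subset by blast
  have par: "even (card (?t S \<inter> D)) \<longleftrightarrow> odd (card (S \<inter> D))" if "S \<subseteq> L" for S
  proof (cases "i \<in> S")
    case True
    then have "S \<inter> D = insert i ((S - {i}) \<inter> D)" using i by auto
    then have "card (S \<inter> D) = Suc (card ((S - {i}) \<inter> D))"
      using fin[OF that] by (metis Int_iff card_insert_disjoint finite_insert insertI1 Diff_iff singletonI)
    then show ?thesis using True by simp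
  next
    case False
    then have "insert i S \<inter> D = insert i (S \<inter> D)" using i by auto
    then have "card (insert i S \<inter> D) = Suc (card (S \<inter> D))"
      using fin[OF that] False by simp
    then show ?thesis using False by simp
  qed
  have tt: "?t (?t S) = S" for S by auto
  have sub: "?t S \<subseteq> L" if "S \<subseteq> L" for S using that i assms by auto
  have "bij_betw ?t {S\<in>Pow L. even (card (S \<inter> D))} {S\<in>Pow L. odd (card (S \<inter> D))}"
  proof (rule bij_betwI[where g = ?t])
    show "?t \<in> {S\<in>Pow L. even (card (S \<inter> D))} \<rightarrow> {S\<in>Pow L. odd (card (S \<inter> D))}"
    proof
      fix S assume "S \<in> {S\<in>Pow L. even (card (S \<inter> D))}"
      then show "?t S \<in> {S\<in>Pow L. odd (card (S \<inter> D))}"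
        unfolding mem_Collect_eq Pow_iff using par[of S] sub[of S] by blast
    qed
    show "?t \<in> {S\<in>Pow L. odd (card (S \<inter> D))} \<rightarrow> {S\<in>Pow L. even (card (S \<inter> D))}"
    proof
      fix S assume "S \<in> {S\<in>Pow L. odd (card (S \<inter> D))}"
      then show "?t S \<in> {S\<in>Pow L. even (card (S \<inter> D))}"
        unfolding mem_Collect_eq Pow_iff using par[of S] sub[of S] by blast
    qed
  qed (use tt in auto)
  then have "card {S\<in>Pow L. even (card (S \<inter> D))} = card {S\<in>Pow L. odd (card (S \<inter> D))}"
    by (rule bij_betw_same_card)
  moreover have "card (Pow L) = card {S\<in>Pow L. even (card (S \<inter> D))} + card {S\<in>Pow L. odd (card (S \<inter> D))}"
    using assms(1) by (subst card_Un_disjoint[symmetric]) (auto intro!: arg_cong[of _ _ card])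
  ultimately show ?thesis using assms(1) by (simp add: card_Pow)
qed

text \<open>A random check \<open>S\<close> misses each nonempty difference \<open>D\<close> with
  probability 1/2, so some \<open>S\<close> leaves at most half of the total weight undetected;
  repeating this \<open>r\<close> times gives the factor 2^r. This is the random linear hash with
  the randomness removed by averaging.\<close>

lemma parity_checks_exist:
  fixes w :: "'i set \<Rightarrow> real"
  assumes "finite L" "\<D> \<subseteq> Pow L - {{}}"
  shows "\<exists>Ss. length Ss = r \<and> set Ss \<subseteq> Pow L \<and>
           2 ^ r * sum w {D\<in>\<D>. \<forall>S\<in>set Ss. even (card (S \<inter> D))} \<le> sum w \<D>"
  using assms(2)
proof (induction r arbitrary: \<D>)
  case 0
  then show ?case by auto
next
  case (Suc r)
  have fin: "finite \<D>" using Suc.prems assms(1) by (meson finite_Diff finite_Pow_iff finite_subset)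
  have "(\<Sum>S\<in>Pow L. 2 * sum w {D\<in>\<D>. even (card (S \<inter> D))})
      = (\<Sum>S\<in>Pow L. \<Sum>D\<in>\<D>. if even (card (S \<inter> D)) then 2 * w D else 0)"
    by (simp add: sum_distrib_left sum.inter_filter[OF fin] if_distrib[of "(*) 2"] cong: if_cong)
  also have "\<dots> = (\<Sum>D\<in>\<D>. \<Sum>S\<in>Pow L. if even (card (S \<inter> D)) then 2 * w D else 0)" by (rule sum.swap)
  also have "\<dots> = (\<Sum>D\<in>\<D>. real (2 * card {S\<in>Pow L. even (card (S \<inter> D))}) * w D)"
    using assms(1) by (simp add: sum.inter_filter[symmetric] mult_ac)
  also have "\<dots> = (\<Sum>D\<in>\<D>. 2 ^ card L * w D)"
  proof (rule sum.cong[OF refl])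
    fix D assume "D \<in> \<D>"
    then have "D \<subseteq> L" "D \<noteq> {}" using Suc.prems by auto
    then show "real (2 * card {S\<in>Pow L. even (card (S \<inter> D))}) * w D = 2 ^ card L * w D"
      by (subst card_even_meet[OF assms(1)]) auto
  qed
  also have "\<dots> = (\<Sum>S\<in>Pow L. sum w \<D>)" using assms(1) by (simp add: sum_distrib_left card_Pow)
  finally have "(\<Sum>S\<in>Pow L. 2 * sum w {D\<in>\<D>. even (card (S \<inter> D))}) = (\<Sum>S\<in>Pow L. sum w \<D>)" .
  then have "\<not> (\<forall>S\<in>Pow L. sum w \<D> < 2 * sum w {D\<in>\<D>. even (card (S \<inter> D))})"
    using sum_strict_mono[of "Pow L" "\<lambda>_. sum w \<D>" "\<lambda>S. 2 * sum w {D\<in>\<D>. even (card (S \<inter> D))}"] assms(1)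
    by auto
  then obtain S where S: "S \<subseteq> L" "2 * sum w {D\<in>\<D>. even (card (S \<inter> D))} \<le> sum w \<D>"
    by (auto simp: not_less)
  obtain Ss where Ss: "length Ss = r" "set Ss \<subseteq> Pow L"
    "2 ^ r * sum w {D\<in>{D\<in>\<D>. even (card (S \<inter> D))}. \<forall>S\<in>set Ss. even (card (S \<inter> D))}
       \<le> sum w {D\<in>\<D>. even (card (S \<inter> D))}"
    using Suc.IH[of "{D\<in>\<D>. even (card (S \<inter> D))}"] Suc.prems by auto
  have eq: "{D\<in>{D\<in>\<D>. even (card (S \<inter> D))}. \<forall>S\<in>set Ss. even (card (S \<inter> D))}
     = {D\<in>\<D>. \<forall>S\<in>set (S # Ss). even (card (S \<inter> D))}" by auto
  show ?case
    using Ss S unfolding eq by (intro exI[of _ "S # Ss"]) auto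
qed

text \<open>The variance of the size of a uniform subset, multiplied by 4 * 2^card A; it feeds a
  Chebyshev bound.\<close>

lemma sum_card_deviation:
  assumes "finite A"
  shows "(\<Sum>E\<in>Pow A. (2 * real (card E) - real (card A))\<^sup>2) = real (card A) * 2 ^ card A"
  using assms
proof (induction A rule: finite_induct)
  case empty
  then show ?case by simp
next
  case (insert a A)
  have inj: "inj_on (insert a) (Pow A)" using insert.hyps by (auto simp: inj_on_def)
  have "(\<Sum>E\<in>Pow (insert a A). (2 * real (card E) - real (card (insert a A)))\<^sup>2)
    = (\<Sum>E\<in>Pow A. (2 * real (card E) - real (card (insert a A)))\<^sup>2)
      + (\<Sum>E\<in>insert a ` Pow A. (2 * real (card E) - real (card (insert a A)))\<^sup>2)"
    unfolding Pow_insert using insert.hyps by (intro sum.union_disjoint) auto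
  also have "(\<Sum>E\<in>insert a ` Pow A. (2 * real (card E) - real (card (insert a A)))\<^sup>2)
     = (\<Sum>E\<in>Pow A. (2 * real (card (insert a E)) - real (card (insert a A)))\<^sup>2)"
    by (simp add: sum.reindex[OF inj])
  also have "\<dots> = (\<Sum>E\<in>Pow A. (2 * real (card E) - real (card A) + 1)\<^sup>2)"
  proof (rule sum.cong[OF refl])
    fix E assume "E \<in> Pow A"
    then have "finite E" "a \<notin> E" using insert.hyps finite_subset by auto
    then show "(2 * real (card (insert a E)) - real (card (insert a A)))\<^sup>2 = (2 * real (card E) - real (card A) + 1)\<^sup>2"
      using insert.hyps by (simp add: algebra_simps)
  qed
  also have "(\<Sum>E\<in>Pow A. (2 * real (card E) - real (card (insert a A)))\<^sup>2) + \<dots>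
     = (\<Sum>E\<in>Pow A. 2 * (2 * real (card E) - real (card A))\<^sup>2 + 2)"
    using insert.hyps by (simp add: sum.distrib[symmetric]) (simp add: power2_eq_square algebra_simps)
  also have "\<dots> = real (card (insert a A)) * 2 ^ card (insert a A)"
    using insert.hyps insert.IH by (simp add: sum.distrib sum_distrib_left[symmetric] card_Pow algebra_simps)
  finally show ?case .
qed

text \<open>Additivity of parity under symmetric difference, that is, linearity of the hash over the
  field with two elements.\<close>

lemma even_card_add_iff:
  assumes "finite A" "finite B"
  shows "even (card A + card B) \<longleftrightarrow> even (card ((A - B) \<union> (B - A)))"
proof -
  have "card A = card (A - B) + card (A \<inter> B)" "card B = card (B - A) + card (A \<inter> B)"
    using assms by (metis Int_commute card_Diff_subset_Int card_mono add.commute diff_add finite_Int inf_le1 le_add_diff_inverse2)+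
  moreover have "card ((A - B) \<union> (B - A)) = card (A - B) + card (B - A)"
    using assms by (intro card_Un_disjoint) auto
  ultimately show ?thesis by (simp only: even_add) blast
qed

definition supp :: "bool list \<Rightarrow> nat set" where
  "supp y = {i. i < length y \<and> y ! i}"

text \<open>The event that output and hash have a second explanation. Nothing is assumed about the
  word of \<open>A\<close>, so x' ranges over all blocks.\<close>

definition ambiguous :: "nat \<Rightarrow> bool list set \<Rightarrow> (bool list \<Rightarrow> 'h) \<Rightarrow> bool list \<Rightarrow> bool list \<Rightarrow> bool" where
  "ambiguous l Y h x y \<longleftrightarrow>
     (\<exists>y'\<in>Y. y' \<noteq> y \<and> h y' = h y \<and> (\<exists>x'\<in>blocks l. recv x' y' = recv x y))"

text \<open>Where the two inputs agree the output is 0 or 2 and reveals both letters, so two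
  explanations can differ only at erasures.\<close>

lemma recv_eq_imp_differ:
  assumes "recv x' y' = recv x y" "length x = l" "length y = l" "length x' = l" "length y' = l"
    "i < l" "y ! i \<noteq> y' ! i"
  shows "x ! i \<noteq> y ! i"
proof -
  have "recv x' y' ! i = recv x y ! i" using assms(1) by simp
  then show ?thesis using assms(2-) by (auto simp: nth_recv of_bool_def split: if_splits)
qed

text \<open>A second explanation differs from \<open>y\<close> on a nonempty subset D of the erasure
  set E, and D passes all parity checks. Typically E has at most (1/2 + c/2) l elements, hence at
  most 2^((1/2 + c/2) l) subsets, while about (1/2 + c) l checks let each nonempty one pass with
  probability about 2^-((1/2 + c) l). One choice of checks serves every \<open>x\<close>, because
  the failure is bounded by an event that depends on \<open>x\<close> and \<open>y\<close> only
  through E.\<close>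

lemma hash_exists:
  fixes c \<eta> :: real
  assumes "c > 0" "\<eta> > 0"
  shows "\<exists>l0. \<forall>l\<ge>l0. \<exists>r (h :: bool list \<Rightarrow> bool list). real r \<le> (1 / 2 + c) * real l + 1 \<and>
     (\<forall>y. length (h y) = r) \<and>
     (\<forall>x\<in>blocks l. real (card {y\<in>blocks l. ambiguous l (blocks l) h x y}) \<le> \<eta> * 2 ^ l)"
proof -
  have "(\<lambda>l::nat. 1 / (c\<^sup>2 * real l) + 2 powr (- c * real l / 2)) \<longlonglongrightarrow> 0"
    using assms(1) by real_asymp
  then have "\<forall>\<^sub>F l in sequentially. 1 / (c\<^sup>2 * real l) + 2 powr (- c * real l / 2) < \<eta>"
    using assms(2) by (rule order_tendstoD(2))
  then obtain l0 where l0: "\<And>l. l \<ge> l0 \<Longrightarrow> 1 / (c\<^sup>2 * real l) + 2 powr (- c * real l / 2) < \<eta>"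
    unfolding eventually_sequentially by blast
  show ?thesis
  proof (rule exI[of _ "max 1 l0"], rule allI, rule impI)
    fix l assume l: "max 1 l0 \<le> l"
    define L where "L = {..<l}"
    have L: "finite L" "card L = l" by (auto simp: L_def)
    define r where "r = nat \<lceil>(1 / 2 + c) * real l\<rceil>"
    have r: "(1 / 2 + c) * real l \<le> real r" "real r \<le> (1 / 2 + c) * real l + 1"
      unfolding r_def using assms(1) zero_le_mult_iff[of "1 / 2 + c" "real l"] by (auto intro: real_nat_ceiling_ge)
    \<comment> \<open>The threshold lies midway between the mean l / 2 of the number of erasures and
      the hash length; one margin of c * l / 2 pays for the Chebyshev tail, the other for the union
      bound.\<close>
    define t where "t = (1 / 2 + c / 2) * real l"
    \<comment> \<open>The weight of \<open>D\<close> is the number of typical erasure sets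
      containing it, so the total weight of the undetected differences bounds the number of typical
      erasure sets that fail.\<close>
    define w where "w D = real (card {E\<in>Pow L. real (card E) \<le> t \<and> D \<subseteq> E})" for D
    obtain Ss where Ss: "length Ss = r" "set Ss \<subseteq> Pow L"
      "2 ^ r * sum w {D\<in>Pow L - {{}}. \<forall>S\<in>set Ss. even (card (S \<inter> D))} \<le> sum w (Pow L - {{}})"
      using parity_checks_exist[OF L(1) order_refl, of r w] by blast
    define h where "h y = map (\<lambda>S. even (card (S \<inter> supp y))) Ss" for y
    define G where "G = {D\<in>Pow L - {{}}. \<forall>S\<in>set Ss. even (card (S \<inter> D))}"
    define Bad where "Bad = {E\<in>Pow L. \<exists>D\<in>G. D \<subseteq> E}"
    have finG: "finite G" unfolding G_def using L(1) by auto
    have "sum w (Pow L - {{}}) \<le> sum w (Pow L)"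
      by (rule sum_mono2) (auto simp: w_def L)
    also have "\<dots> = (\<Sum>D\<in>Pow L. \<Sum>E\<in>Pow L. if real (card E) \<le> t \<and> D \<subseteq> E then 1 else 0)"
      unfolding w_def using L(1) by (simp add: sum.inter_filter[symmetric])
    also have "\<dots> = (\<Sum>E\<in>Pow L. \<Sum>D\<in>Pow L. if real (card E) \<le> t \<and> D \<subseteq> E then 1 else 0)"
      by (rule sum.swap)
    also have "\<dots> \<le> (\<Sum>E\<in>Pow L. 2 powr t)"
    proof (rule sum_mono)
      fix E assume E: "E \<in> Pow L"
      then have "finite E" using L finite_subset by auto
      have "(\<Sum>D\<in>Pow L. if real (card E) \<le> t \<and> D \<subseteq> E then 1 else 0 :: real) = real (card {D\<in>Pow L. real (card E) \<le> t \<and> D \<subseteq> E})"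
        using L(1) by (simp add: sum.inter_filter[symmetric])
      also have "\<dots> \<le> 2 powr t"
      proof (cases "real (card E) \<le> t")
        case True
        have "card {D\<in>Pow L. real (card E) \<le> t \<and> D \<subseteq> E} \<le> card (Pow E)"
          using \<open>finite E\<close> by (intro card_mono) auto
        then have "real (card {D\<in>Pow L. real (card E) \<le> t \<and> D \<subseteq> E}) \<le> 2 ^ card E"
          using \<open>finite E\<close> by (metis card_Pow of_nat_le_iff of_nat_numeral of_nat_power)
        also have "\<dots> \<le> 2 powr t" using True by (simp add: powr_realpow[symmetric])
        finally show ?thesis .
      qed simp
      finally show "(\<Sum>D\<in>Pow L. if real (card E) \<le> t \<and> D \<subseteq> E then 1 else 0 :: real) \<le> 2 powr t" .
    qed
    also have "\<dots> = 2 ^ l * 2 powr t" using L by (simp add: card_Pow)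
    finally have "2 ^ r * sum w G \<le> 2 ^ l * 2 powr t" using Ss(3) unfolding G_def by linarith
    then have "sum w G \<le> 2 ^ l * 2 powr (t - real r)"
      by (simp add: powr_diff powr_realpow field_simps)
    also have "\<dots> \<le> 2 ^ l * 2 powr (- c * real l / 2)"
      using r(1) by (simp add: t_def algebra_simps)
    finally have sG: "sum w G \<le> 2 ^ l * 2 powr (- c * real l / 2)" .
    have tail: "real (card {E\<in>Pow L. t < real (card E)}) \<le> 2 ^ l * (1 / (c\<^sup>2 * real l))"
    proof -
      have "real (card {E\<in>Pow L. t < real (card E)}) * (c * real l)\<^sup>2
        = (\<Sum>E\<in>{E\<in>Pow L. t < real (card E)}. (c * real l)\<^sup>2)" by simp
      also have "\<dots> \<le> (\<Sum>E\<in>{E\<in>Pow L. t < real (card E)}. (2 * real (card E) - real (card L))\<^sup>2)"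
        using assms(1) by (intro sum_mono power_mono) (auto simp: t_def L algebra_simps)
      also have "\<dots> \<le> (\<Sum>E\<in>Pow L. (2 * real (card E) - real (card L))\<^sup>2)"
        by (rule sum_mono2) (auto simp: L)
      also have "\<dots> = real l * 2 ^ l" using sum_card_deviation[OF L(1)] L(2) by simp
      finally show ?thesis using l assms(1) by (simp add: field_simps power2_eq_square)
    qed
    have "Bad \<subseteq> {E\<in>Pow L. t < real (card E)} \<union> (\<Union>D\<in>G. {E\<in>Pow L. real (card E) \<le> t \<and> D \<subseteq> E})"
      unfolding Bad_def by auto
    then have "card Bad \<le> card ({E\<in>Pow L. t < real (card E)} \<union> (\<Union>D\<in>G. {E\<in>Pow L. real (card E) \<le> t \<and> D \<subseteq> E}))"
      using L finG by (intro card_mono) auto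
    also have "\<dots> \<le> card {E\<in>Pow L. t < real (card E)} + card (\<Union>D\<in>G. {E\<in>Pow L. real (card E) \<le> t \<and> D \<subseteq> E})"
      by (rule card_Un_le)
    also have "\<dots> \<le> card {E\<in>Pow L. t < real (card E)} + (\<Sum>D\<in>G. card {E\<in>Pow L. real (card E) \<le> t \<and> D \<subseteq> E})"
      using card_UN_le[OF finG] by simp
    finally have "real (card Bad) \<le> real (card {E\<in>Pow L. t < real (card E)}) + sum w G"
      unfolding w_def of_nat_sum[symmetric] of_nat_add[symmetric] of_nat_le_iff .
    also have "\<dots> \<le> 2 ^ l * (1 / (c\<^sup>2 * real l) + 2 powr (- c * real l / 2))"
      using tail sG by (simp add: algebra_simps)
    also have "\<dots> \<le> 2 ^ l * \<eta>" using l0[of l] l by (intro mult_left_mono) auto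
    finally have bad: "real (card Bad) \<le> \<eta> * 2 ^ l" by (simp add: mult.commute)
    have "card {y\<in>blocks l. ambiguous l (blocks l) h x y} \<le> card Bad" if x: "x \<in> blocks l" for x
    proof (rule card_inj_on_le)
      \<comment> \<open>For fixed \<open>x\<close> the erasure set determines \<open>y\<close>, so
        bad words can be counted as bad erasure sets.\<close>
      let ?e = "\<lambda>y. {i. i < l \<and> x ! i \<noteq> y ! i}"
      show "inj_on ?e {y\<in>blocks l. ambiguous l (blocks l) h x y}"
      proof (rule inj_onI)
        fix y y' assume y: "y \<in> {y\<in>blocks l. ambiguous l (blocks l) h x y}" "y' \<in> {y\<in>blocks l. ambiguous l (blocks l) h x y}"
          and eq: "?e y = ?e y'"
        have "y ! i = y' ! i" if "i < l" for i using eq that by (auto simp: set_eq_iff)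
        then show "y = y'" using y by (auto simp: blocks_def intro: nth_equalityI)
      qed
      show "?e ` {y\<in>blocks l. ambiguous l (blocks l) h x y} \<subseteq> Bad"
      proof safe
        fix y assume y: "y \<in> blocks l" "ambiguous l (blocks l) h x y"
        then obtain y' x' where y': "y' \<in> blocks l" "y' \<noteq> y" "h y' = h y" "x' \<in> blocks l" "recv x' y' = recv x y"
          unfolding ambiguous_def by blast
        let ?D = "{i. i < l \<and> y ! i \<noteq> y' ! i}"
        have len: "length x = l" "length y = l" "length x' = l" "length y' = l"
          using x y y' by (auto simp: blocks_def)
        have "?D \<noteq> {}" using y'(2) len nth_equalityI[of y' y] by auto
        moreover have "even (card (S \<inter> ?D))" if S: "S \<in> set Ss" for S
        proof -
          have SL: "S \<subseteq> L" using S Ss(2) by auto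
          have "even (card (S \<inter> supp y')) = even (card (S \<inter> supp y))"
            using y'(3) S unfolding h_def by auto
          then have "even (card (S \<inter> supp y) + card (S \<inter> supp y'))" by simp
          then have "even (card ((S \<inter> supp y - S \<inter> supp y') \<union> (S \<inter> supp y' - S \<inter> supp y)))"
            by (subst (asm) even_card_add_iff) (auto simp: supp_def)
          moreover have "(S \<inter> supp y - S \<inter> supp y') \<union> (S \<inter> supp y' - S \<inter> supp y) = S \<inter> ?D"
            using SL len by (auto simp: supp_def L_def)
          ultimately show ?thesis by simp
        qed
        ultimately have "?D \<in> G" by (auto simp: G_def L_def)
        moreover have "?D \<subseteq> ?e y" using recv_eq_imp_differ[OF y'(5) len] by auto
        ultimately show "?e y \<in> Bad" unfolding Bad_def L_def by blast
      qed
      show "finite Bad" using L by (simp add: Bad_def)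
    qed
    then have "\<forall>x\<in>blocks l. real (card {y\<in>blocks l. ambiguous l (blocks l) h x y}) \<le> \<eta> * 2 ^ l"
      using bad by (meson of_nat_le_iff order_trans)
    then show "\<exists>r (h :: bool list \<Rightarrow> bool list). real r \<le> (1 / 2 + c) * real l + 1 \<and> (\<forall>y. length (h y) = r) \<and>
     (\<forall>x\<in>blocks l. real (card {y\<in>blocks l. ambiguous l (blocks l) h x y}) \<le> \<eta> * 2 ^ l)"
      using r Ss(1) by (intro exI[of _ r] exI[of _ h]) (auto simp: h_def)
  qed
qed

subsection \<open>Building blocks of the codes\<close>

text \<open>The word for \<open>i\<close> has its only zero at \<open>i\<close>: an adversary \<open>B\<close> who sends a one at \<open>j\<close> produces an output
  \<open>2\<close> unless \<open>A\<close> sends message \<open>j\<close>.\<close>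

lemma id_code_pulse:
  assumes "N > 0"
  shows "id_code {..<N} {0::nat} N (1 / real N)"
proof -
  define f where "f i = (replicate N True)[i := False]" for i
  define g where "g = replicate N False"
  define d where "d z = (if 2 \<in> set z then Blame_B
      else if \<exists>i<N. z = recv (f i) g then Msg (SOME i. i < N \<and> z = recv (f i) g) (0::nat) else Blame_A)" for z
  have len: "length (f i) = N" "length g = N" for i by (auto simp: f_def g_def)
  have two: "2 \<notin> set (recv x g)" if "length x = N" for x
    using that by (auto simp: in_set_conv_nth nth_recv g_def of_bool_def split: if_splits)
  show ?thesis
  proof (rule tag_codeI[of _ f _ _ _ "\<lambda>_. g" _ d])
    fix x :: "bool list" assume "length x = N"
    then have "{b\<in>{0}. \<not> safe_A (d (recv x g)) b} = {}" using two[of x] by (auto simp: d_def)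
    then show "real (card {b\<in>{0}. \<not> safe_A (d (recv x g)) b}) \<le> 1 / real N * real (card {0::nat})"
      by (simp only: card.empty) simp
  next
    fix y :: "bool list" assume y: "length y = N"
    have "\<exists>j. {a\<in>{..<N}. \<not> safe_B (d (recv (f a) y)) a} \<subseteq> {j}"
    proof (cases "\<exists>j<N. y ! j")
      case True
      then obtain j where j: "j < N" "y ! j" by blast
      have "d (recv (f a) y) = Blame_B" if "a < N" "a \<noteq> j" for a
      proof -
        have "recv (f a) y ! j = 2" using j y that by (simp add: nth_recv len) (simp add: f_def)
        then have "2 \<in> set (recv (f a) y)" using j y len by (metis length_recv min.idem nth_mem)
        then show ?thesis by (simp add: d_def)
      qed
      then have "\<forall>a<N. a \<noteq> j \<longrightarrow> d (recv (f a) y) = Blame_B" by blast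
      then show ?thesis by (intro exI[of _ j]) auto
    next
      case False
      then have yg: "y = g" using y by (intro nth_equalityI) (auto simp: g_def)
      have "d (recv (f a) y) = Msg a 0" if a: "a < N" for a
      proof -
        have uniq: "i = a" if "i < N" "recv (f a) g = recv (f i) g" for i
        proof (rule ccontr)
          assume "i \<noteq> a"
          have "f a = f i" by (rule recv_inject[OF that(2)]) (auto simp: len)
          then have "f a ! a = f i ! a" by simp
          then show False using a \<open>i \<noteq> a\<close> by (simp add: f_def)
        qed
        have "(SOME i. i < N \<and> recv (f a) g = recv (f i) g) = a"
          by (rule some_equality) (use a uniq in blast)+
        then show ?thesis using a two[of "f a"] yg len by (auto simp: d_def)
      qed
      then show ?thesis by auto
    qed
    then obtain j where "{a\<in>{..<N}. \<not> safe_B (d (recv (f a) y)) a} \<subseteq> {j}" by blast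
    then have "card {a\<in>{..<N}. \<not> safe_B (d (recv (f a) y)) a} \<le> card {j}" by (intro card_mono) auto
    then show "real (card {a\<in>{..<N}. \<not> safe_B (d (recv (f a) y)) a}) \<le> 1 / real N * real (card {..<N})"
      using assms by simp
  qed (auto simp: len)
qed

text \<open>The message is sent digit by digit in base \<open>N\<close>, with a union bound over the
  digits. The rate tends to zero, but polynomially many messages need only a small multiple of
  \<open>N\<close> uses; this starts the construction, since the first colours to be sent are
  polynomially many.\<close>

lemma id_code_pulse_power:
  assumes "N > 0"
  shows "id_code {..<N ^ k} {0::nat} (k * N) (real k / real N)"
proof (induction k)
  case 0
  have "{..<N ^ 0} = {0}" by auto
  then show ?case using id_code_trivial[of 0 0 0] by simp
next
  case (Suc k)
  have "id_code ({..<N} \<times> {..<N ^ k}) ({0::nat} \<times> {0::nat}) (N + k * N) (1 / real N + real k / real N)"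
    by (rule id_code_times[OF id_code_pulse[OF assms] Suc.IH]) auto
  then have "id_code {..<N ^ Suc k} {0::nat} (N + k * N) (1 / real N + real k / real N)"
    by (rule id_code_card) (auto simp: card_cartesian_product)
  moreover have "1 / real N + real k / real N = real (Suc k) / real N" by (simp add: add_divide_distrib)
  moreover have "N + k * N = Suc k * N" by simp
  ultimately show ?case by metis
qed

section \<open>Cutting transmissions into blocks\<close>

definition word :: "nat \<Rightarrow> (nat \<Rightarrow> bool list) \<Rightarrow> bool list" where
  "word K xs = concat (map xs [0..<K])"

definition chunk :: "nat \<Rightarrow> nat \<Rightarrow> 'a list \<Rightarrow> 'a list" where
  "chunk l j w = take l (drop (j * l) w)"

lemma length_word:
  assumes "\<And>j. j < K \<Longrightarrow> length (xs j) = l"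
  shows "length (word K xs) = K * l"
  using assms by (induction K) (auto simp: word_def)

lemma chunk_word:
  assumes "\<And>j. j < K \<Longrightarrow> length (xs j) = l" "j < K"
  shows "chunk l j (word K xs) = xs j"
  using assms
proof (induction K)
  case (Suc K)
  have len: "length (word K xs) = K * l" using Suc.prems by (intro length_word) auto
  have w: "word (Suc K) xs = word K xs @ xs K" by (simp add: word_def)
  show ?case
  proof (cases "j = K")
    case True
    then show ?thesis using len Suc.prems by (simp add: w chunk_def)
  next
    case False
    then have j: "j < K" using Suc.prems by simp
    then have "Suc j * l \<le> K * l" by (intro mult_le_mono1) auto
    then have "chunk l j (word (Suc K) xs) = chunk l j (word K xs)"
      using len by (simp add: w chunk_def)
    then show ?thesis using Suc j by simp
  qed
qed simp

lemma length_chunk: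
  assumes "length w = K * l" "j < K"
  shows "length (chunk l j w) = l"
proof -
  have "Suc j * l \<le> K * l" using assms by (intro mult_le_mono1) auto
  then show ?thesis using assms by (simp add: chunk_def)
qed

lemma chunk_recv: "chunk l j (recv x y) = recv (chunk l j x) (chunk l j y)"
  by (simp add: chunk_def take_recv drop_recv)

section \<open>The decoder of one stage\<close>

definition candidates ::
  "nat \<Rightarrow> bool list set \<Rightarrow> (bool list \<Rightarrow> 'h) \<Rightarrow> nat list \<Rightarrow> 'h \<Rightarrow> bool list set" where
  "candidates l Y h z v = {y\<in>Y. h y = v \<and> (\<exists>x\<in>blocks l. recv x y = z)}"

text \<open>The estimate is wrong in at most 2 * T blocks. Two words within that radius of it differ
  in at most 4 * T blocks, which is why the colourings below have to be proper up to distance 4 *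
  T.\<close>

definition nearby :: "nat \<Rightarrow> nat \<Rightarrow> (nat \<Rightarrow> 'x) set \<Rightarrow> ((nat \<Rightarrow> 'x) \<Rightarrow> 'g) \<Rightarrow> (nat \<Rightarrow> 'x) \<Rightarrow> 'g \<Rightarrow> (nat \<Rightarrow> 'x) set" where
  "nearby K T V t ws g = {xs\<in>V. hdist K xs ws \<le> 2 * T \<and> t xs = g}"

text \<open>Whatever \<open>A\<close> sends, the true block of an honest \<open>B\<close> is always
  a candidate and ambiguous blocks are rare, so the three tests that blame \<open>B\<close> rarely
  fail an honest one. Conversely, if these tests pass and \<open>A\<close> is honest, the estimate
  of its word is usually close enough for its colour to match, so a mismatch may be charged to
  \<open>A\<close>. Ambiguous blocks are resolved arbitrarily and left to the colours. The argument
  \<open>e\<close> is the part of the message of \<open>A\<close> that travels with the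
  hash.\<close>

definition stage_decode ::
  "nat \<Rightarrow> nat \<Rightarrow> nat \<Rightarrow> bool list set \<Rightarrow> (bool list \<Rightarrow> 'h) \<Rightarrow> ((nat \<Rightarrow> bool list) \<Rightarrow> 'g) \<Rightarrow>
   ((nat \<Rightarrow> bool list) \<Rightarrow> 'k) \<Rightarrow> nat list \<Rightarrow> 'e \<Rightarrow> (nat \<Rightarrow> 'h) \<Rightarrow> 'g \<Rightarrow> 'k \<Rightarrow>
   ((nat \<Rightarrow> bool list) \<times> 'e, nat \<Rightarrow> bool list) verdict" where
  "stage_decode l K T Y h tA tB z e v gA gB =
    (let cand = (\<lambda>j. candidates l Y h (chunk l j z) (v j));
         ys = (\<lambda>j. SOME y. y \<in> cand j);
         xs = (\<lambda>j. SOME x. x \<in> blocks l \<and> recv x (ys j) = chunk l j z);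
         As = nearby K T ({..<K} \<rightarrow>\<^sub>E blocks l) tA xs gA;
         Bs = nearby K T ({..<K} \<rightarrow>\<^sub>E Y) tB ys gB
     in if (\<exists>j<K. cand j = {}) \<or> T < card {j. j < K \<and> (\<exists>y\<in>cand j. \<exists>y'\<in>cand j. y \<noteq> y')} \<or> Bs = {}
        then Blame_B
        else if As = {} then Blame_A
        else Msg (SOME x. x \<in> As, e) (SOME y. y \<in> Bs))"

lemma nearby_unique:
  assumes proper: "\<And>xs xs'. xs \<in> V \<Longrightarrow> xs' \<in> V \<Longrightarrow> hdist K xs xs' \<le> 4 * T \<Longrightarrow> t xs = t xs' \<Longrightarrow> xs = xs'"
    and "xs \<in> V" "hdist K xs ws \<le> 2 * T"
  shows "nearby K T V t ws (t xs) = {xs}"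
proof
  show "{xs} \<subseteq> nearby K T V t ws (t xs)" using assms by (simp add: nearby_def)
  show "nearby K T V t ws (t xs) \<subseteq> {xs}"
  proof
    fix xs' assume "xs' \<in> nearby K T V t ws (t xs)"
    then have x: "xs' \<in> V" "hdist K xs' ws \<le> 2 * T" "t xs' = t xs" by (auto simp: nearby_def)
    have "hdist K xs xs' \<le> hdist K xs ws + hdist K ws xs'" by (rule hdist_triangle)
    then have "hdist K xs xs' \<le> 4 * T" using assms(3) x(2) hdist_commute[of K ws xs'] by simp
    then show "xs' \<in> {xs}" using proper[OF assms(2) x(1)] x(3) by simp
  qed
qed

text \<open>The values \<open>v\<close> and \<open>gA\<close> are decoded from later transmissions. A dishonest \<open>A\<close> controls \<open>gA\<close>, possibly
  depending on \<open>ys\<close>; therefore \<open>gA\<close> is arbitrary here, and \<open>gB\<close> is in the mirror image below.\<close>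

lemma stage_decode_safe_A:
  assumes Y: "Y \<subseteq> blocks l" and x: "length x = K * l" and ys: "ys \<in> {..<K} \<rightarrow>\<^sub>E Y"
    and v: "\<And>j. j < K \<Longrightarrow> v j = h (ys j)"
    and proper: "\<And>ys ys'. ys \<in> {..<K} \<rightarrow>\<^sub>E Y \<Longrightarrow> ys' \<in> {..<K} \<rightarrow>\<^sub>E Y \<Longrightarrow> hdist K ys ys' \<le> 4 * T \<Longrightarrow>
      tB ys = tB ys' \<Longrightarrow> ys = ys'"
    and few: "card {j. j < K \<and> ambiguous l Y h (chunk l j x) (ys j)} \<le> T"
  shows "safe_A (stage_decode l K T Y h tA tB (recv x (word K ys)) e v gA (tB ys)) ys"
proof -
  define z where "z = recv x (word K ys)"
  define cand where "cand j = candidates l Y h (chunk l j z) (v j)" for j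
  have len: "length (ys j) = l" "ys j \<in> Y" if "j < K" for j using ys Y that by (auto simp: blocks_def)
  have z: "chunk l j z = recv (chunk l j x) (ys j)" if "j < K" for j
    using that len by (simp add: z_def chunk_recv chunk_word)
  have xl: "chunk l j x \<in> blocks l" if "j < K" for j using length_chunk[OF x that] by (simp add: blocks_def)
  have ysc: "ys j \<in> cand j" if "j < K" for j
    using that z[OF that] xl[OF that] len[OF that] v[OF that] by (auto simp: cand_def candidates_def)
  let ?amb = "{j. j < K \<and> ambiguous l Y h (chunk l j x) (ys j)}"
  \<comment> \<open>A candidate other than the true block is exactly a second explanation, so an
    arbitrary choice is correct in every unambiguous block.\<close>
  have amb: "j \<in> ?amb" if "j < K" "y \<in> cand j" "y \<noteq> ys j" for j y
  proof -
    have "y \<in> Y" "h y = h (ys j)" "\<exists>x'\<in>blocks l. recv x' y = recv (chunk l j x) (ys j)"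
      using that z[OF that(1)] v[OF that(1)] by (auto simp: cand_def candidates_def)
    then show ?thesis using that unfolding ambiguous_def by blast
  qed
  have "{j. j < K \<and> (\<exists>y\<in>cand j. \<exists>y'\<in>cand j. y \<noteq> y')} \<subseteq> ?amb" using amb by blast
  then have "card {j. j < K \<and> (\<exists>y\<in>cand j. \<exists>y'\<in>cand j. y \<noteq> y')} \<le> card ?amb" by (intro card_mono) auto
  then have c1: "\<not> T < card {j. j < K \<and> (\<exists>y\<in>cand j. \<exists>y'\<in>cand j. y \<noteq> y')}" using few by linarith
  define ws where "ws j = (SOME y. y \<in> cand j)" for j
  have wsc: "ws j \<in> cand j" if "j < K" for j unfolding ws_def using ysc[OF that] by (rule someI)
  have "{j. j < K \<and> ys j \<noteq> ws j} \<subseteq> ?amb"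
  proof
    fix j assume "j \<in> {j. j < K \<and> ys j \<noteq> ws j}"
    then have "j < K" "ws j \<noteq> ys j" by auto
    then show "j \<in> ?amb" using amb[of j "ws j"] wsc[of j] by blast
  qed
  then have "hdist K ys ws \<le> card ?amb" unfolding hdist_def by (intro card_mono) auto
  then have "hdist K ys ws \<le> 2 * T" using few by linarith
  then have near: "nearby K T ({..<K} \<rightarrow>\<^sub>E Y) tB ws (tB ys) = {ys}" using proper ys by (intro nearby_unique) auto
  have wse: "(\<lambda>j. SOME y. y \<in> cand j) = ws" by (simp add: ws_def fun_eq_iff)
  show ?thesis
    unfolding z_def[symmetric] stage_decode_def Let_def cand_def[symmetric] wse near
    using c1 ysc by auto
qed

text \<open>Equal inputs cause no erasure, so the output has a single explanation. This is the trap
  for a dishonest \<open>B\<close>.\<close>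

lemma recv_self:
  assumes "recv x y' = recv y y" "length x = l" "length y = l" "length y' = l"
  shows "y' = y"
proof (rule nth_equalityI)
  fix i assume "i < length y'"
  then show "y' ! i = y ! i" using recv_eq_imp_differ[OF assms(1,3,3,2,4), of i] assms by auto
qed (use assms in simp)

text \<open>The assumption \<open>caught\<close> splits the lies of \<open>B\<close>. If the claim
  is false in more than \<open>T\<close> blocks, in one of them \<open>A\<close> sent the same block
  as \<open>B\<close>; its only explanation violates the claim, and the empty candidate set blames
  \<open>B\<close>. Otherwise at most \<open>T\<close> blocks are false and, if \<open>B\<close> is
  not blamed, at most \<open>T\<close> are ambiguous; elsewhere the block of \<open>B\<close> is the
  only candidate and subtraction recovers that of \<open>A\<close>. This is the origin of the radius
  2 * T.\<close>

lemma stage_decode_safe_B: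
  assumes Y: "Y \<subseteq> blocks l" and y: "length y = K * l" and xs: "xs \<in> {..<K} \<rightarrow>\<^sub>E blocks l"
    and proper: "\<And>xs xs'. xs \<in> {..<K} \<rightarrow>\<^sub>E blocks l \<Longrightarrow> xs' \<in> {..<K} \<rightarrow>\<^sub>E blocks l \<Longrightarrow> hdist K xs xs' \<le> 4 * T \<Longrightarrow>
      tA xs = tA xs' \<Longrightarrow> xs = xs'"
    and caught: "card {j. j < K \<and> (chunk l j y \<notin> Y \<or> h (chunk l j y) \<noteq> v j)} \<le> T \<or>
      (\<exists>j<K. (chunk l j y \<notin> Y \<or> h (chunk l j y) \<noteq> v j) \<and> xs j = chunk l j y)"
  shows "safe_B (stage_decode l K T Y h tA tB (recv (word K xs) y) e v (tA xs) gB) (xs, e)"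
proof -
  define z where "z = recv (word K xs) y"
  define cand where "cand j = candidates l Y h (chunk l j z) (v j)" for j
  define ws where "ws j = (SOME y. y \<in> cand j)" for j
  define us where "us j = (SOME x. x \<in> blocks l \<and> recv x (ws j) = chunk l j z)" for j
  have xl: "length (xs j) = l" if "j < K" for j using xs that by (auto simp: blocks_def)
  have yl: "length (chunk l j y) = l" if "j < K" for j using length_chunk[OF y that] .
  have z: "chunk l j z = recv (xs j) (chunk l j y)" if "j < K" for j
    using that xl by (simp add: z_def chunk_recv chunk_word)
  let ?bad = "{j. j < K \<and> (chunk l j y \<notin> Y \<or> h (chunk l j y) \<noteq> v j)}"
  let ?amb = "{j. j < K \<and> (\<exists>y\<in>cand j. \<exists>y'\<in>cand j. y \<noteq> y')}"
  have dec: "stage_decode l K T Y h tA tB z e v (tA xs) gB =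
     (if (\<exists>j<K. cand j = {}) \<or> T < card ?amb \<or> nearby K T ({..<K} \<rightarrow>\<^sub>E Y) tB ws gB = {} then Blame_B
      else if nearby K T ({..<K} \<rightarrow>\<^sub>E blocks l) tA us (tA xs) = {} then Blame_A
      else Msg (SOME x. x \<in> nearby K T ({..<K} \<rightarrow>\<^sub>E blocks l) tA us (tA xs), e)
             (SOME y. y \<in> nearby K T ({..<K} \<rightarrow>\<^sub>E Y) tB ws gB))"
    unfolding stage_decode_def Let_def cand_def[symmetric] ws_def[symmetric] us_def[symmetric] by (rule refl)
  show ?thesis
  proof (cases "(\<exists>j<K. cand j = {}) \<or> T < card ?amb")
    case True
    then have "stage_decode l K T Y h tA tB z e v (tA xs) gB = Blame_B" unfolding dec by (metis (no_types, lifting))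
    then show ?thesis unfolding z_def by simp
  next
    case False
    have few: "card ?bad \<le> T"
    proof (rule ccontr)
      assume "\<not> card ?bad \<le> T"
      then obtain j where j: "j < K" "chunk l j y \<notin> Y \<or> h (chunk l j y) \<noteq> v j" "xs j = chunk l j y"
        using caught by blast
      have "cand j = {}"
      proof (rule equals0I)
        fix y' assume "y' \<in> cand j"
        then obtain x' where x': "y' \<in> Y" "h y' = v j" "x' \<in> blocks l" "recv x' y' = recv (xs j) (chunk l j y)"
          using z[OF j(1)] by (auto simp: cand_def candidates_def)
        have "y' = chunk l j y"
          using x' Y j(3) yl[OF j(1)] by (intro recv_self[of x' y' _ l]) (auto simp: blocks_def)
        then show False using x' j(2) by auto
      qed
      then show False using False j(1) by blast
    qed
    have "{j. j < K \<and> xs j \<noteq> us j} \<subseteq> ?bad \<union> ?amb"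
    proof (rule subsetI, rule ccontr)
      fix j assume j: "j \<in> {j. j < K \<and> xs j \<noteq> us j}" and nb: "j \<notin> ?bad \<union> ?amb"
      then have jK: "j < K" by simp
      have wj: "ws j \<in> cand j" unfolding ws_def using False jK by (metis equals0I someI)
      have "chunk l j y \<in> cand j"
        using nb jK z[OF jK] xl[OF jK] by (auto simp: cand_def candidates_def blocks_def)
      then have ws: "ws j = chunk l j y" using wj nb jK by blast
      have "\<exists>x. x \<in> blocks l \<and> recv x (ws j) = chunk l j z"
        using z[OF jK] xl[OF jK] ws by (auto simp: blocks_def)
      then have "us j \<in> blocks l \<and> recv (us j) (ws j) = chunk l j z" unfolding us_def by (rule someI_ex)
      then have "us j = xs j"
        using z[OF jK] xl[OF jK] yl[OF jK] ws by (intro recv_inject[of "us j" "chunk l j y" "xs j" "chunk l j y" l]) (auto simp: blocks_def)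
      then show False using j by simp
    qed
    then have "hdist K xs us \<le> card (?bad \<union> ?amb)" unfolding hdist_def by (intro card_mono) auto
    also have "\<dots> \<le> card ?bad + card ?amb" by (rule card_Un_le)
    also have "\<dots> \<le> 2 * T" using few False by linarith
    finally have near: "nearby K T ({..<K} \<rightarrow>\<^sub>E blocks l) tA us (tA xs) = {xs}"
      using proper xs by (intro nearby_unique) auto
    show ?thesis unfolding z_def[symmetric] dec near by auto
  qed
qed

section \<open>Counting words with independent uniform blocks\<close>

lemma card_PiE_coordinate:
  assumes "finite X" "S \<subseteq> X" "j < K"
  shows "card {f \<in> {..<K} \<rightarrow>\<^sub>E X. f j \<in> S} * card X = card S * card X ^ K"
proof -
  have "{f \<in> {..<K} \<rightarrow>\<^sub>E X. f j \<in> S} = PiE {..<K} (\<lambda>i. if i = j then S else X)"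
  proof (rule set_eqI)
    fix f
    show "f \<in> {f \<in> {..<K} \<rightarrow>\<^sub>E X. f j \<in> S} \<longleftrightarrow> f \<in> PiE {..<K} (\<lambda>i. if i = j then S else X)"
      unfolding PiE_iff mem_Collect_eq using assms(2,3) by (smt (verit) lessThan_iff subsetD)
  qed
  then have "card {f \<in> {..<K} \<rightarrow>\<^sub>E X. f j \<in> S} = (\<Prod>i<K. if i = j then card S else card X)"
    by (simp add: card_PiE if_distrib cong: if_cong)
  also have "\<dots> = card S * (\<Prod>i\<in>{..<K} - {j}. card X)"
    using assms by (subst prod.remove[of _ j]) (auto intro!: prod.cong)
  also have "(\<Prod>i\<in>{..<K} - {j}. card X) = card X ^ (K - 1)" using assms by simp
  finally have "card {f \<in> {..<K} \<rightarrow>\<^sub>E X. f j \<in> S} * card X = card S * (card X ^ (K - 1) * card X)"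
    by (simp only: mult.assoc)
  also have "card X ^ (K - 1) * card X = card X ^ K"
    using assms(3) power_minus_mult[of K "card X"] by simp
  finally show ?thesis .
qed

text \<open>Markov's inequality for the number of blocks in which an event of probability at most
  \<eta> occurs.\<close>

lemma card_many_events_le:
  fixes P :: "nat \<Rightarrow> 'x \<Rightarrow> bool" and \<eta> :: real
  assumes "finite Y" "Y \<noteq> {}" "T > 0" "\<And>j. j < K \<Longrightarrow> real (card {y\<in>Y. P j y}) \<le> \<eta> * real (card Y)"
  shows "real (card {ys \<in> {..<K} \<rightarrow>\<^sub>E Y. T < card {j. j < K \<and> P j (ys j)}})
           \<le> \<eta> * real K / real T * real (card ({..<K} \<rightarrow>\<^sub>E Y))"
proof -
  let ?V = "{..<K} \<rightarrow>\<^sub>E Y"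
  let ?B = "{ys \<in> ?V. T < card {j. j < K \<and> P j (ys j)}}"
  have fin: "finite ?V" using assms(1) by (intro finite_PiE) auto
  have q: "real (card Y) > 0" using assms by (simp add: card_gt_0_iff)
  have V: "card ?V = card Y ^ K" by (simp add: card_PiE)
  have "real (card ?B) * real T = (\<Sum>ys\<in>?B. real T)" by simp
  also have "\<dots> \<le> (\<Sum>ys\<in>?B. real (card {j. j < K \<and> P j (ys j)}))" by (intro sum_mono) auto
  also have "\<dots> \<le> (\<Sum>ys\<in>?V. real (card {j. j < K \<and> P j (ys j)}))"
    using fin by (intro sum_mono2) auto
  also have "\<dots> = (\<Sum>ys\<in>?V. \<Sum>j<K. if P j (ys j) then 1 else 0)"
    by (intro sum.cong[OF refl]) (simp add: sum.inter_filter[symmetric])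
  also have "\<dots> = (\<Sum>j<K. \<Sum>ys\<in>?V. if P j (ys j) then 1 else 0)" by (rule sum.swap)
  also have "\<dots> = (\<Sum>j<K. real (card {ys\<in>?V. P j (ys j)}))"
    using fin by (simp add: sum.inter_filter[symmetric])
  also have "\<dots> \<le> (\<Sum>j<K. \<eta> * real (card ?V))"
  proof (rule sum_mono)
    fix j assume "j \<in> {..<K}"
    then have j: "j < K" by simp
    have eq: "{ys\<in>?V. P j (ys j)} = {ys\<in>?V. ys j \<in> {y\<in>Y. P j y}}" using j by auto
    have "card {ys\<in>?V. P j (ys j)} * card Y = card {y\<in>Y. P j y} * card Y ^ K"
      unfolding eq using assms(1) j by (intro card_PiE_coordinate) auto
    then have "real (card {ys\<in>?V. P j (ys j)}) * real (card Y) = real (card {y\<in>Y. P j y}) * real (card ?V)"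
      unfolding V of_nat_mult[symmetric] by simp
    also have "\<dots> \<le> \<eta> * real (card Y) * real (card ?V)" using assms(4)[OF j] by (intro mult_right_mono) auto
    finally show "real (card {ys\<in>?V. P j (ys j)}) \<le> \<eta> * real (card ?V)"
      using q by (simp add: mult.commute mult.left_commute)
  qed
  also have "\<dots> = \<eta> * real K * real (card ?V)" by simp
  finally show ?thesis using assms(3) by (simp add: field_simps)
qed

text \<open>By independence of the blocks, the probability of missing a prescribed block at every
  place of \<open>J\<close> is a product of factors 1 - 1 / card X. Here \<open>J\<close> will be
  the set of falsely claimed blocks.\<close>

lemma card_avoiding_le:
  fixes K :: nat
  assumes "finite X" "J \<subseteq> {..<K}" "T \<le> card J" "\<And>j. j \<in> J \<Longrightarrow> y j \<in> X"
  shows "real (card {xs \<in> {..<K} \<rightarrow>\<^sub>E X. \<forall>j\<in>J. xs j \<noteq> y j})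
           \<le> (1 - 1 / real (card X)) ^ T * real (card ({..<K} \<rightarrow>\<^sub>E X))"
proof (cases "J = {}")
  case True
  then show ?thesis using assms(3) by simp
next
  case False
  then have q: "card X > 0" using assms by (auto simp: card_gt_0_iff)
  have "{xs \<in> {..<K} \<rightarrow>\<^sub>E X. \<forall>j\<in>J. xs j \<noteq> y j} = PiE {..<K} (\<lambda>j. if j \<in> J then X - {y j} else X)"
    using assms(2) by (auto simp: PiE_iff extensional_def split: if_splits)
  then have "real (card {xs \<in> {..<K} \<rightarrow>\<^sub>E X. \<forall>j\<in>J. xs j \<noteq> y j})
      = (\<Prod>j<K. real (card (if j \<in> J then X - {y j} else X)))"
    by (simp only: card_PiE[OF finite_lessThan] of_nat_prod)
  also have "\<dots> = (\<Prod>j<K. (if j \<in> J then 1 - 1 / real (card X) else 1) * real (card X))"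
    using assms q by (intro prod.cong[OF refl]) (auto simp: field_simps of_nat_diff)
  also have "\<dots> = (\<Prod>j<K. if j \<in> J then 1 - 1 / real (card X) else 1) * real (card ({..<K} \<rightarrow>\<^sub>E X))"
    by (simp add: prod.distrib card_PiE)
  also have "(\<Prod>j<K. if j \<in> J then 1 - 1 / real (card X) else 1) = (1 - 1 / real (card X)) ^ card J"
    using assms(2) by (subst prod.inter_restrict[symmetric]) (auto simp: Int_absorb1)
  also have "\<dots> \<le> (1 - 1 / real (card X)) ^ T"
    using q assms(3) by (intro power_decreasing) auto
  finally show ?thesis by (simp add: mult_right_mono)
qed

text \<open>The hash is sent in a separate phase whose \<open>A\<close>-message \<open>e\<close> is independent of \<open>xs\<close>: the hash value that a
  dishonest \<open>B\<close> makes the decoder see may depend on \<open>e\<close>, but not on \<open>xs\<close>.\<close>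

lemma stage_code:
  fixes h :: "bool list \<Rightarrow> 'h" and tA :: "(nat \<Rightarrow> bool list) \<Rightarrow> 'g" and tB :: "(nat \<Rightarrow> bool list) \<Rightarrow> 'k"
    and EA :: "'e set" and \<rho> :: "'s \<Rightarrow> nat \<Rightarrow> 'h"
  defines "V \<equiv> \<lambda>K l. {..<K} \<rightarrow>\<^sub>E blocks l"
  assumes Y: "Y \<subseteq> blocks l" "Y \<noteq> {}" and fin: "finite EA" and T: "T > 0" and \<eta>: "\<eta> \<ge> 0"
    and amb: "\<And>x. x \<in> blocks l \<Longrightarrow> real (card {y\<in>Y. ambiguous l Y h x y}) \<le> \<eta> * real (card Y)"
    and c2: "tag_code (V K l \<times> EA) ({..<K} \<rightarrow>\<^sub>E Y) snd sB n2 e2"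
    and \<rho>: "\<And>ys j. ys \<in> {..<K} \<rightarrow>\<^sub>E Y \<Longrightarrow> j < K \<Longrightarrow> \<rho> (sB ys) j = h (ys j)"
    and c3: "tag_code (V K l \<times> EA) ({..<K} \<rightarrow>\<^sub>E Y) (\<lambda>p. tA (fst p)) tB n3 e3"
    and properA: "\<And>xs xs'. xs \<in> V K l \<Longrightarrow> xs' \<in> V K l \<Longrightarrow> hdist K xs xs' \<le> 4 * T \<Longrightarrow>
        tA xs = tA xs' \<Longrightarrow> xs = xs'"
    and properB: "\<And>ys ys'. ys \<in> {..<K} \<rightarrow>\<^sub>E Y \<Longrightarrow> ys' \<in> {..<K} \<rightarrow>\<^sub>E Y \<Longrightarrow> hdist K ys ys' \<le> 4 * T \<Longrightarrow>
        tB ys = tB ys' \<Longrightarrow> ys = ys'"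
  shows "id_code (V K l \<times> EA) ({..<K} \<rightarrow>\<^sub>E Y) (K * l + (n2 + n3))
           ((\<eta> * real K / real T + (1 - 1 / 2 ^ l) ^ T) + (e2 + e3))"
proof -
  let ?VA = "V K l" and ?VB = "{..<K} \<rightarrow>\<^sub>E Y"
  have finY: "finite Y" using Y(1) finite_blocks finite_subset by blast
  have finB: "finite ?VB" using finY by (intro finite_PiE) auto
  have finA: "finite ?VA" unfolding V_def by (intro finite_PiE) auto
  have finM: "finite (?VA \<times> EA)" using finA fin by simp
  have VAl: "length (xs j) = l" if "xs \<in> ?VA" "j < K" for xs j using that by (auto simp: V_def blocks_def)
  have VBl: "length (ys j) = l" if "ys \<in> ?VB" "j < K" for ys j using that Y by (auto simp: blocks_def)
  obtain fA fB and d :: "nat list \<Rightarrow> ('e, 's) verdict" where c: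
    "\<And>p. p \<in> ?VA \<times> EA \<Longrightarrow> length (fA (snd p)) = n2" "\<And>ys. ys \<in> ?VB \<Longrightarrow> length (fB (sB ys)) = n2"
    "\<And>x. length x = n2 \<Longrightarrow>
       real (card {b\<in>?VB. \<not> safe_A (d (recv x (fB (sB b)))) (sB b)}) \<le> e2 * real (card ?VB)"
    "\<And>y. length y = n2 \<Longrightarrow>
       real (card {a\<in>?VA \<times> EA. \<not> safe_B (d (recv (fA (snd a)) y)) (snd a)}) \<le> e2 * real (card (?VA \<times> EA))"
    using c2 by (rule tag_codeE) blast
  obtain gA gB and d' :: "nat list \<Rightarrow> ('g, 'k) verdict" where c':
    "\<And>p. p \<in> ?VA \<times> EA \<Longrightarrow> length (gA (tA (fst p))) = n3" "\<And>ys. ys \<in> ?VB \<Longrightarrow> length (gB (tB ys)) = n3"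
    "\<And>x. length x = n3 \<Longrightarrow>
       real (card {b\<in>?VB. \<not> safe_A (d' (recv x (gB (tB b)))) (tB b)}) \<le> e3 * real (card ?VB)"
    "\<And>y. length y = n3 \<Longrightarrow>
       real (card {a\<in>?VA \<times> EA. \<not> safe_B (d' (recv (gA (tA (fst a))) y)) (tA (fst a))}) \<le> e3 * real (card (?VA \<times> EA))"
    using c3 by (rule tag_codeE) blast
  define F where "F p = word K (fst p) @ fA (snd p) @ gA (tA (fst p))" for p
  define G where "G ys = word K ys @ fB (sB ys) @ gB (tB ys)" for ys
  define D where "D z = (case d (take n2 (drop (K * l) z)) of Blame_A \<Rightarrow> Blame_A | Blame_B \<Rightarrow> Blame_B
     | Msg e v \<Rightarrow> (case d' (drop n2 (drop (K * l) z)) of Blame_A \<Rightarrow> Blame_A | Blame_B \<Rightarrow> Blame_B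
     | Msg a b \<Rightarrow> stage_decode l K T Y h tA tB (take (K * l) z) e (\<rho> v) a b))" for z
  show ?thesis
  proof (rule tag_codeI[of _ F _ _ _ G _ D])
    fix p assume "p \<in> ?VA \<times> EA"
    then show "length (F p) = K * l + (n2 + n3)"
      using c(1) c'(1) length_word[of K "fst p" l] VAl by (auto simp: F_def)
  next
    fix ys assume "ys \<in> ?VB"
    then show "length (G ys) = K * l + (n2 + n3)"
      using c(2) c'(2) length_word[of K ys l] VBl by (auto simp: G_def)
  next
    fix x :: "bool list" assume x: "length x = K * l + (n2 + n3)"
    define x1 x2 x3 where "x1 = take (K * l) x" and "x2 = take n2 (drop (K * l) x)" and "x3 = drop n2 (drop (K * l) x)"
    have xl: "length x1 = K * l" "length x2 = n2" "length x3 = n3" using x by (auto simp: x1_def x2_def x3_def)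
    let ?Q = "\<lambda>ys. T < card {j. j < K \<and> ambiguous l Y h (chunk l j x1) (ys j)}"
    let ?R = "\<lambda>ys. \<not> safe_A (d (recv x2 (fB (sB ys)))) (sB ys)"
    let ?S = "\<lambda>ys. \<not> safe_A (d' (recv x3 (gB (tB ys)))) (tB ys)"
    have "real (card {ys\<in>?VB. ?Q ys}) \<le> \<eta> * real K / real T * real (card ?VB)"
      using amb length_chunk[OF xl(1)] by (intro card_many_events_le[OF finY Y(2) T]) (auto simp: blocks_def)
    \<comment> \<open>Ambiguity matters only against a dishonest \<open>A\<close> and avoidance of
      the trap only against a dishonest \<open>B\<close>; both terms are added so that one error
      bound serves both cases.\<close>
    moreover have "0 \<le> (1 - 1 / 2 ^ l :: real) ^ T" by simp
    ultimately have Q: "real (card {ys\<in>?VB. ?Q ys}) \<le> (\<eta> * real K / real T + (1 - 1 / 2 ^ l) ^ T) * real (card ?VB)"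
      by (smt (verit) mult_right_mono of_nat_0_le_iff)
    have RS: "real (card {ys\<in>?VB. ?R ys \<or> ?S ys}) \<le> (e2 + e3) * real (card ?VB)"
      by (rule card_bad_Un[OF finB _ c(3)[OF xl(2)] c'(3)[OF xl(3)]]) auto
    show "real (card {ys\<in>?VB. \<not> safe_A (D (recv x (G ys))) ys})
        \<le> ((\<eta> * real K / real T + (1 - 1 / 2 ^ l) ^ T) + (e2 + e3)) * real (card ?VB)"
    proof (rule card_bad_Un[OF finB _ Q RS])
      fix ys assume ys: "ys \<in> ?VB" and bad: "\<not> safe_A (D (recv x (G ys))) ys"
      have wl: "length (word K ys) = K * l" using VBl[OF ys] by (rule length_word)
      have parts: "take (K * l) (recv x (G ys)) = recv x1 (word K ys)"
        "take n2 (drop (K * l) (recv x (G ys))) = recv x2 (fB (sB ys))"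
        "drop n2 (drop (K * l) (recv x (G ys))) = recv x3 (gB (tB ys))"
        using wl c(2)[OF ys] by (simp_all add: G_def take_recv drop_recv x1_def x2_def x3_def)
      show "?Q ys \<or> (?R ys \<or> ?S ys)"
      proof (rule ccontr)
        assume "\<not> ?thesis"
        then have ok: "\<not> ?Q ys" "\<not> ?R ys" "\<not> ?S ys" by auto
        from ok(2) consider "d (recv x2 (fB (sB ys))) = Blame_A" | e where "d (recv x2 (fB (sB ys))) = Msg e (sB ys)"
          by (auto simp: safe_A_def)
        then show False
        proof cases
          case 1
          then show False using bad by (simp add: D_def parts del: drop_drop)
        next
          case (2 e)
          from ok(3) consider "d' (recv x3 (gB (tB ys))) = Blame_A" | a where "d' (recv x3 (gB (tB ys))) = Msg a (tB ys)"
            by (auto simp: safe_A_def)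
          then show False
          proof cases
            case 1
            then show False using bad 2 by (simp add: D_def parts del: drop_drop)
          next
            case (2 a)
            have "safe_A (stage_decode l K T Y h tA tB (recv x1 (word K ys)) e (\<rho> (sB ys)) a (tB ys)) ys"
              using properB ok(1) \<rho>[OF ys] by (intro stage_decode_safe_A[OF Y(1) xl(1) ys]) auto
            then show False using bad 2 \<open>d (recv x2 (fB (sB ys))) = Msg e (sB ys)\<close>
              by (simp add: D_def parts del: drop_drop)
          qed
        qed
      qed
    qed
  next
    fix y :: "bool list" assume y: "length y = K * l + (n2 + n3)"
    define y1 y2 y3 where "y1 = take (K * l) y" and "y2 = take n2 (drop (K * l) y)" and "y3 = drop n2 (drop (K * l) y)"
    have yl: "length y1 = K * l" "length y2 = n2" "length y3 = n3" using y by (auto simp: y1_def y2_def y3_def)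
    \<comment> \<open>Once the word of \<open>B\<close> is fixed, the decoded hash, and with it the
      set \<open>J\<close> of falsely claimed blocks, depends on \<open>e\<close> alone. For each
      fixed \<open>e\<close> the blocks \<open>xs\<close> are still uniform, so the trap can be
      counted separately for each \<open>e\<close>.\<close>
    define claim where "claim e = (case d (recv (fA e) y2) of Msg _ v \<Rightarrow> \<rho> v | _ \<Rightarrow> undefined)" for e
    define J where "J e = {j. j < K \<and> (chunk l j y1 \<notin> Y \<or> h (chunk l j y1) \<noteq> claim e j)}" for e
    let ?Q = "\<lambda>p. T < card (J (snd p)) \<and> (\<forall>j\<in>J (snd p). fst p j \<noteq> chunk l j y1)"
    let ?R = "\<lambda>p. \<not> safe_B (d (recv (fA (snd p)) y2)) (snd p)"
    let ?S = "\<lambda>p. \<not> safe_B (d' (recv (gA (tA (fst p))) y3)) (tA (fst p))"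
    have "{p\<in>?VA \<times> EA. ?Q p} = (\<Union>e\<in>EA. {xs\<in>?VA. ?Q (xs, e)} \<times> {e})" by auto
    then have "card {p\<in>?VA \<times> EA. ?Q p} \<le> (\<Sum>e\<in>EA. card ({xs\<in>?VA. ?Q (xs, e)} \<times> {e}))"
      using card_UN_le[OF fin] by simp
    then have "real (card {p\<in>?VA \<times> EA. ?Q p}) \<le> (\<Sum>e\<in>EA. real (card {xs\<in>?VA. ?Q (xs, e)}))"
      unfolding of_nat_sum[symmetric] of_nat_le_iff by (simp add: card_cartesian_product)
    also have "\<dots> \<le> (\<Sum>e\<in>EA. (1 - 1 / 2 ^ l) ^ T * real (card ?VA))"
    proof (rule sum_mono)
      fix e assume "e \<in> EA"
      show "real (card {xs\<in>?VA. ?Q (xs, e)}) \<le> (1 - 1 / 2 ^ l) ^ T * real (card ?VA)"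
      proof (cases "T < card (J e)")
        case True
        have "chunk l j y1 \<in> blocks l" if "j < K" for j
          using length_chunk[OF yl(1) that] by (simp add: blocks_def)
        then have "real (card {xs\<in>?VA. \<forall>j\<in>J e. xs j \<noteq> chunk l j y1}) \<le> (1 - 1 / real (card (blocks l))) ^ T * real (card ?VA)"
          unfolding V_def using True by (intro card_avoiding_le) (auto simp: J_def)
        then show ?thesis using True by simp
      qed simp
    qed
    also have "\<dots> = (1 - 1 / 2 ^ l) ^ T * real (card (?VA \<times> EA))" by (simp add: card_cartesian_product)
    also have "\<dots> \<le> (\<eta> * real K / real T + (1 - 1 / 2 ^ l) ^ T) * real (card (?VA \<times> EA))"
      using \<eta> by (intro mult_right_mono) auto
    finally have Q: "real (card {p\<in>?VA \<times> EA. ?Q p}) \<le> (\<eta> * real K / real T + (1 - 1 / 2 ^ l) ^ T) * real (card (?VA \<times> EA))" .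
    have RS: "real (card {p\<in>?VA \<times> EA. ?R p \<or> ?S p}) \<le> (e2 + e3) * real (card (?VA \<times> EA))"
      by (rule card_bad_Un[OF finM _ c(4)[OF yl(2)] c'(4)[OF yl(3)]]) auto
    show "real (card {p\<in>?VA \<times> EA. \<not> safe_B (D (recv (F p) y)) p})
        \<le> ((\<eta> * real K / real T + (1 - 1 / 2 ^ l) ^ T) + (e2 + e3)) * real (card (?VA \<times> EA))"
    proof (rule card_bad_Un[OF finM _ Q RS])
      fix p assume p: "p \<in> ?VA \<times> EA" and bad: "\<not> safe_B (D (recv (F p) y)) p"
      obtain xs e where pe: "p = (xs, e)" by (cases p)
      have xs: "xs \<in> ?VA" using p pe by simp
      have wl: "length (word K xs) = K * l" using VAl[OF xs] by (rule length_word)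
      have parts: "take (K * l) (recv (F p) y) = recv (word K xs) y1"
        "take n2 (drop (K * l) (recv (F p) y)) = recv (fA e) y2"
        "drop n2 (drop (K * l) (recv (F p) y)) = recv (gA (tA xs)) y3"
        using wl c(1)[OF p] by (simp_all add: pe F_def take_recv drop_recv y1_def y2_def y3_def)
      show "?Q p \<or> (?R p \<or> ?S p)"
      proof (rule ccontr)
        assume "\<not> ?thesis"
        then have ok: "\<not> ?Q p" "safe_B (d (recv (fA e) y2)) e" "safe_B (d' (recv (gA (tA xs)) y3)) (tA xs)" by (auto simp: pe)
        from ok(2) consider "d (recv (fA e) y2) = Blame_B" | v where "d (recv (fA e) y2) = Msg e v"
          by (auto simp: safe_B_def)
        then show False
        proof cases
          case 1
          then show False using bad by (simp add: D_def parts del: drop_drop)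
        next
          case v: (2 v)
          from ok(3) consider "d' (recv (gA (tA xs)) y3) = Blame_B" | b where "d' (recv (gA (tA xs)) y3) = Msg (tA xs) b"
            by (auto simp: safe_B_def)
          then show False
          proof cases
            case 1
            then show False using bad v by (simp add: D_def parts del: drop_drop)
          next
            case (2 b)
            have cl: "claim e = \<rho> v" using v by (simp add: claim_def)
            have "safe_B (stage_decode l K T Y h tA tB (recv (word K xs) y1) e (\<rho> v) (tA xs) b) (xs, e)"
            proof (rule stage_decode_safe_B[OF Y(1) yl(1)])
              show "xs \<in> {..<K} \<rightarrow>\<^sub>E blocks l" using xs by (simp add: V_def)
              show "card {j. j < K \<and> (chunk l j y1 \<notin> Y \<or> h (chunk l j y1) \<noteq> \<rho> v j)} \<le> T \<or>
                (\<exists>j<K. (chunk l j y1 \<notin> Y \<or> h (chunk l j y1) \<noteq> \<rho> v j) \<and> xs j = chunk l j y1)"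
                using ok(1) unfolding pe J_def cl[symmetric] by auto
            qed (use properA in \<open>auto simp: V_def\<close>)
            then show False using bad v 2 by (simp add: D_def parts[unfolded pe] pe del: drop_drop)
          qed
        qed
      qed
    qed
  qed
qed

subsection \<open>Codes from hashes\<close>

lemma block_colouring:
  assumes "card {D. D \<subseteq> {..<K} \<and> card D \<le> t} * (2 ^ l) ^ t \<le> B"
  obtains g :: "(nat \<Rightarrow> bool list) \<Rightarrow> nat"
  where "\<And>xs. xs \<in> {..<K} \<rightarrow>\<^sub>E blocks l \<Longrightarrow> g xs \<le> B"
    "\<And>xs ys. xs \<in> {..<K} \<rightarrow>\<^sub>E blocks l \<Longrightarrow> ys \<in> {..<K} \<rightarrow>\<^sub>E blocks l \<Longrightarrow> hdist K xs ys \<le> t \<Longrightarrow> g xs = g ys \<Longrightarrow> xs = ys"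
proof -
  let ?V = "{..<K} \<rightarrow>\<^sub>E blocks l"
  have "\<exists>g :: (nat \<Rightarrow> bool list) \<Rightarrow> nat. (\<forall>v\<in>?V. g v \<le> B) \<and>
     (\<forall>u\<in>?V. \<forall>v\<in>?V. hdist K u v \<le> t \<and> u \<noteq> v \<longrightarrow> g u \<noteq> g v)"
  proof (rule greedy_colouring)
    fix xs assume "xs \<in> ?V"
    then have "card {ys \<in> ?V. hdist K xs ys \<le> t} \<le> card {D. D \<subseteq> {..<K} \<and> card D \<le> t} * card (blocks l) ^ t"
      by (intro card_hdist_ball) auto
    then show "card {ys \<in> ?V. hdist K xs ys \<le> t} \<le> B" using assms by simp
  qed (auto simp: hdist_commute intro: finite_PiE)
  then obtain g :: "(nat \<Rightarrow> bool list) \<Rightarrow> nat" where g: "\<forall>v\<in>?V. g v \<le> B"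
    "\<forall>u\<in>?V. \<forall>v\<in>?V. hdist K u v \<le> t \<and> u \<noteq> v \<longrightarrow> g u \<noteq> g v" by auto
  show thesis by (rule that[of g]) (use g in auto)
qed

lemma eventually_power_le_two_power:
  "\<forall>\<^sub>F k :: nat in sequentially. (C * real k) ^ d \<le> 2 ^ k"
proof -
  have "filterlim (\<lambda>k::nat. real k * ln 2) at_top sequentially" by real_asymp
  then have "(\<lambda>k::nat. (real k * ln 2) ^ d / exp (real k * ln 2)) \<longlonglongrightarrow> 0"
    by (rule filterlim_compose[OF tendsto_power_div_exp_0])
  then have "(\<lambda>k::nat. (C / ln 2) ^ d * ((real k * ln 2) ^ d / exp (real k * ln 2))) \<longlonglongrightarrow> (C / ln 2) ^ d * 0"
    by (intro tendsto_mult tendsto_const)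
  then have "\<forall>\<^sub>F k :: nat in sequentially. (C / ln 2) ^ d * ((real k * ln 2) ^ d / exp (real k * ln 2)) < 1"
    by (intro order_tendstoD) auto
  then show ?thesis
  proof eventually_elim
    case (elim k)
    have "exp (real k * ln 2) = 2 ^ k" by (simp add: exp_of_nat_mult)
    moreover have "(C / ln 2) ^ d * (real k * ln 2) ^ d = (C * real k) ^ d"
      unfolding power_mult_distrib[symmetric] by simp
    ultimately show ?case using elim by (simp add: field_simps)
  qed
qed

text \<open>\<open>A\<close> sends uncoded bits and \<open>B\<close> is supposed to send zeros.
  Blocks of length one and a trivial hash suffice, as the only legal block of \<open>B\<close> is
  known: a one from \<open>B\<close> is exposed whenever \<open>A\<close> also sends a one, so a
  constant \<open>T\<close> already makes the probability of escape small. Colours for constant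
  \<open>T\<close> are polynomially many in \<open>k\<close>, and the pulse code sends them in at
  most \<delta> * k uses.\<close>

lemma bit_code_single:
  fixes \<epsilon> \<delta> :: real
  assumes "\<epsilon> > 0" "\<delta> > 0"
  shows "\<exists>k0. \<forall>k\<ge>k0. \<exists>n. real n \<le> (1 + \<delta>) * real k \<and> bit_code k 0 n \<epsilon>"
proof -
  obtain T0 where T0: "(1 / 2 :: real) ^ T0 < \<epsilon> / 2" using real_arch_pow_inv[of "\<epsilon> / 2" "1 / 2"] assms by auto
  define T where "T = Suc T0"
  have T: "(1 / 2 :: real) ^ T \<le> \<epsilon> / 2" "T > 0" using T0 assms by (auto simp: T_def)
  \<comment> \<open>The number of colours has degree 4 * T in \<open>k\<close>. One extra
    base-\<open>N\<close> digit makes N ^ \<kappa> exceed it despite the constant factors, for large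
    \<open>k\<close>.\<close>
  define \<kappa> where "\<kappa> = 4 * T + 1"
  define N where "N k = nat \<lfloor>\<delta> * real k / real \<kappa>\<rfloor>" for k :: nat
  \<comment> \<open>Chosen so that eventually 2 * (k + 1) \<le> C * N k, which turns the bound on
    the colours into a power of \<open>N k\<close>.\<close>
  define C where "C = 4 * real \<kappa> / \<delta>"
  have \<kappa>0: "real \<kappa> > 0" by (simp add: \<kappa>_def)
  have C: "C > 0" using assms by (simp add: C_def \<kappa>_def)
  have N: "real (N k) \<le> \<delta> * real k / real \<kappa>" "\<delta> * real k / real \<kappa> - 1 \<le> real (N k)" for k
    unfolding N_def using assms by (auto simp: of_nat_nat)
  have "filterlim (\<lambda>k. \<delta> * real k / real \<kappa> - 1) at_top sequentially"
    using assms \<kappa>_def by real_asymp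
  then have "\<forall>\<^sub>F k in sequentially. max (4 * C ^ (4 * T)) (6 * real \<kappa> / \<epsilon> + 1) \<le> \<delta> * real k / real \<kappa> - 1"
    unfolding filterlim_at_top by blast
  moreover have "\<forall>\<^sub>F k in sequentially. (\<delta> / real \<kappa> * real k) ^ \<kappa> \<le> 2 ^ k"
    by (rule eventually_power_le_two_power)
  moreover have "\<forall>\<^sub>F k :: nat in sequentially. 2 + C \<le> 2 * real k" by real_asymp
  ultimately have "\<forall>\<^sub>F k in sequentially. \<exists>n. real n \<le> (1 + \<delta>) * real k \<and> bit_code k 0 n \<epsilon>"
  proof eventually_elim
    case (elim k)
    let ?N = "N k"
    define p where "p = ?N ^ \<kappa>"
    have Nbig: "4 * C ^ (4 * T) \<le> real ?N" "6 * real \<kappa> / \<epsilon> + 1 \<le> real ?N" using elim(1) N(2)[of k] by auto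
    have "6 * real \<kappa> / \<epsilon> \<ge> 0" using assms by simp
    then have N1: "real ?N \<ge> 1" using Nbig(2) by linarith
    have lin: "2 * (real k + 1) \<le> C * real ?N"
    proof -
      have "C * (\<delta> * real k / real \<kappa> - 1) = 4 * real k - C"
        using assms \<kappa>0 by (simp add: C_def field_simps)
      moreover have "C * (\<delta> * real k / real \<kappa> - 1) \<le> C * real ?N" using N(2)[of k] C by (intro mult_left_mono) auto
      ultimately have "4 * real k - C \<le> C * real ?N" by (simp only:)
      moreover have "2 * (real k + 1) \<le> 4 * real k - C" using elim(3) by (simp add: algebra_simps)
      ultimately show ?thesis by (rule order_trans[rotated])
    qed
    define B where "B = (k + 1) ^ (4 * T) * (2 ^ 1) ^ (4 * T)"
    have "B > 0" by (simp add: B_def)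
    then have "real (2 * (B + 1)) \<le> real (4 * B)" unfolding of_nat_le_iff by simp
    also have "\<dots> = 4 * real B" by simp
    also have "4 * real B = 4 * (2 * (real k + 1)) ^ (4 * T)" unfolding power_mult_distrib by (simp add: B_def add.commute)
    also have "\<dots> \<le> 4 * (C * real ?N) ^ (4 * T)" using lin by (intro mult_left_mono power_mono) auto
    also have "\<dots> = 4 * (C ^ (4 * T) * real ?N ^ (4 * T))" by (simp add: power_mult_distrib)
    finally have "real (2 * (B + 1)) \<le> (4 * C ^ (4 * T)) * real ?N ^ (4 * T)" by simp
    also have "\<dots> \<le> real ?N * real ?N ^ (4 * T)" using Nbig(1) by (intro mult_right_mono) auto
    also have "\<dots> = real p" by (simp add: p_def \<kappa>_def)
    finally have pB: "2 * (B + 1) \<le> p" by linarith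
    have "real p \<le> (\<delta> / real \<kappa> * real k) ^ \<kappa>"
      unfolding p_def of_nat_power using N(1)[of k] by (intro power_mono) auto
    also have "\<dots> \<le> real (2 ^ k)" using elim(2) by simp
    finally have pk: "p \<le> 2 ^ k" by linarith
    define V where "V = {..<k} \<rightarrow>\<^sub>E blocks 1"
    have V: "finite V" "card V = 2 ^ k" by (auto simp: V_def card_PiE intro: finite_PiE)
    obtain g where g: "\<And>xs. xs \<in> V \<Longrightarrow> g xs \<le> B"
      "\<And>xs ys. xs \<in> V \<Longrightarrow> ys \<in> V \<Longrightarrow> hdist k xs ys \<le> 4 * T \<Longrightarrow> g xs = g ys \<Longrightarrow> xs = ys"
      unfolding V_def
      using block_colouring[of k "4 * T" 1 B] card_small_subsets_le_power[of k "4 * T"] by (auto simp: B_def)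
    obtain s where s: "s \<in> V \<rightarrow> {..<p}" "\<And>a b. a \<in> V \<Longrightarrow> b \<in> V \<Longrightarrow> s a = s b \<Longrightarrow> g a = g b"
      "\<And>v. card {a\<in>V. s a = v} * p \<le> 3 * card V"
      using balanced_refinement[of V g "{..B}" p] V g(1) pB pk by (auto simp: image_subset_iff)
    define Y where "Y = {[False]}"
    define VB where "VB = {..<k} \<rightarrow>\<^sub>E Y"
    have VB: "finite VB" "card VB = 1" by (auto simp: VB_def Y_def card_PiE intro: finite_PiE)
    have VBeq: "ys = ys'" if "ys \<in> VB" "ys' \<in> VB" for ys ys'
      using that VB(2) by (metis card_1_singletonE singletonD)
    have none: "{a \<in> V \<times> {0::nat}. 0 < snd a} = {}" by auto
    \<comment> \<open>The hash phase is empty: with a single legal word of \<open>B\<close> there is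
      nothing to announce.\<close>
    have c2: "tag_code (V \<times> {0::nat}) VB snd (\<lambda>_. 0::nat) 0 0"
      by (rule tag_codeI[of _ "\<lambda>_. []" _ _ _ "\<lambda>_. []" _ "\<lambda>_. Msg 0 0"]) (auto simp: none)
    have c3: "tag_code (V \<times> {0::nat}) VB (\<lambda>p. s (fst p)) (\<lambda>_. 0::nat) (\<kappa> * ?N) (3 * (real \<kappa> / real ?N))"
    proof (rule tag_code_pull)
      show "id_code {..<p} {0::nat} (\<kappa> * ?N) (real \<kappa> / real ?N)"
        unfolding p_def using N1 by (intro id_code_pulse_power) linarith
      fix v assume "v \<in> {..<p}"
      have "{a \<in> V \<times> {0::nat}. s (fst a) = v} = {a\<in>V. s a = v} \<times> {0}" by auto
      then have "card {a \<in> V \<times> {0::nat}. s (fst a) = v} * p \<le> 3 * card (V \<times> {0::nat})"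
        using s(3)[of v] by (simp add: card_cartesian_product)
      then show "real (card {a \<in> V \<times> {0::nat}. s (fst a) = v}) * real (card {..<p}) \<le> 3 * real (card (V \<times> {0::nat}))"
        unfolding card_lessThan of_nat_mult[symmetric] by linarith
    qed (use V VB s(1) in auto)
    have code: "id_code (V \<times> {0::nat}) VB (k * 1 + (0 + \<kappa> * ?N))
       ((0 * real k / real T + (1 - 1 / 2 ^ 1) ^ T) + (0 + 3 * (real \<kappa> / real ?N)))"
      unfolding V_def VB_def
    proof (rule stage_code[where h = "\<lambda>_. ()" and \<rho> = "\<lambda>_ _. ()" and tA = s and tB = "\<lambda>_. 0::nat" and sB = "\<lambda>_. 0::nat"])
      show "Y \<subseteq> blocks 1" "Y \<noteq> {}" by (auto simp: Y_def blocks_def)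
      show "real (card {y\<in>Y. ambiguous 1 Y (\<lambda>_. ()) x y}) \<le> 0 * real (card Y)" for x
      proof -
        have "{y\<in>Y. ambiguous 1 Y (\<lambda>_. ()) x y} = {}" by (auto simp: Y_def ambiguous_def)
        then show ?thesis by (simp only: card.empty of_nat_0 mult_zero_left order_refl)
      qed
      show "xs = ys" if "xs \<in> {..<k} \<rightarrow>\<^sub>E blocks 1" "ys \<in> {..<k} \<rightarrow>\<^sub>E blocks 1"
        "hdist k xs ys \<le> 4 * T" "s xs = s ys" for xs ys
        using g(2)[folded V_def] s(2) that unfolding V_def[symmetric] by blast
      show "ys = ys'" if "ys \<in> {..<k} \<rightarrow>\<^sub>E Y" "ys' \<in> {..<k} \<rightarrow>\<^sub>E Y" for ys ys'
        using VBeq that unfolding VB_def by blast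
      show "tag_code (({..<k} \<rightarrow>\<^sub>E blocks 1) \<times> {0::nat}) ({..<k} \<rightarrow>\<^sub>E Y) snd (\<lambda>_. 0::nat) 0 0"
        using c2 unfolding V_def VB_def .
      show "tag_code (({..<k} \<rightarrow>\<^sub>E blocks 1) \<times> {0::nat}) ({..<k} \<rightarrow>\<^sub>E Y) (\<lambda>p. s (fst p)) (\<lambda>_. 0::nat)
          (\<kappa> * ?N) (3 * (real \<kappa> / real ?N))"
        using c3 unfolding V_def VB_def .
    qed (use T in auto)
    have "(1 - 1 / 2 ^ 1 :: real) ^ T \<le> \<epsilon> / 2" using T(1) by simp
    moreover have "3 * (real \<kappa> / real ?N) \<le> \<epsilon> / 2"
      using Nbig(2) N1 assms by (simp add: field_simps)
    ultimately have "id_code (V \<times> {0::nat}) VB (k + \<kappa> * ?N) \<epsilon>"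
      using tag_code_mono[OF code, of \<epsilon>] by simp
    then have "bit_code k 0 (k + \<kappa> * ?N) \<epsilon>"
      using V VB by (subst bit_code_iff[of "V \<times> {0::nat}" VB]) (auto simp: card_cartesian_product)
    moreover have "real (k + \<kappa> * ?N) \<le> (1 + \<delta>) * real k"
      using N(1)[of k] by (simp add: \<kappa>_def field_simps)
    ultimately show ?case by blast
  qed
  then show ?thesis unfolding eventually_sequentially by blast
qed

text \<open>The lower bounds on \<open>l2\<close> and \<open>k3\<close> provide twice as many tags
  as hashes or colours, and the upper bounds keep the tags no more numerous than the words; both are
  needed for balancing. The factor 3 on \<open>e2\<close> and \<open>e3\<close> is the price of tags
  that are only nearly uniform.\<close>

lemma bit_code_stage:
  fixes h :: "bool list \<Rightarrow> bool list"
  assumes h: "\<And>y. length (h y) = r" and "\<eta> \<ge> 0" "T > 0"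
    and amb: "\<And>x. x \<in> blocks l \<Longrightarrow> real (card {y\<in>blocks l. ambiguous l (blocks l) h x y}) \<le> \<eta> * 2 ^ l"
    and code2: "bit_code k2 l2 n2 e2" and l2: "r * K + 1 \<le> l2" "l2 \<le> l * K"
    and code3: "bit_code k3 k3 n3 e3" and k3: "K + 4 * l * T + 2 \<le> k3" "k3 \<le> l * K"
  shows "bit_code (l * K + k2) (l * K) (K * l + (n2 + n3))
           ((\<eta> * real K / real T + (1 - 1 / 2 ^ l) ^ T) + (3 * e2 + 3 * e3))"
proof -
  define V where "V = {..<K} \<rightarrow>\<^sub>E blocks l"
  have V: "finite V" "card V = 2 ^ (l * K)" by (auto simp: V_def card_PiE power_mult intro: finite_PiE)
  define EA where "EA = {..<2 ^ k2 :: nat}"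
  define B :: nat where "B = 2 ^ K * (2 ^ l) ^ (4 * T)"
  obtain g where g: "\<And>xs. xs \<in> V \<Longrightarrow> g xs \<le> B"
    "\<And>xs ys. xs \<in> V \<Longrightarrow> ys \<in> V \<Longrightarrow> hdist K xs ys \<le> 4 * T \<Longrightarrow> g xs = g ys \<Longrightarrow> xs = ys"
    unfolding V_def
    using block_colouring[of K "4 * T" l B] card_small_subsets_le_exp[of K "4 * T"] by (auto simp: B_def)
  have "2 * (B + 1) \<le> 4 * B" by (simp add: B_def)
  also have "4 * B = 2 ^ (K + 4 * l * T + 2)"
    unfolding B_def by (simp add: power_add power_mult[symmetric] mult.commute mult.left_commute)
  also have "\<dots> \<le> 2 ^ k3" using k3 by (intro power_increasing) auto
  finally have pB: "2 * (B + 1) \<le> 2 ^ k3" .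
  have pk: "2 ^ k3 \<le> card V" unfolding V using k3 by (intro power_increasing) auto
  obtain s :: "(nat \<Rightarrow> bool list) \<Rightarrow> nat" where s: "s \<in> V \<rightarrow> {..<2 ^ k3}" "\<And>a b. a \<in> V \<Longrightarrow> b \<in> V \<Longrightarrow> s a = s b \<Longrightarrow> g a = g b"
    "\<And>v. card {a\<in>V. s a = v} * 2 ^ k3 \<le> 3 * card V"
    using balanced_refinement[of V g "{..B}" "2 ^ k3"] V(1) g(1) pB pk by (auto simp: image_subset_iff)
  define H where "H ys = (\<lambda>j\<in>{..<K}. h (ys j))" for ys :: "nat \<Rightarrow> bool list"
  have cH: "card ({..<K} \<rightarrow>\<^sub>E blocks r) = 2 ^ (r * K)" by (simp add: card_PiE power_mult)
  have "2 * card ({..<K} \<rightarrow>\<^sub>E blocks r) = 2 ^ (r * K + 1)" by (simp add: cH)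
  also have "\<dots> \<le> 2 ^ l2" using l2 by (intro power_increasing) auto
  finally have pH: "2 * card ({..<K} \<rightarrow>\<^sub>E blocks r) \<le> 2 ^ l2" .
  have HV: "H ` V \<subseteq> {..<K} \<rightarrow>\<^sub>E blocks r" by (auto simp: H_def blocks_def h split: if_splits)
  have finH: "finite ({..<K} \<rightarrow>\<^sub>E blocks r)" by (intro finite_PiE) auto
  have pl: "2 ^ l2 \<le> card V" unfolding V using l2 by (intro power_increasing) auto
  obtain u :: "(nat \<Rightarrow> bool list) \<Rightarrow> nat" where u: "u \<in> V \<rightarrow> {..<2 ^ l2}" "\<And>a b. a \<in> V \<Longrightarrow> b \<in> V \<Longrightarrow> u a = u b \<Longrightarrow> H a = H b"
    "\<And>v. card {a\<in>V. u a = v} * 2 ^ l2 \<le> 3 * card V"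
    by (rule balanced_refinement[OF V(1) HV finH pH pl]) blast
  \<comment> \<open>The hash is read off any word with the received tag; the choice is immaterial
    because equal tags have equal hashes.\<close>
  define \<rho> where "\<rho> v j = h ((SOME ys. ys \<in> V \<and> u ys = v) j)" for v j
  have \<rho>: "\<rho> (u ys) j = h (ys j)" if "ys \<in> V" "j < K" for ys j
  proof -
    have "(SOME ys'. ys' \<in> V \<and> u ys' = u ys) \<in> V \<and> u (SOME ys'. ys' \<in> V \<and> u ys' = u ys) = u ys"
      using someI_ex[of "\<lambda>ys'. ys' \<in> V \<and> u ys' = u ys"] that(1) by blast
    then have "H (SOME ys'. ys' \<in> V \<and> u ys' = u ys) = H ys" using u(2) that by blast
    then have "H (SOME ys'. ys' \<in> V \<and> u ys' = u ys) j = H ys j" by simp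
    then show ?thesis using that by (simp add: \<rho>_def H_def)
  qed
  have fibre: "real (card {a\<in>V. w a = v}) * real (card {..<2 ^ k :: nat}) \<le> 3 * real (card V)"
    if "card {a\<in>V. w a = v} * 2 ^ k \<le> 3 * card V" for w :: "(nat \<Rightarrow> bool list) \<Rightarrow> nat" and v k
    using that unfolding card_lessThan of_nat_mult[symmetric] by linarith
  have c2: "tag_code (V \<times> EA) V snd u n2 (3 * e2)"
  proof (rule tag_code_pull[OF code2[unfolded bit_code_def]])
    fix v assume v: "v \<in> {..<2 ^ k2 :: nat}"
    have "card {a \<in> V \<times> EA. snd a = v} = card V"
      by (rule card_snd_fibre) (use V v in \<open>auto simp: EA_def\<close>)
    then show "real (card {a \<in> V \<times> EA. snd a = v}) * real (card {..<2 ^ k2 :: nat}) \<le> 3 * real (card (V \<times> EA))"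
      by (simp add: card_cartesian_product EA_def)
  qed (use V u fibre in \<open>auto simp: EA_def\<close>)
  have c3: "tag_code (V \<times> EA) V (\<lambda>p. s (fst p)) s n3 (3 * e3)"
  proof (rule tag_code_pull[OF code3[unfolded bit_code_def]])
    fix v assume v: "v \<in> {..<2 ^ k3 :: nat}"
    have "{a \<in> V \<times> EA. s (fst a) = v} = {a\<in>V. s a = v} \<times> EA" by auto
    then have "real (card {a \<in> V \<times> EA. s (fst a) = v}) * real (card {..<2 ^ k3 :: nat})
       = (real (card {a\<in>V. s a = v}) * real (card {..<2 ^ k3 :: nat})) * real (card EA)"
      by (simp add: card_cartesian_product)
    also have "\<dots> \<le> (3 * real (card V)) * real (card EA)"
      by (intro mult_right_mono fibre s(3)) auto
    finally show "real (card {a \<in> V \<times> EA. s (fst a) = v}) * real (card {..<2 ^ k3 :: nat}) \<le> 3 * real (card (V \<times> EA))"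
      by (simp add: card_cartesian_product)
  qed (use V s fibre in \<open>auto simp: EA_def\<close>)
  have "id_code (V \<times> EA) V (K * l + (n2 + n3))
     ((\<eta> * real K / real T + (1 - 1 / 2 ^ l) ^ T) + (3 * e2 + 3 * e3))"
    unfolding V_def
  proof (rule stage_code[where h = h and \<rho> = \<rho> and tA = s and tB = s and sB = u])
    show "real (card {y\<in>blocks l. ambiguous l (blocks l) h x y}) \<le> \<eta> * real (card (blocks l))"
      if "x \<in> blocks l" for x using amb[OF that] by simp
    show "xs = ys" if "xs \<in> {..<K} \<rightarrow>\<^sub>E blocks l" "ys \<in> {..<K} \<rightarrow>\<^sub>E blocks l"
      "hdist K xs ys \<le> 4 * T" "s xs = s ys" for xs ys
      using g(2)[folded V_def] s(2) that unfolding V_def[symmetric] by blast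
    then show "xs = ys" if "xs \<in> {..<K} \<rightarrow>\<^sub>E blocks l" "ys \<in> {..<K} \<rightarrow>\<^sub>E blocks l"
      "hdist K xs ys \<le> 4 * T" "s xs = s ys" for xs ys using that by blast
    show "\<rho> (u ys) j = h (ys j)" if "ys \<in> {..<K} \<rightarrow>\<^sub>E blocks l" "j < K" for ys j
      using \<rho> that unfolding V_def by blast
    show "tag_code (({..<K} \<rightarrow>\<^sub>E blocks l) \<times> EA) ({..<K} \<rightarrow>\<^sub>E blocks l) snd u n2 (3 * e2)"
      using c2 unfolding V_def .
    show "tag_code (({..<K} \<rightarrow>\<^sub>E blocks l) \<times> EA) ({..<K} \<rightarrow>\<^sub>E blocks l) (\<lambda>p. s (fst p)) s n3 (3 * e3)"
      using c3 unfolding V_def .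
  qed (use assms(2,3) in \<open>auto simp: EA_def\<close>)
  then show ?thesis
    using V by (subst bit_code_iff[of "V \<times> EA" V]) (auto simp: card_cartesian_product EA_def power_add)
qed

subsection \<open>The cone of achievable triples\<close>

text \<open>\<open>approx_code \<alpha> \<beta> \<gamma>\<close>: asymptotically, \<open>\<alpha>\<close> bits of \<open>A\<close> and \<open>\<beta>\<close> bits of \<open>B\<close> cost \<open>\<gamma>\<close> channel uses. The number of
  bits is prescribed on both sides because a code with fewer messages cannot be obtained by restriction.\<close>

definition approx_code :: "real \<Rightarrow> real \<Rightarrow> real \<Rightarrow> bool" where
  "approx_code \<alpha> \<beta> \<gamma> \<longleftrightarrow> (\<forall>\<epsilon>>0. \<forall>\<delta>>0. \<forall>\<^sub>F m in sequentially. \<exists>k l n.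
     \<bar>real k - \<alpha> * real m\<bar> \<le> \<delta> * real m \<and> \<bar>real l - \<beta> * real m\<bar> \<le> \<delta> * real m \<and>
     real n \<le> (\<gamma> + \<delta>) * real m \<and> bit_code k l n \<epsilon>)"

lemma approx_codeD:
  assumes "approx_code \<alpha> \<beta> \<gamma>" "\<epsilon> > 0" "\<delta> > 0"
  shows "\<forall>\<^sub>F m in sequentially. \<exists>k l n.
     \<bar>real k - \<alpha> * real m\<bar> \<le> \<delta> * real m \<and> \<bar>real l - \<beta> * real m\<bar> \<le> \<delta> * real m \<and>
     real n \<le> (\<gamma> + \<delta>) * real m \<and> bit_code k l n \<epsilon>"
  using assms unfolding approx_code_def by blast

lemma approx_code_swap: "approx_code \<alpha> \<beta> \<gamma> \<Longrightarrow> approx_code \<beta> \<alpha> \<gamma>"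
  unfolding approx_code_def
proof (intro allI impI)
  fix \<epsilon> \<delta> :: real assume "\<epsilon> > 0" "\<delta> > 0" and "\<forall>\<epsilon>>0. \<forall>\<delta>>0. \<forall>\<^sub>F m in sequentially. \<exists>k l n.
     \<bar>real k - \<alpha> * real m\<bar> \<le> \<delta> * real m \<and> \<bar>real l - \<beta> * real m\<bar> \<le> \<delta> * real m \<and>
     real n \<le> (\<gamma> + \<delta>) * real m \<and> bit_code k l n \<epsilon>"
  then have "\<forall>\<^sub>F m in sequentially. \<exists>k l n.
     \<bar>real k - \<alpha> * real m\<bar> \<le> \<delta> * real m \<and> \<bar>real l - \<beta> * real m\<bar> \<le> \<delta> * real m \<and>
     real n \<le> (\<gamma> + \<delta>) * real m \<and> bit_code k l n \<epsilon>" by blast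
  then show "\<forall>\<^sub>F m in sequentially. \<exists>k l n.
     \<bar>real k - \<beta> * real m\<bar> \<le> \<delta> * real m \<and> \<bar>real l - \<alpha> * real m\<bar> \<le> \<delta> * real m \<and>
     real n \<le> (\<gamma> + \<delta>) * real m \<and> bit_code k l n \<epsilon>"
  proof eventually_elim
    case (elim m)
    then show ?case using bit_code_swap by blast
  qed
qed

lemma approx_code_zero:
  assumes "\<gamma> \<ge> 0"
  shows "approx_code 0 0 \<gamma>"
  unfolding approx_code_def
proof (intro allI impI always_eventually)
  fix \<epsilon> \<delta> :: real and m :: nat assume "\<epsilon> > 0" "\<delta> > 0"
  then show "\<exists>k l n. \<bar>real k - 0 * real m\<bar> \<le> \<delta> * real m \<and> \<bar>real l - 0 * real m\<bar> \<le> \<delta> * real m \<and>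
     real n \<le> (\<gamma> + \<delta>) * real m \<and> bit_code k l n \<epsilon>"
    using bit_code_mono[OF bit_code_zero[of 0], of \<epsilon>] assms by (intro exI[of _ 0]) auto
qed

lemma approx_code_add:
  assumes "approx_code \<alpha> \<beta> \<gamma>" "approx_code \<alpha>' \<beta>' \<gamma>'"
  shows "approx_code (\<alpha> + \<alpha>') (\<beta> + \<beta>') (\<gamma> + \<gamma>')"
  unfolding approx_code_def
proof (intro allI impI)
  fix \<epsilon> \<delta> :: real assume e: "\<epsilon> > 0" "\<delta> > 0"
  have "\<epsilon> / 2 > 0" "\<delta> / 2 > 0" using e by auto
  from approx_codeD[OF assms(1) this] approx_codeD[OF assms(2) this]
  show "\<forall>\<^sub>F m in sequentially. \<exists>k l n.
     \<bar>real k - (\<alpha> + \<alpha>') * real m\<bar> \<le> \<delta> * real m \<and> \<bar>real l - (\<beta> + \<beta>') * real m\<bar> \<le> \<delta> * real m \<and>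
     real n \<le> (\<gamma> + \<gamma>' + \<delta>) * real m \<and> bit_code k l n \<epsilon>"
  proof eventually_elim
    case (elim m)
    then obtain k l n k' l' n' where c:
      "\<bar>real k - \<alpha> * real m\<bar> \<le> \<delta> / 2 * real m" "\<bar>real l - \<beta> * real m\<bar> \<le> \<delta> / 2 * real m"
      "real n \<le> (\<gamma> + \<delta> / 2) * real m" "bit_code k l n (\<epsilon> / 2)"
      "\<bar>real k' - \<alpha>' * real m\<bar> \<le> \<delta> / 2 * real m" "\<bar>real l' - \<beta>' * real m\<bar> \<le> \<delta> / 2 * real m"
      "real n' \<le> (\<gamma>' + \<delta> / 2) * real m" "bit_code k' l' n' (\<epsilon> / 2)" by blast
    have "bit_code (k + k') (l + l') (n + n') \<epsilon>" using bit_code_add[OF c(4,8)] by simp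
    moreover have "\<bar>real (k + k') - (\<alpha> + \<alpha>') * real m\<bar> \<le> \<delta> * real m"
    proof -
      have "real (k + k') - (\<alpha> + \<alpha>') * real m = (real k - \<alpha> * real m) + (real k' - \<alpha>' * real m)"
        by (simp add: algebra_simps)
      then show ?thesis using c(1,5) by linarith
    qed
    moreover have "\<bar>real (l + l') - (\<beta> + \<beta>') * real m\<bar> \<le> \<delta> * real m"
    proof -
      have "real (l + l') - (\<beta> + \<beta>') * real m = (real l - \<beta> * real m) + (real l' - \<beta>' * real m)"
        by (simp add: algebra_simps)
      then show ?thesis using c(2,6) by linarith
    qed
    moreover have "real (n + n') \<le> (\<gamma> + \<gamma>' + \<delta>) * real m"
      using c(3,7) by (simp add: algebra_simps)
    ultimately show ?case by blast
  qed
qed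

text \<open>The code for index m is the given one at the integer part of t * m; rounding shifts the
  bit counts by at most a constant, which is absorbed by \<delta> * m.\<close>

lemma approx_code_scale:
  assumes "approx_code \<alpha> \<beta> \<gamma>" "t \<ge> 0" "\<gamma> \<ge> 0"
  shows "approx_code (t * \<alpha>) (t * \<beta>) (t * \<gamma>)"
proof (cases "t = 0")
  case True
  then show ?thesis using approx_code_zero by simp
next
  case False
  then have t: "t > 0" using assms by simp
  show ?thesis
    unfolding approx_code_def
  proof (intro allI impI)
    fix \<epsilon> \<delta> :: real assume e: "\<epsilon> > 0" "\<delta> > 0"
    define \<delta>' where "\<delta>' = \<delta> / (2 * t)"
    have d: "\<delta>' > 0" "\<delta>' * t = \<delta> / 2" using e t by (auto simp: \<delta>'_def)
    define f where "f m = nat \<lfloor>t * real m\<rfloor>" for m :: nat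
    have f: "real (f m) \<le> t * real m" "t * real m - 1 \<le> real (f m)" for m
      unfolding f_def using t by (auto simp: of_nat_nat)
    have "filterlim (\<lambda>m. t * real m - 1) at_top sequentially" using t by real_asymp
    then have "filterlim (\<lambda>m. real (f m)) at_top sequentially"
      by (rule filterlim_at_top_mono) (use f in auto)
    then have "filterlim f at_top sequentially" by (simp add: filterlim_sequentially_iff_filterlim_real)
    from eventually_compose_filterlim[OF approx_codeD[OF assms(1) e(1) d(1)] this]
    have "\<forall>\<^sub>F m in sequentially. \<exists>k l n.
       \<bar>real k - \<alpha> * real (f m)\<bar> \<le> \<delta>' * real (f m) \<and> \<bar>real l - \<beta> * real (f m)\<bar> \<le> \<delta>' * real (f m) \<and>
       real n \<le> (\<gamma> + \<delta>') * real (f m) \<and> bit_code k l n \<epsilon>" .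
    moreover have "\<forall>\<^sub>F m in sequentially. \<bar>\<alpha>\<bar> + \<bar>\<beta>\<bar> \<le> \<delta> / 2 * real m" using e by real_asymp
    ultimately show "\<forall>\<^sub>F m in sequentially. \<exists>k l n.
       \<bar>real k - t * \<alpha> * real m\<bar> \<le> \<delta> * real m \<and> \<bar>real l - t * \<beta> * real m\<bar> \<le> \<delta> * real m \<and>
       real n \<le> (t * \<gamma> + \<delta>) * real m \<and> bit_code k l n \<epsilon>"
    proof eventually_elim
      case (elim m)
      then obtain k l n where c: "\<bar>real k - \<alpha> * real (f m)\<bar> \<le> \<delta>' * real (f m)"
        "\<bar>real l - \<beta> * real (f m)\<bar> \<le> \<delta>' * real (f m)"
        "real n \<le> (\<gamma> + \<delta>') * real (f m)" "bit_code k l n \<epsilon>" by blast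
      have "\<delta>' * real (f m) \<le> \<delta>' * (t * real m)" using f d by (intro mult_left_mono) auto
      also have "\<dots> = \<delta> / 2 * real m" using d(2) by (simp add: mult.assoc[symmetric])
      finally have dm: "\<delta>' * real (f m) \<le> \<delta> / 2 * real m" .
      have dev: "\<bar>a * real (f m) - t * a * real m\<bar> \<le> \<bar>a\<bar>" for a
      proof -
        have "a * real (f m) - t * a * real m = a * (real (f m) - t * real m)" by (simp add: algebra_simps)
        moreover have "\<bar>real (f m) - t * real m\<bar> \<le> 1" using f[of m] by (simp add: abs_le_iff)
        ultimately show ?thesis by (simp add: abs_mult mult_left_le)
      qed
      have "(\<gamma> + \<delta>') * real (f m) \<le> (\<gamma> + \<delta>') * (t * real m)" using f d assms(3) by (intro mult_left_mono) auto
      also have "\<dots> = (t * \<gamma> + \<delta>' * t) * real m" by (simp add: algebra_simps)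
      also have "\<dots> \<le> (t * \<gamma> + \<delta>) * real m" unfolding d(2) using e by (intro mult_right_mono) auto
      finally have "real n \<le> (t * \<gamma> + \<delta>) * real m" using c(3) by linarith
      moreover have "\<bar>real k - t * \<alpha> * real m\<bar> \<le> \<delta> * real m"
        using c(1) dm dev[of \<alpha>] elim(2) by linarith
      moreover have "\<bar>real l - t * \<beta> * real m\<bar> \<le> \<delta> * real m"
        using c(2) dm dev[of \<beta>] elim(2) by linarith
      ultimately show ?case using c(4) by blast
    qed
  qed
qed

lemma approx_code_limit:
  assumes "\<And>\<delta>. \<delta> > 0 \<Longrightarrow> \<exists>\<alpha>' \<beta>' \<gamma>'. \<bar>\<alpha>' - \<alpha>\<bar> \<le> \<delta> \<and> \<bar>\<beta>' - \<beta>\<bar> \<le> \<delta> \<and> \<gamma>' \<le> \<gamma> + \<delta> \<and> approx_code \<alpha>' \<beta>' \<gamma>'"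
  shows "approx_code \<alpha> \<beta> \<gamma>"
  unfolding approx_code_def
proof (intro allI impI)
  fix \<epsilon> \<delta> :: real assume e: "\<epsilon> > 0" "\<delta> > 0"
  have d: "\<delta> / 2 > 0" using e by simp
  obtain \<alpha>' \<beta>' \<gamma>' where p: "\<bar>\<alpha>' - \<alpha>\<bar> \<le> \<delta> / 2" "\<bar>\<beta>' - \<beta>\<bar> \<le> \<delta> / 2" "\<gamma>' \<le> \<gamma> + \<delta> / 2" "approx_code \<alpha>' \<beta>' \<gamma>'"
    using assms[OF d] by blast
  from approx_codeD[OF p(4) e(1) d]
  show "\<forall>\<^sub>F m in sequentially. \<exists>k l n.
     \<bar>real k - \<alpha> * real m\<bar> \<le> \<delta> * real m \<and> \<bar>real l - \<beta> * real m\<bar> \<le> \<delta> * real m \<and>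
     real n \<le> (\<gamma> + \<delta>) * real m \<and> bit_code k l n \<epsilon>"
  proof eventually_elim
    case (elim m)
    then obtain k l n where c: "\<bar>real k - \<alpha>' * real m\<bar> \<le> \<delta> / 2 * real m"
      "\<bar>real l - \<beta>' * real m\<bar> \<le> \<delta> / 2 * real m" "real n \<le> (\<gamma>' + \<delta> / 2) * real m" "bit_code k l n \<epsilon>" by blast
    have diff: "\<bar>a' * real m - a * real m\<bar> \<le> \<delta> / 2 * real m" if "\<bar>a' - a\<bar> \<le> \<delta> / 2" for a a'
    proof -
      have "\<bar>a' * real m - a * real m\<bar> = \<bar>a' - a\<bar> * real m"
        unfolding left_diff_distrib[symmetric] abs_mult by simp
      then show ?thesis using mult_right_mono[OF that, of "real m"] by simp
    qed
    have "\<bar>real k - \<alpha> * real m\<bar> \<le> \<delta> * real m" using c(1) diff[OF p(1)] by linarith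
    moreover have "\<bar>real l - \<beta> * real m\<bar> \<le> \<delta> * real m" using c(2) diff[OF p(2)] by linarith
    moreover have "(\<gamma>' + \<delta> / 2) * real m \<le> (\<gamma> + \<delta>) * real m" using p(3) by (intro mult_right_mono) auto
    then have "real n \<le> (\<gamma> + \<delta>) * real m" using c(3) by linarith
    ultimately show ?case using c(4) by blast
  qed
qed

lemma approx_code_single: "approx_code 1 0 1"
  unfolding approx_code_def
proof (intro allI impI)
  fix \<epsilon> \<delta> :: real assume e: "\<epsilon> > 0" "\<delta> > 0"
  obtain k0 where k0: "\<And>k. k \<ge> k0 \<Longrightarrow> \<exists>n. real n \<le> (1 + \<delta>) * real k \<and> bit_code k 0 n \<epsilon>"
    using bit_code_single[OF e] by blast
  show "\<forall>\<^sub>F m in sequentially. \<exists>k l n.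
     \<bar>real k - 1 * real m\<bar> \<le> \<delta> * real m \<and> \<bar>real l - 0 * real m\<bar> \<le> \<delta> * real m \<and>
     real n \<le> (1 + \<delta>) * real m \<and> bit_code k l n \<epsilon>"
    unfolding eventually_sequentially
  proof (rule exI[of _ k0], rule allI, rule impI)
    fix m assume "k0 \<le> m"
    then obtain n where "real n \<le> (1 + \<delta>) * real m" "bit_code m 0 n \<epsilon>" using k0 by blast
    then show "\<exists>k l n. \<bar>real k - 1 * real m\<bar> \<le> \<delta> * real m \<and> \<bar>real l - 0 * real m\<bar> \<le> \<delta> * real m \<and>
       real n \<le> (1 + \<delta>) * real m \<and> bit_code k l n \<epsilon>"
      using e by (intro exI[of _ m] exI[of _ 0] exI[of _ n]) auto
  qed
qed

text \<open>The order of choices matters: \<open>c\<close> and \<eta> come from the required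
  precision, then \<open>l\<close> is fixed, and only the number \<open>K\<close> of blocks and the
  tolerance \<open>T\<close> grow with \<open>m\<close>. Since l \<ge> 1 / c and T \<le> c * K, the
  colours have only about c * m bits, so even a code with poor rate can send them.\<close>

lemma approx_code_stage:
  assumes appr: "approx_code \<alpha> (1 / 2) \<gamma>"
  shows "approx_code (1 + \<alpha>) 1 (1 + \<gamma>)"
  unfolding approx_code_def
proof (intro allI impI)
  fix \<epsilon> \<delta> :: real assume e: "\<epsilon> > 0" "\<delta> > 0"
  \<comment> \<open>The excess length adds up to (9 + 1 + 24) * c * m: blocks, hash phase and
    colours. It stays below 40 * c * m \<le> \<delta> * m.\<close>
  define c where "c = min (1 / 40) (\<delta> / 40)"
  have c: "c > 0" "c \<le> 1 / 40" "40 * c \<le> \<delta>" using e by (auto simp: c_def)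
  \<comment> \<open>As K / T is at most 2 / c, the ambiguity error \<eta> * K / T is at most
    \<epsilon> / 8.\<close>
  define \<eta> where "\<eta> = \<epsilon> * c / 16"
  have \<eta>: "\<eta> > 0" using e c by (simp add: \<eta>_def)
  obtain l0 where l0: "\<And>l. l \<ge> l0 \<Longrightarrow> \<exists>r (h :: bool list \<Rightarrow> bool list). real r \<le> (1 / 2 + c) * real l + 1 \<and>
     (\<forall>y. length (h y) = r) \<and>
     (\<forall>x\<in>blocks l. real (card {y\<in>blocks l. ambiguous l (blocks l) h x y}) \<le> \<eta> * 2 ^ l)"
    using hash_exists[OF c(1) \<eta>] by blast
  define l where "l = max (l0 + 1) (nat \<lceil>1 / c\<rceil>)"
  have "1 / c \<le> real (nat \<lceil>1 / c\<rceil>)" by linarith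
  also have "\<dots> \<le> real l" by (simp add: l_def)
  finally have lc: "1 \<le> c * real l" using c by (simp add: field_simps)
  have lpos: "l > 0" by (simp add: l_def)
  obtain r and h :: "bool list \<Rightarrow> bool list" where r: "real r \<le> (1 / 2 + c) * real l + 1"
    and h: "\<And>y. length (h y) = r"
    and amb: "\<And>x. x \<in> blocks l \<Longrightarrow> real (card {y\<in>blocks l. ambiguous l (blocks l) h x y}) \<le> \<eta> * 2 ^ l"
  proof -
    have "l0 \<le> l" by (simp add: l_def)
    from l0[OF this] that show thesis by blast
  qed
  have r': "real r \<le> (1 / 2 + 2 * c) * real l" using r lc by (simp add: algebra_simps)
  obtain T0 where T0: "(1 - 1 / 2 ^ l :: real) ^ T0 < \<epsilon> / 8"
    using real_arch_pow_inv[of "\<epsilon> / 8" "1 - 1 / 2 ^ l"] e by auto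
  \<comment> \<open>Slightly fewer than m / l blocks are used because the inner code carries a
    prescribed number of bits of \<open>B\<close>, possibly only (1/2 - c) * m. The factor 1 - 8 * c
    makes the hash shorter than that: (1/2 + 2 * c) * (1 - 8 * c) is at most 1/2 - 2 * c.\<close>
  define K where "K m = nat \<lfloor>(1 - 8 * c) * real m / real l\<rfloor>" for m :: nat
  define T where "T m = nat \<lfloor>c * real (K m)\<rfloor>" for m :: nat
  have K: "real (K m) \<le> (1 - 8 * c) * real m / real l" "(1 - 8 * c) * real m / real l - 1 \<le> real (K m)" for m
    unfolding K_def using c by (auto simp: of_nat_nat)
  have T: "real (T m) \<le> c * real (K m)" "c * real (K m) - 1 \<le> real (T m)" for m
    unfolding T_def using c by (auto simp: of_nat_nat)
  define e2 where "e2 = \<epsilon> / 24"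
  define e3 where "e3 = \<epsilon> / 48"
  have e23: "e2 > 0" "e3 > 0" using e by (auto simp: e2_def e3_def)
  obtain k0 where k0: "\<And>k. k \<ge> k0 \<Longrightarrow> \<exists>n. real n \<le> (1 + 1) * real k \<and> bit_code k 0 n e3"
    using bit_code_single[OF e23(2), of 1] by auto
  have "filterlim (\<lambda>m. (1 - 8 * c) * real m / real l - 1) at_top sequentially"
  proof -
    have "1 - 8 * c > 0" using c by simp
    then show ?thesis using lpos by real_asymp
  qed
  then have Klim: "filterlim (\<lambda>m. real (K m)) at_top sequentially"
    by (rule filterlim_at_top_mono) (use K in auto)
  have "\<forall>\<^sub>F m in sequentially. max (real k0) ((real T0 + 2) / c) \<le> real (K m)"
    using Klim unfolding filterlim_at_top by blast
  moreover have "\<forall>\<^sub>F m in sequentially. (2 + real l) \<le> c * real m" using c by real_asymp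
  moreover note approx_codeD[OF appr e23(1) c(1)]
  ultimately show "\<forall>\<^sub>F m in sequentially. \<exists>k l n.
     \<bar>real k - (1 + \<alpha>) * real m\<bar> \<le> \<delta> * real m \<and> \<bar>real l - 1 * real m\<bar> \<le> \<delta> * real m \<and>
     real n \<le> (1 + \<gamma> + \<delta>) * real m \<and> bit_code k l n \<epsilon>"
  proof eventually_elim
    case (elim m)
    have Kbig: "real k0 \<le> real (K m)" "real T0 + 2 \<le> c * real (K m)"
      using elim(1) c by (auto simp: field_simps)
    have TT: "T m \<ge> T0" "T m > 0" "c * real (K m) \<le> 2 * real (T m)"
      using Kbig(2) T(2)[of m] by linarith+
    obtain k2 l2 n2 where c2: "\<bar>real k2 - \<alpha> * real m\<bar> \<le> c * real m" "\<bar>real l2 - 1 / 2 * real m\<bar> \<le> c * real m"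
      "real n2 \<le> (\<gamma> + c) * real m" "bit_code k2 l2 n2 e2" using elim(3) by blast
    have lK: "real l * real (K m) \<le> (1 - 8 * c) * real m" "(1 - 8 * c) * real m - real l \<le> real l * real (K m)"
      using K[of m] lpos by (auto simp: field_simps)
    have cm: "0 \<le> c * real m" using c by simp
    have ccm: "c * (c * real m) \<le> 1 / 40 * (c * real m)" using c cm by (intro mult_right_mono) auto
    have cm40: "c * real m \<le> 1 / 40 * real m" using c by (intro mult_right_mono) auto
    have "real r * real (K m) \<le> (1 / 2 + 2 * c) * (real l * real (K m))"
      using mult_right_mono[OF r', of "real (K m)"] by (simp add: mult.assoc)
    also have "\<dots> \<le> (1 / 2 + 2 * c) * ((1 - 8 * c) * real m)" using lK c by (intro mult_left_mono) auto
    also have "\<dots> = real m / 2 - 2 * (c * real m) - 16 * (c * (c * real m))" by (simp add: algebra_simps)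
    also have "\<dots> \<le> real m / 2 - 2 * (c * real m)" using c by simp
    finally have rK: "real r * real (K m) \<le> real m / 2 - 2 * (c * real m)" .
    have l2a: "r * K m + 1 \<le> l2"
    proof -
      have "real r * real (K m) + 1 \<le> real l2" using rK c2(2) elim(2) by linarith
      then show ?thesis by (metis of_nat_1 of_nat_add of_nat_le_iff of_nat_mult)
    qed
    have l2b: "l2 \<le> l * K m"
    proof -
      have "real l2 \<le> real l * real (K m)"
        using lK(2) c2(2) elim(2) cm40 by (simp add: algebra_simps)
      then show ?thesis by (metis of_nat_le_iff of_nat_mult)
    qed
    define k3 where "k3 = K m + 4 * l * T m + 2"
    have clK: "real (K m) \<le> c * (real l * real (K m))"
      using mult_right_mono[OF lc, of "real (K m)"] by (simp add: mult.assoc)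
    have "real l * real (T m) \<le> real l * (c * real (K m))" using T(1)[of m] by (intro mult_left_mono) auto
    then have lT: "real l * real (T m) \<le> c * (real l * real (K m))" by (simp add: mult.left_commute)
    have clKm: "c * (real l * real (K m)) \<le> c * real m"
    proof -
      have "real l * real (K m) \<le> real m" using lK(1) cm by (simp add: algebra_simps)
      then show ?thesis using c by (intro mult_left_mono) auto
    qed
    have K2: "2 \<le> real (K m)"
    proof -
      have "c * real (K m) \<le> 1 * real (K m)" using c by (intro mult_right_mono) auto
      then show ?thesis using Kbig(2) by linarith
    qed
    have k3r: "real k3 = real (K m) + 4 * (real l * real (T m)) + 2" by (simp add: k3_def)
    have k3a: "real k3 \<le> 6 * (c * (real l * real (K m)))" unfolding k3r using clK lT K2 by linarith
    have k3b: "k3 \<le> l * K m"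
    proof -
      have "c * (real l * real (K m)) \<le> 1 / 40 * (real l * real (K m))" using c by (intro mult_right_mono) auto
      then have "real k3 \<le> real l * real (K m)" using k3a by (simp add: mult_nonneg_nonneg)
      then show ?thesis by (metis of_nat_le_iff of_nat_mult)
    qed
    have k3c: "real k3 \<le> 6 * (c * real m)" using k3a clKm by linarith
    have "k0 \<le> k3" using Kbig(1) unfolding k3_def by linarith
    then obtain na where na: "real na \<le> (1 + 1) * real k3" "bit_code k3 0 na e3" using k0 by blast
    \<comment> \<open>The colours of the two users are sent one after the other by single-user
      codes.\<close>
    have code3: "bit_code k3 k3 (na + na) (e3 + e3)"
      using bit_code_add[OF na(2) bit_code_swap[OF na(2)]] by simp
    have n3: "real (na + na) \<le> 24 * (c * real m)" using na(1) k3c by simp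
    have code: "bit_code (l * K m + k2) (l * K m) (K m * l + (n2 + (na + na)))
       ((\<eta> * real (K m) / real (T m) + (1 - 1 / 2 ^ l) ^ T m) + (3 * e2 + 3 * (e3 + e3)))"
      by (rule bit_code_stage[OF h less_imp_le[OF \<eta>] TT(2) amb c2(4) l2a l2b code3 _ k3b]) (simp_all add: k3_def)
    have "\<eta> * real (K m) / real (T m) \<le> \<epsilon> / 8"
    proof -
      have "\<eta> * real (K m) = \<epsilon> / 16 * (c * real (K m))" by (simp add: \<eta>_def)
      also have "\<dots> \<le> \<epsilon> / 16 * (2 * real (T m))" using TT(3) e by (intro mult_left_mono) auto
      finally show ?thesis using TT(2) by (simp add: field_simps)
    qed
    moreover have "(1 - 1 / 2 ^ l :: real) ^ T m \<le> \<epsilon> / 8"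
    proof -
      have "(1 - 1 / 2 ^ l :: real) ^ T m \<le> (1 - 1 / 2 ^ l) ^ T0" using TT(1) by (intro power_decreasing) auto
      then show ?thesis using T0 by linarith
    qed
    moreover have "3 * e2 + 3 * (e3 + e3) \<le> \<epsilon> / 4" by (simp add: e2_def e3_def)
    ultimately have code': "bit_code (l * K m + k2) (l * K m) (K m * l + (n2 + (na + na))) \<epsilon>"
      using e by (intro bit_code_mono[OF code]) linarith
    have d40: "40 * (c * real m) \<le> \<delta> * real m"
      using mult_right_mono[OF c(3), of "real m"] by (simp add: mult.assoc)
    have lK': "\<bar>real l * real (K m) - real m\<bar> \<le> 9 * (c * real m)"
      using lK elim(2) cm by (simp add: algebra_simps abs_le_iff)
    have "\<bar>real (l * K m + k2) - (1 + \<alpha>) * real m\<bar> \<le> \<delta> * real m"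
    proof -
      have "real (l * K m + k2) - (1 + \<alpha>) * real m = (real l * real (K m) - real m) + (real k2 - \<alpha> * real m)"
        by (simp add: algebra_simps)
      then show ?thesis using lK' c2(1) d40 cm by linarith
    qed
    moreover have "\<bar>real (l * K m) - 1 * real m\<bar> \<le> \<delta> * real m"
      using lK' d40 cm by simp
    moreover have "real (K m * l + (n2 + (na + na))) \<le> (1 + \<gamma> + \<delta>) * real m"
    proof -
      have "real (K m * l + (n2 + (na + na))) = real l * real (K m) + real n2 + real (na + na)" by simp
      also have "\<dots> \<le> (real m + 9 * (c * real m)) + (\<gamma> * real m + c * real m) + 24 * (c * real m)"
        using lK' c2(3) n3 by (simp add: algebra_simps abs_le_iff)
      also have "\<dots> \<le> real m + \<gamma> * real m + \<delta> * real m" using d40 cm by linarith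
      finally show ?thesis by (simp add: algebra_simps)
    qed
    ultimately show ?case using code' by blast
  qed
qed

text \<open>Halving the triple obtained from a stage restores the share 1/2 of \<open>B\<close> and
  moves both \<alpha> and \<gamma> halfway towards 1. The start is the single-user code of
  \<open>B\<close>, scaled by 1/2.\<close>

lemma approx_code_iterate:
  "approx_code (1 - (1 / 2) ^ i) (1 / 2) (1 - (1 / 2) ^ Suc i)"
proof (induction i)
  case 0
  have "approx_code 0 1 1" using approx_code_swap[OF approx_code_single] .
  then have "approx_code (1 / 2 * 0) (1 / 2 * 1) (1 / 2 * 1)" by (rule approx_code_scale) auto
  then show ?case by simp
next
  case (Suc i)
  have p: "(1 / 2 :: real) ^ i \<le> 1" "(1 / 2 :: real) ^ Suc i \<le> 1" by (intro power_le_one; simp)+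
  have "approx_code (1 / 2 * (1 + (1 - (1 / 2) ^ i))) (1 / 2 * 1) (1 / 2 * (1 + (1 - (1 / 2) ^ Suc i)))"
    using p by (intro approx_code_scale approx_code_stage[OF Suc.IH]) auto
  then show ?case by (simp add: algebra_simps)
qed

lemma approx_code_corner: "approx_code 1 (1 / 2) 1"
proof (rule approx_code_limit)
  fix \<delta> :: real assume "\<delta> > 0"
  then obtain i where i: "(1 / 2 :: real) ^ i < \<delta>" using real_arch_pow_inv[of \<delta> "1 / 2"] by auto
  have "approx_code (1 - (1 / 2) ^ i) (1 / 2) (1 - (1 / 2) ^ Suc i)" by (rule approx_code_iterate)
  moreover have z: "0 \<le> (1 / 2 :: real) ^ Suc i" by simp
  then have "1 - (1 / 2) ^ Suc i \<le> 1 + \<delta>" using \<open>\<delta> > 0\<close> z by linarith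
  moreover have "\<bar>1 / 2 - 1 / 2 :: real\<bar> \<le> \<delta>" using \<open>\<delta> > 0\<close> by simp
  moreover have "\<bar>1 - (1 / 2) ^ i - 1\<bar> \<le> \<delta>" using i by simp
  ultimately show "\<exists>\<alpha>' \<beta>' \<gamma>'. \<bar>\<alpha>' - 1\<bar> \<le> \<delta> \<and> \<bar>\<beta>' - 1 / 2\<bar> \<le> \<delta> \<and> \<gamma>' \<le> 1 + \<delta> \<and> approx_code \<alpha>' \<beta>' \<gamma>'"
    by blast
qed

lemma approx_code_region:
  assumes "0 \<le> a" "a \<le> 1" "0 \<le> b" "b \<le> 1" "a + b \<le> 3 / 2"
  shows "approx_code a b 1"
proof -
  \<comment> \<open>Time sharing with weight 2 * b on the corner, a - 2 * b on the single-user code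
    and 1 - a on silence.\<close>
  have low: "approx_code a b 1" if "a \<le> 1" "0 \<le> b" "2 * b \<le> a" for a b
  proof -
    have "approx_code (2 * b * 1 + (a - 2 * b) * 1 + 0) (2 * b * (1 / 2) + (a - 2 * b) * 0 + 0)
      (2 * b * 1 + (a - 2 * b) * 1 + (1 - a))"
      using that
      by (intro approx_code_add approx_code_scale approx_code_single approx_code_corner approx_code_zero) auto
    then show ?thesis by simp
  qed
  consider "2 * b \<le> a" | "2 * a \<le> b" | "a \<le> 2 * b" "b \<le> 2 * a" by linarith
  then show ?thesis
  proof cases
    case 1
    then show ?thesis using low assms by blast
  next
    case 2
    then show ?thesis using low[of b a] assms approx_code_swap by blast
  next
    case 3
    \<comment> \<open>The solution of p + q / 2 = a and p / 2 + q = b, the weights of the two corner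
      points. Silence takes the rest, which is nonnegative because p + q = 2 * (a + b) / 3.\<close>
    define p q where "p = (4 * a - 2 * b) / 3" and "q = (4 * b - 2 * a) / 3"
    have "approx_code (p * 1 + q * (1 / 2) + 0) (p * (1 / 2) + q * 1 + 0) (p * 1 + q * 1 + (1 - p - q))"
      using 3 assms
      by (intro approx_code_add approx_code_scale approx_code_corner approx_code_swap[OF approx_code_corner] approx_code_zero)
         (auto simp: p_def q_def field_simps)
    moreover have "p * 1 + q * (1 / 2) + 0 = a" "p * (1 / 2) + q * 1 + 0 = b" "p * 1 + q * 1 + (1 - p - q) = 1"
      by (simp_all add: p_def q_def field_simps)
    ultimately show ?thesis by metis
  qed
qed

section \<open>Exact numbers of messages\<close>

lemma num_messages_bounds:
  assumes "R \<ge> 0"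
  shows "num_messages R n \<ge> 1" "real (num_messages R n) \<le> 2 powr (real n * R)"
    "2 powr (real n * R) \<le> 2 * real (num_messages R n)"
proof -
  have g: "1 \<le> 2 powr (real n * R)" using assms by (simp add: ge_one_powr_ge_zero)
  then have fl: "\<lfloor>2 powr (real n * R)\<rfloor> \<ge> 1" by linarith
  have N: "real (num_messages R n) = of_int \<lfloor>2 powr (real n * R)\<rfloor>" and N1: "num_messages R n \<ge> 1"
    unfolding num_messages_def using fl by linarith+
  show "num_messages R n \<ge> 1" by (rule N1)
  show "real (num_messages R n) \<le> 2 powr (real n * R)" unfolding N by simp
  have "2 powr (real n * R) \<le> of_int \<lfloor>2 powr (real n * R)\<rfloor> + 1" by linarith
  then show "2 powr (real n * R) \<le> 2 * real (num_messages R n)" using N N1 by linarith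
qed

text \<open>The bounds on 2 ^ k are those under which a code may be restricted to the exact number
  of messages.\<close>

lemma num_messages_bits:
  assumes "R \<ge> 0"
  obtains k where "num_messages R n \<le> 2 ^ k" "2 ^ k \<le> 2 * num_messages R n"
    "real n * R \<le> real k" "real k \<le> real n * R + 1"
proof -
  define k where "k = nat \<lfloor>real n * R\<rfloor>"
  have nn: "0 \<le> real n * R" using assms by simp
  have k: "real k \<le> real n * R" "real n * R \<le> real (Suc k)"
    unfolding k_def using nn by (auto simp: of_nat_nat) linarith
  have p: "(2::real) ^ j = 2 powr real j" for j by (simp add: powr_realpow)
  have "real (2 ^ k) \<le> 2 powr (real n * R)" using k(1) by (simp add: p)
  then have "int (2 ^ k) \<le> \<lfloor>2 powr (real n * R)\<rfloor>" by (simp add: le_floor_iff)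
  then have le: "2 ^ k \<le> num_messages R n" unfolding num_messages_def by linarith
  have "real (num_messages R n) \<le> 2 powr (real (Suc k))"
    using num_messages_bounds(2)[OF assms] k(2) order_trans by (metis powr_mono one_le_numeral)
  also have "\<dots> = real (2 ^ Suc k)" unfolding p[symmetric] by simp
  finally have "num_messages R n \<le> 2 ^ Suc k" by linarith
  moreover have "2 ^ Suc k \<le> 2 * num_messages R n" using le by simp
  ultimately show thesis using that[of "Suc k"] k by auto
qed

text \<open>Achievability prescribes the number of messages, whereas \<open>approx_code\<close>
  controls the bits only up to an error. So the rates aimed at are lower by \<mu>, single-user
  codes, whose number of bits can be chosen exactly, supply the difference, and the result is cut
  down by a factor of at most 2.\<close>

lemma id_code_exact_rate:
  fixes \<epsilon> :: real
  assumes "0 < a" "a < 1" "0 < b" "b < 1" "a + b < 3 / 2" "\<epsilon> > 0"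
  shows "\<forall>\<^sub>F n in sequentially. id_code {1..num_messages a n} {1..num_messages b n} n \<epsilon>"
proof -
  \<comment> \<open>A fraction \<open>5 * \<mu>\<close> of the block length is reserved for sending the missing bits of each user separately.\<close>
  define \<mu> where "\<mu> = Min {a, b, (1 - a) / 4, (1 - b) / 4, (3 / 2 - a - b) / 6, 1 / 10}"
  have \<mu>0: "\<mu> > 0" using assms by (simp add: \<mu>_def)
  have "\<mu> \<le> a" "\<mu> \<le> b" "\<mu> \<le> (1 - a) / 4" "\<mu> \<le> (1 - b) / 4" "\<mu> \<le> (3 / 2 - a - b) / 6" "\<mu> \<le> 1 / 10"
    unfolding \<mu>_def by (rule Min_le; simp)+
  then have \<mu>: "\<mu> \<le> a" "\<mu> \<le> b" "4 * \<mu> \<le> 1 - a" "4 * \<mu> \<le> 1 - b" "6 * \<mu> \<le> 3 / 2 - a - b" "\<mu> \<le> 1 / 10"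
    by (simp_all add: field_simps)
  define t where "t = 1 - 5 * \<mu>"
  have t: "t > 0" using \<mu>(6) by (simp add: t_def)
  have "approx_code ((a - \<mu>) / t) ((b - \<mu>) / t) 1"
  proof (rule approx_code_region)
    have "a - \<mu> \<le> t" "b - \<mu> \<le> t" using \<mu> by (simp_all add: t_def)
    then show "(a - \<mu>) / t \<le> 1" "(b - \<mu>) / t \<le> 1" using t by simp_all
    have "(a - \<mu>) + (b - \<mu>) \<le> 3 / 2 * t" using \<mu>(5) \<mu>0 by (simp add: t_def)
    then show "(a - \<mu>) / t + (b - \<mu>) / t \<le> 3 / 2"
      unfolding add_divide_distrib[symmetric] using t by (simp add: pos_divide_le_eq)
  qed (use t \<mu> in auto)
  then have "approx_code (t * ((a - \<mu>) / t)) (t * ((b - \<mu>) / t)) (t * 1)"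
    using t by (intro approx_code_scale) auto
  then have ap: "approx_code (a - \<mu>) (b - \<mu>) t" using t by simp
  have e6: "\<epsilon> / 6 > 0" "\<mu> / 4 > 0" using assms \<mu>0 by auto
  obtain k0 where k0: "\<And>k. k \<ge> k0 \<Longrightarrow> \<exists>n. real n \<le> (1 + 1 / 4) * real k \<and> bit_code k 0 n (\<epsilon> / 6)"
    using bit_code_single[OF e6(1), of "1 / 4"] by auto
  have "\<forall>\<^sub>F n :: nat in sequentially. max (real k0) 3 \<le> 3 / 4 * \<mu> * real n"
    using \<mu>0 by real_asymp
  then show ?thesis using approx_codeD[OF ap e6]
  proof eventually_elim
    case (elim n)
    then have big: "real k0 \<le> 3 / 4 * (\<mu> * real n)" "3 \<le> 3 / 4 * (\<mu> * real n)" by auto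
    obtain k l n1 where c: "\<bar>real k - (a - \<mu>) * real n\<bar> \<le> \<mu> / 4 * real n"
      "\<bar>real l - (b - \<mu>) * real n\<bar> \<le> \<mu> / 4 * real n"
      "real n1 \<le> (t + \<mu> / 4) * real n" "bit_code k l n1 (\<epsilon> / 6)" using elim(2) by blast
    \<comment> \<open>Each user misses between 3/4 * \<mu> * n and 5/4 * \<mu> * n + 1 bits, sent
      with overhead factor 5/4. Both users together need at most 25/8 * \<mu> * n + 5/2 uses, which
      fits into the 19/4 * \<mu> * n uses left over.\<close>
    have rest: "\<exists>k' nk. real nk \<le> 25 / 16 * (\<mu> * real n) + 5 / 4 \<and> bit_code k' 0 nk (\<epsilon> / 6) \<and>
       num_messages R n \<le> 2 ^ (k + k') \<and> 2 ^ (k + k') \<le> 2 * num_messages R n"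
      if R: "R \<ge> 0" and k: "\<bar>real k - (R - \<mu>) * real n\<bar> \<le> \<mu> / 4 * real n" for R k
    proof -
      obtain kR where kR: "num_messages R n \<le> 2 ^ kR" "2 ^ kR \<le> 2 * num_messages R n"
        "real n * R \<le> real kR" "real kR \<le> real n * R + 1" using num_messages_bits[OF R] by blast
      have k': "\<bar>real k - real n * R + \<mu> * real n\<bar> \<le> 1 / 4 * (\<mu> * real n)" using k by (simp add: algebra_simps)
      then have lo: "real k + 3 / 4 * (\<mu> * real n) \<le> real kR" and hi: "real kR \<le> real k + 5 / 4 * (\<mu> * real n) + 1"
        using kR(3,4) by linarith+
      have "0 \<le> \<mu> * real n" using \<mu>0 by simp
      then have "k \<le> kR" using lo by linarith
      define k' where "k' = kR - k"
      have kk: "k + k' = kR" using \<open>k \<le> kR\<close> by (simp add: k'_def)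
      then have rk: "real k' = real kR - real k" by (simp add: algebra_simps flip: of_nat_add)
      have "k0 \<le> k'" using lo big(1) rk by linarith
      then obtain nk where nk: "real nk \<le> (1 + 1 / 4) * real k'" "bit_code k' 0 nk (\<epsilon> / 6)" using k0 by blast
      have "real nk \<le> 25 / 16 * (\<mu> * real n) + 5 / 4" using nk(1) hi rk by (simp add: field_simps)
      then show ?thesis using nk(2) kR(1,2) kk by blast
    qed
    obtain ka na where A: "real na \<le> 25 / 16 * (\<mu> * real n) + 5 / 4" "bit_code ka 0 na (\<epsilon> / 6)"
       "num_messages a n \<le> 2 ^ (k + ka)" "2 ^ (k + ka) \<le> 2 * num_messages a n"
      using rest[OF _ c(1)] assms(1) by auto
    obtain kb nb where B: "real nb \<le> 25 / 16 * (\<mu> * real n) + 5 / 4" "bit_code kb 0 nb (\<epsilon> / 6)"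
       "num_messages b n \<le> 2 ^ (l + kb)" "2 ^ (l + kb) \<le> 2 * num_messages b n"
      using rest[OF _ c(2)] assms(3) by auto
    have "bit_code (k + ka + 0) (l + 0 + kb) (n1 + na + nb) (\<epsilon> / 6 + \<epsilon> / 6 + \<epsilon> / 6)"
      by (intro bit_code_add c(4) A(2) bit_code_swap[OF B(2)])
    then have "bit_code (k + ka) (l + kb) (n1 + na + nb) (\<epsilon> / 2)" by simp
    moreover have "n1 + na + nb \<le> n"
    proof -
      have "real n1 \<le> real n - 19 / 4 * (\<mu> * real n)" using c(3) by (simp add: t_def algebra_simps)
      then have "real (n1 + na + nb) \<le> real n" using A(1) B(1) big(2) by simp
      then show ?thesis by linarith
    qed
    ultimately have "bit_code (k + ka) (l + kb) n (\<epsilon> / 2)" by (rule bit_code_pad)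
    then have "id_code {1..2 ^ (k + ka) :: nat} {1..2 ^ (l + kb) :: nat} n (\<epsilon> / 2)"
      by (subst (asm) bit_code_iff[of "{1..2 ^ (k + ka) :: nat}" "{1..2 ^ (l + kb) :: nat}"]) auto
    then have "id_code {1..num_messages a n} {1..num_messages b n} n (2 * (\<epsilon> / 2))"
      by (rule id_code_subset) (use A(3,4) B(3,4) assms(6) in auto)
    then show ?case by simp
  qed
qed

subsection \<open>Transfer to the channel\<close>

definition to_word :: "nat \<Rightarrow> bool list \<Rightarrow> nat \<Rightarrow> nat" where
  "to_word n x = (\<lambda>i\<in>{..<n}. of_bool (x ! i))"

definition of_word :: "nat \<Rightarrow> (nat \<Rightarrow> nat) \<Rightarrow> bool list" where
  "of_word n w = map (\<lambda>i. w i = 1) [0..<n]"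

definition output_word :: "nat \<Rightarrow> (nat \<Rightarrow> nat) \<Rightarrow> (nat \<Rightarrow> nat) \<Rightarrow> nat \<Rightarrow> nat" where
  "output_word n x y = (\<lambda>i\<in>{..<n}. x i + y i)"

lemma to_word_in_words: "to_word n x \<in> words inputs n"
  by (auto simp: to_word_def words_def inputs_def)

lemma length_of_word [simp]: "length (of_word n w) = n"
  by (simp add: of_word_def)

lemma to_word_of_word: "w \<in> words inputs n \<Longrightarrow> to_word n (of_word n w) = w"
  unfolding to_word_def of_word_def words_def inputs_def
  by (rule ext) (force simp: PiE_iff extensional_def restrict_def)

lemma output_word_in_words:
  assumes "x \<in> words inputs n" "y \<in> words inputs n"
  shows "output_word n x y \<in> words outputs n"
proof -
  have "x i + y i \<in> outputs" if "i < n" for i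
  proof -
    have "x i \<in> {0, 1}" "y i \<in> {0, 1}" using assms that by (auto simp: words_def inputs_def PiE_iff)
    then show ?thesis by (auto simp: outputs_def)
  qed
  then show ?thesis by (auto simp: output_word_def words_def)
qed

lemma map_output_word:
  assumes "length x = n" "length y = n"
  shows "map (output_word n (to_word n x) (to_word n y)) [0..<n] = recv x y"
  using assms by (intro nth_equalityI) (auto simp: output_word_def to_word_def nth_recv)

lemma prob_erasure_mac:
  assumes "x \<in> words inputs n" "y \<in> words inputs n"
  shows "measure_pmf.prob (product_channel erasure_mac n x y) {z \<in> words outputs n. P z}
       = of_bool (P (output_word n x y))"
proof -
  have "product_channel erasure_mac n x y = return_pmf (\<lambda>i. if i \<in> {..<n} then x i + y i else undefined)"
    unfolding product_channel_def erasure_mac_def by (subst Pi_pmf_return_pmf) auto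
  also have "(\<lambda>i. if i \<in> {..<n} then x i + y i else undefined) = output_word n x y"
    by (simp add: output_word_def restrict_def)
  finally show ?thesis
    using output_word_in_words[OF assms] by (simp add: measure_return_pmf indicator_def)
qed

lemma words_finite_nonempty: "finite (words inputs n)" "words inputs n \<noteq> {}"
  using to_word_in_words by (simp add: words_def inputs_def finite_PiE, blast)

lemma sum_of_bool_card: "finite A \<Longrightarrow> (\<Sum>a\<in>A. of_bool (P a)) = real (card {a\<in>A. P a})"
  by (simp add: of_bool_def sum.inter_filter[symmetric])

text \<open>With both users honest, decoding fails only if the verdict is unsafe against
  \<open>A\<close> or against \<open>B\<close>; summing the two averages gives the factor 2.\<close>

lemma adv_id_code_of_id_code:
  assumes code: "id_code {1..NA} {1..NB} n e" and N: "NA \<ge> 1" "NB \<ge> 1"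
  shows "\<exists>fA fB \<phi>. adv_id_code NA NB n fA fB \<phi> \<and> err_adv_id erasure_mac NA NB n fA fB \<phi> \<le> 2 * e"
proof -
  obtain gA gB and d :: "nat list \<Rightarrow> (nat, nat) verdict" where c:
    "\<And>a. a \<in> {1..NA} \<Longrightarrow> length (gA a) = n" "\<And>b. b \<in> {1..NB} \<Longrightarrow> length (gB b) = n"
    "\<And>x. length x = n \<Longrightarrow>
       real (card {b\<in>{1..NB}. \<not> safe_A (d (recv x (gB b))) b}) \<le> e * real (card {1..NB})"
    "\<And>y. length y = n \<Longrightarrow>
       real (card {a\<in>{1..NA}. \<not> safe_B (d (recv (gA a) y)) a}) \<le> e * real (card {1..NA})"
    using code by (rule tag_codeE) blast
  define fA where "fA a = to_word n (gA a)" for a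
  define fB where "fB b = to_word n (gB b)" for b
  \<comment> \<open>The verdict may name messages out of range, for instance after a restriction. An
    honest message is in range, so a safe verdict stays safe when the user named with an impossible
    message is blamed.\<close>
  define \<phi> where "\<phi> z = (case d (map z [0..<n]) of Blame_A \<Rightarrow> Adversary_A | Blame_B \<Rightarrow> Adversary_B
     | Msg a b \<Rightarrow> if a \<notin> {1..NA} then Adversary_A else if b \<notin> {1..NB} then Adversary_B else Messages (a, b))"
    for z :: "nat \<Rightarrow> nat"
  have fA: "fA a \<in> words inputs n" and fB: "fB a \<in> words inputs n" for a
    by (auto simp: fA_def fB_def to_word_in_words)
  have e0: "0 \<le> e"
    using c(3)[of "replicate n False"] N(2) by (auto simp: zero_le_mult_iff dest: order_trans[OF of_nat_0_le_iff])
  let ?badA = "\<lambda>x b. \<phi> (output_word n x (fB b)) \<notin> Messages ` ({1..NA} \<times> {b}) \<union> {Adversary_A}"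
  let ?badB = "\<lambda>y a. \<phi> (output_word n (fA a) y) \<notin> Messages ` ({a} \<times> {1..NB}) \<union> {Adversary_B}"
  have A: "real (card {b\<in>{1..NB}. ?badA x b}) \<le> e * real NB" if x: "x \<in> words inputs n" for x
  proof -
    have "card {b\<in>{1..NB}. ?badA x b} \<le> card {b\<in>{1..NB}. \<not> safe_A (d (recv (of_word n x) (gB b))) b}"
    proof (intro card_mono subsetI)
      fix b assume b: "b \<in> {b\<in>{1..NB}. ?badA x b}"
      then have "map (output_word n x (fB b)) [0..<n] = recv (of_word n x) (gB b)"
        using map_output_word[of "of_word n x" n "gB b"] c(2) by (simp add: to_word_of_word[OF x] fB_def)
      then show "b \<in> {b\<in>{1..NB}. \<not> safe_A (d (recv (of_word n x) (gB b))) b}"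
        using b by (auto simp: \<phi>_def safe_A_def split: if_splits)
    qed simp
    then show ?thesis using c(3)[of "of_word n x"] by simp
  qed
  have B: "real (card {a\<in>{1..NA}. ?badB y a}) \<le> e * real NA" if y: "y \<in> words inputs n" for y
  proof -
    have "card {a\<in>{1..NA}. ?badB y a} \<le> card {a\<in>{1..NA}. \<not> safe_B (d (recv (gA a) (of_word n y))) a}"
    proof (intro card_mono subsetI)
      fix a assume a: "a \<in> {a\<in>{1..NA}. ?badB y a}"
      then have "map (output_word n (fA a) y) [0..<n] = recv (gA a) (of_word n y)"
        using map_output_word[of "gA a" n "of_word n y"] c(1) by (simp add: to_word_of_word[OF y] fA_def)
      then show "a \<in> {a\<in>{1..NA}. \<not> safe_B (d (recv (gA a) (of_word n y))) a}"
        using a by (auto simp: \<phi>_def safe_B_def split: if_splits)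
    qed simp
    then show ?thesis using c(4)[of "of_word n y"] by simp
  qed
  have "err_malicious_A erasure_mac NA NB n fB \<phi> \<le> e"
  proof -
    have "1 / real NB * (\<Sum>mB\<in>{1..NB}. measure_pmf.prob (product_channel erasure_mac n x (fB mB))
         {z \<in> words outputs n. \<phi> z \<notin> Messages ` ({1..NA} \<times> {mB}) \<union> {Adversary_A}}) \<le> e"
      if x: "x \<in> words inputs n" for x
      using A[OF x] N unfolding prob_erasure_mac[OF x fB] sum_of_bool_card[OF finite_atLeastAtMost]
      by (simp add: field_simps)
    then show ?thesis unfolding err_malicious_A_def using words_finite_nonempty by (intro Max.boundedI) auto
  qed
  moreover have "err_malicious_B erasure_mac NA NB n fA \<phi> \<le> e"
  proof -
    have "1 / real NA * (\<Sum>mA\<in>{1..NA}. measure_pmf.prob (product_channel erasure_mac n (fA mA) y)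
         {z \<in> words outputs n. \<phi> z \<notin> Messages ` ({mA} \<times> {1..NB}) \<union> {Adversary_B}}) \<le> e"
      if y: "y \<in> words inputs n" for y
      using B[OF y] N unfolding prob_erasure_mac[OF fA y] sum_of_bool_card[OF finite_atLeastAtMost]
      by (simp add: field_simps)
    then show ?thesis unfolding err_malicious_B_def using words_finite_nonempty by (intro Max.boundedI) auto
  qed
  moreover have "err_honest erasure_mac NA NB n fA fB \<phi> \<le> 2 * e"
  proof -
    have "(\<Sum>mA\<in>{1..NA}. \<Sum>mB\<in>{1..NB}. of_bool (\<phi> (output_word n (fA mA) (fB mB)) \<noteq> Messages (mA, mB)))
      \<le> (\<Sum>mA\<in>{1..NA}. \<Sum>mB\<in>{1..NB}. of_bool (?badA (fA mA) mB) + (of_bool (?badB (fB mB) mA) :: real))"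
      by (intro sum_mono) auto
    also have "\<dots> = (\<Sum>mA\<in>{1..NA}. \<Sum>mB\<in>{1..NB}. of_bool (?badA (fA mA) mB))
        + (\<Sum>mB\<in>{1..NB}. \<Sum>mA\<in>{1..NA}. of_bool (?badB (fB mB) mA))"
      unfolding sum.distrib by (subst (2) sum.swap) (rule refl)
    also have "\<dots> \<le> (\<Sum>mA\<in>{1..NA}. e * real NB) + (\<Sum>mB\<in>{1..NB}. e * real NA)"
      unfolding sum_of_bool_card[OF finite_atLeastAtMost] by (intro add_mono sum_mono A B fA fB)
    also have "\<dots> = 2 * e * (real NA * real NB)" by (simp add: algebra_simps)
    finally show ?thesis unfolding err_honest_def prob_erasure_mac[OF fA fB] using N by (simp add: field_simps)
  qed
  ultimately have "err_adv_id erasure_mac NA NB n fA fB \<phi> \<le> 2 * e"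
    unfolding err_adv_id_def using e0 by auto
  moreover have "adv_id_code NA NB n fA fB \<phi>"
    unfolding adv_id_code_def using fA fB by (auto simp: \<phi>_def split: verdict.splits)
  ultimately show ?thesis by blast
qed

subsection \<open>Converse\<close>

text \<open>Jensen's inequality for the logarithm, with weights proportional to r^2 and (1 - r)^2
  and written with tangents, bounds the left side by - S * ln S, where S is the sum of the weights.
  Since S \<ge> 1/2, a second tangent, at S = 1/2, gives the value attained at r = 1/2.\<close>

lemma sq_neg_ln_le:
  fixes r :: real
  assumes "0 \<le> r" "r \<le> 1"
  shows "r\<^sup>2 * (- ln r) + (1 - r)\<^sup>2 * (- ln (1 - r)) \<le> ln 2 / 2"
proof (cases "r = 0 \<or> r = 1")
  case True
  then show ?thesis by auto
next
  case False
  then have r: "0 < r" "r < 1" using assms by auto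
  define S where "S = r\<^sup>2 + (1 - r)\<^sup>2"
  have "0 \<le> (2 * r - 1)\<^sup>2" by simp
  then have S: "1 / 2 \<le> S" by (simp add: S_def power2_eq_square algebra_simps)
  have bound: "x\<^sup>2 * (- ln x) \<le> x * S - x\<^sup>2 - x\<^sup>2 * ln S" if "0 < x" for x
  proof -
    have "ln (S / x) \<le> S / x - 1" using that S by (intro ln_le_minus_one) auto
    then have "- ln x \<le> S / x - 1 - ln S" using that S by (simp add: ln_div)
    then have "x\<^sup>2 * (- ln x) \<le> x\<^sup>2 * (S / x - 1 - ln S)" by (intro mult_left_mono) auto
    also have "\<dots> = x * S - x\<^sup>2 - x\<^sup>2 * ln S" using that by (simp add: power2_eq_square algebra_simps)
    finally show ?thesis .
  qed
  have "r\<^sup>2 * (- ln r) + (1 - r)\<^sup>2 * (- ln (1 - r)) \<le> (r + (1 - r)) * S - S - S * ln S"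
    using bound[of r] bound[of "1 - r"] r unfolding S_def by (simp add: algebra_simps)
  also have "\<dots> = S * (- ln S)" by simp
  also have "\<dots> \<le> S * (ln 2 + (1 / (2 * S) - 1))"
  proof (intro mult_left_mono)
    have "ln (1 / (2 * S)) \<le> 1 / (2 * S) - 1" using S by (intro ln_le_minus_one) auto
    then show "- ln S \<le> ln 2 + (1 / (2 * S) - 1)" using S by (simp add: ln_div ln_mult)
  qed (use S in auto)
  also have "\<dots> = 1 / 2 - S * (1 - ln 2)" using S by (simp add: field_simps)
  also have "\<dots> \<le> 1 / 2 - 1 / 2 * (1 - ln 2)"
    using S ln_le_minus_one[of "2::real"] by (intro diff_left_mono mult_right_mono) auto
  also have "\<dots> = ln 2 / 2" by (simp add: algebra_simps diff_divide_distrib)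
  finally show ?thesis .
qed

text \<open>By the inequality of arithmetic and geometric means, replacing p and q by their mean can
  only increase both products, which reduces the claim to one variable.\<close>

lemma cross_entropy_le:
  fixes p q :: real
  assumes "0 \<le> p" "p \<le> 1" "0 \<le> q" "q \<le> 1"
  defines "r \<equiv> (p + q) / 2"
  shows "p * q * (- log 2 r) + (1 - p) * (1 - q) * (- log 2 (1 - r)) \<le> 1 / 2"
proof -
  have r: "0 \<le> r" "r \<le> 1" using assms by auto
  have "0 \<le> (p - q)\<^sup>2" by simp
  then have pq: "p * q \<le> r\<^sup>2" "(1 - p) * (1 - q) \<le> (1 - r)\<^sup>2"
    by (simp_all add: r_def power2_eq_square field_simps)
  have "0 \<le> - ln x" if "0 \<le> x" "x \<le> 1" for x :: real
    using that by (cases "x = 0") auto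
  then have nn: "0 \<le> - ln r" "0 \<le> - ln (1 - r)" using r by simp_all
  have "p * q * (- ln r) + (1 - p) * (1 - q) * (- ln (1 - r)) \<le> r\<^sup>2 * (- ln r) + (1 - r)\<^sup>2 * (- ln (1 - r))"
    by (intro add_mono mult_right_mono pq nn)
  also have "\<dots> \<le> ln 2 / 2" by (rule sq_neg_ln_le[OF r])
  finally have "(p * q * (- ln r) + (1 - p) * (1 - q) * (- ln (1 - r))) / ln 2 \<le> 1 / 2"
    by (simp add: field_simps)
  then show ?thesis by (simp add: log_def add_divide_distrib diff_divide_distrib)
qed

section \<open>Correctly decoded pairs of a non-adversarial code\<close>

lemma sum_both_equal:
  assumes "finite A" "finite B"
  shows "(\<Sum>a\<in>A. \<Sum>b\<in>B. if P a \<and> Q b then c else (0::real)) = real (card {a\<in>A. P a}) * real (card {b\<in>B. Q b}) * c"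
proof -
  have "(\<Sum>b\<in>B. if P a \<and> Q b then c else 0) = (if P a then real (card {b\<in>B. Q b}) * c else 0)" for a
    using assms by (simp add: sum.inter_filter[symmetric])
  then show ?thesis using assms by (simp add: sum.inter_filter[symmetric])
qed

text \<open>The junk value \<open>log 2 0 = 0\<close> only affects letters that never occur.\<close>

definition cost :: "real \<Rightarrow> nat \<Rightarrow> real" where
  "cost r z = 1 + (if z = 2 then - log 2 r else if z = 0 then - log 2 (1 - r) else 0)"

text \<open>For a uniform pair of messages the two letters at a position are independent, with
  probabilities p and q of a one; the average cost is one bit plus the cross-entropy term already
  bounded.\<close>

lemma sum_cost_le:
  fixes x y :: "nat \<Rightarrow> nat"
  assumes "finite A" "A \<noteq> {}" "finite B" "B \<noteq> {}" "\<And>a. a \<in> A \<Longrightarrow> x a \<in> {0, 1}" "\<And>b. b \<in> B \<Longrightarrow> y b \<in> {0, 1}"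
  defines "r \<equiv> (real (card {a\<in>A. x a = 1}) / real (card A) + real (card {b\<in>B. y b = 1}) / real (card B)) / 2"
  shows "(\<Sum>a\<in>A. \<Sum>b\<in>B. cost r (x a + y b)) \<le> 3 / 2 * (real (card A) * real (card B))"
proof -
  define p where "p = real (card {a\<in>A. x a = 1}) / real (card A)"
  define q where "q = real (card {b\<in>B. y b = 1}) / real (card B)"
  have r: "r = (p + q) / 2" by (simp add: r_def p_def q_def)
  have pos: "real (card A) > 0" "real (card B) > 0" using assms by (simp_all add: card_gt_0_iff)
  have co: "real (card {u\<in>U. w u = 0}) = real (card U) - real (card {u\<in>U. w u = 1})"
    if "finite U" "\<And>u. u \<in> U \<Longrightarrow> w u \<in> {0, 1}" for U :: "nat set" and w :: "nat \<Rightarrow> nat"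
  proof -
    have "{u\<in>U. w u = 0} = U - {u\<in>U. w u = 1}" using that by auto
    then show ?thesis using that(1) by (simp add: card_Diff_subset of_nat_diff card_mono)
  qed
  have le: "card {u\<in>U. w u = 1} \<le> card U" if "finite U" for U :: "nat set" and w :: "nat \<Rightarrow> nat"
    using that by (intro card_mono) auto
  have pq: "0 \<le> p" "p \<le> 1" "0 \<le> q" "q \<le> 1"
    using pos le[OF assms(1), of x] le[OF assms(3), of y] by (auto simp: p_def q_def divide_le_eq_1)
  have A1: "real (card {a\<in>A. x a = 1}) = real (card A) * p" and B1: "real (card {b\<in>B. y b = 1}) = real (card B) * q"
    using pos by (auto simp: p_def q_def)
  have A0: "real (card {a\<in>A. x a = 0}) = real (card A) * (1 - p)" and B0: "real (card {b\<in>B. y b = 0}) = real (card B) * (1 - q)"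
    using co[of A x, OF assms(1,5)] co[of B y, OF assms(3,6)] A1 B1 by (simp_all add: algebra_simps)
  have "(\<Sum>a\<in>A. \<Sum>b\<in>B. cost r (x a + y b)) = (\<Sum>a\<in>A. \<Sum>b\<in>B. 1
      + (if x a = 1 \<and> y b = 1 then - log 2 r else 0) + (if x a = 0 \<and> y b = 0 then - log 2 (1 - r) else 0))"
    using assms(5,6) by (intro sum.cong refl) (force simp: cost_def)
  also have "\<dots> = real (card A) * real (card B)
      + (real (card A) * p) * (real (card B) * q) * (- log 2 r)
      + (real (card A) * (1 - p)) * (real (card B) * (1 - q)) * (- log 2 (1 - r))"
    unfolding sum.distrib sum_both_equal[OF assms(1,3)] A0 A1 B0 B1 by simp
  also have "\<dots> = real (card A) * real (card B) * (1 + (p * q * (- log 2 r) + (1 - p) * (1 - q) * (- log 2 (1 - r))))"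
    by (simp add: algebra_simps)
  also have "\<dots> \<le> real (card A) * real (card B) * (1 + 1 / 2)"
    unfolding r by (intro mult_left_mono add_left_mono cross_entropy_le pq) auto
  finally show ?thesis by simp
qed

definition weight :: "real \<Rightarrow> nat \<Rightarrow> real" where
  "weight r z = (if z = 2 then r / 2 else if z = 0 then (1 - r) / 2 else 1 / 2)"

lemma weight_eq_powr_cost:
  assumes "0 \<le> r" "r \<le> 1" "z = 2 \<Longrightarrow> r \<noteq> 0" "z = 0 \<Longrightarrow> r \<noteq> 1"
  shows "weight r z = 2 powr (- cost r z)"
proof -
  have "2 powr (- cost r z) = 2 powr - 1 * 2 powr (1 - cost r z)" unfolding powr_add[symmetric] by simp
  moreover have "2 powr (1 - cost r z) = (if z = 2 then r else if z = 0 then 1 - r else 1)"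
    using assms by (auto simp: cost_def)
  moreover have "2 powr - 1 = (1 / 2 :: real)" by (simp add: powr_minus_divide)
  ultimately have "2 powr (- cost r z) = 1 / 2 * (if z = 2 then r else if z = 0 then 1 - r else 1)"
    by (simp only:)
  then show ?thesis unfolding weight_def by (simp only:) auto
qed

text \<open>By Markov's inequality, outputs of total cost above \<open>M\<close> account for at most
  the fraction (3/2) / (3/2 + \<delta>) of the pairs. The remaining pairs of \<open>G\<close> have
  distinct outputs, each of weight at least 2^-M; the product weights sum to 1, so there are at most
  2^M of them.\<close>

lemma good_pairs_sum_bound:
  fixes fA fB :: "nat \<Rightarrow> nat \<Rightarrow> nat" and \<delta> :: real
  assumes A: "finite A" "A \<noteq> {}" and B: "finite B" "B \<noteq> {}"
    and fA: "\<And>a. a \<in> A \<Longrightarrow> fA a \<in> words inputs n" and fB: "\<And>b. b \<in> B \<Longrightarrow> fB b \<in> words inputs n"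
    and G: "G \<subseteq> A \<times> B" "inj_on (\<lambda>(a, b). output_word n (fA a) (fB b)) G"
    and "\<delta> > 0" "n > 0"
  shows "real (card G) \<le> (3 / 2) / (3 / 2 + \<delta>) * (real (card A) * real (card B)) + 2 powr ((3 / 2 + \<delta>) * real n)"
proof -
  define r where "r i = (real (card {a\<in>A. fA a i = 1}) / real (card A)
     + real (card {b\<in>B. fB b i = 1}) / real (card B)) / 2" for i
  define L where "L z = (\<Sum>i<n. cost (r i) (z i))" for z :: "nat \<Rightarrow> nat"
  define M where "M = (3 / 2 + \<delta>) * real n"
  have M: "M > 0" using assms by (simp add: M_def)
  have pos: "real (card A) > 0" "real (card B) > 0" using A B by (simp_all add: card_gt_0_iff)
  have xa: "fA a i \<in> {0, 1}" if "a \<in> A" "i < n" for a i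
    using fA[OF that(1)] that(2) by (auto simp: words_def inputs_def PiE_iff)
  have yb: "fB b i \<in> {0, 1}" if "b \<in> B" "i < n" for b i
    using fB[OF that(1)] that(2) by (auto simp: words_def inputs_def PiE_iff)
  have le1: "real (card {a\<in>A. fA a i = 1}) / real (card A) \<le> 1" "real (card {b\<in>B. fB b i = 1}) / real (card B) \<le> 1" for i
    using A B pos by (auto simp: divide_le_eq_1 intro!: card_mono)
  have ge0: "0 \<le> real (card {a\<in>A. fA a i = 1}) / real (card A)" "0 \<le> real (card {b\<in>B. fB b i = 1}) / real (card B)" for i
    by simp_all
  have mid: "0 \<le> (u + v) / 2" "(u + v) / 2 \<le> 1" if "0 \<le> u" "u \<le> 1" "0 \<le> v" "v \<le> 1" for u v :: real
    using that by auto
  have r0: "0 \<le> r i" for i unfolding r_def by (rule mid(1)[OF ge0(1) le1(1) ge0(2) le1(2)])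
  have r1: "r i \<le> 1" for i unfolding r_def by (rule mid(2)[OF ge0(1) le1(1) ge0(2) le1(2)])
  note r = r0 r1
  have log0: "log 2 0 = (0 :: real)" by (simp add: log_def)
  have cost0: "0 \<le> cost (r i) z" for i z
    using r[of i] by (cases "r i = 0"; cases "r i = 1") (auto simp: cost_def log0)
  have L0: "0 \<le> L z" for z unfolding L_def by (intro sum_nonneg cost0)
  have pairs: "weight (r i) (fA a i + fB b i) = 2 powr (- cost (r i) (fA a i + fB b i))"
    if ab: "a \<in> A" "b \<in> B" and i: "i < n" for a b i
  proof (rule weight_eq_powr_cost[OF r])
    assume "fA a i + fB b i = 2"
    then have "fA a i = 1" using xa[OF ab(1) i] yb[OF ab(2) i] by auto
    then have "card {a\<in>A. fA a i = 1} > 0" using ab A by (auto simp: card_gt_0_iff)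
    then have "0 < real (card {a\<in>A. fA a i = 1}) / real (card A)" using pos by simp
    then have "0 < r i" using ge0(2)[of i] unfolding r_def by (intro half_gt_zero add_pos_nonneg)
    then show "r i \<noteq> 0" by simp
  next
    assume "fA a i + fB b i = 0"
    then have "a \<notin> {a\<in>A. fA a i = 1}" by simp
    then have "{a\<in>A. fA a i = 1} \<subset> A" using ab(1) by blast
    then have "card {a\<in>A. fA a i = 1} < card A" using A by (intro psubset_card_mono) auto
    then have "real (card {a\<in>A. fA a i = 1}) / real (card A) < 1" using pos by simp
    then have "2 * r i < 1 + 1" using le1(2)[of i] unfolding r_def by (simp add: add_less_le_mono)
    then show "r i \<noteq> 1" by simp
  qed
  have "(\<Sum>a\<in>A. \<Sum>b\<in>B. L (output_word n (fA a) (fB b))) = (\<Sum>a\<in>A. \<Sum>b\<in>B. \<Sum>i<n. cost (r i) (fA a i + fB b i))"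
    by (intro sum.cong refl) (simp add: L_def output_word_def)
  also have "\<dots> = (\<Sum>a\<in>A. \<Sum>i<n. \<Sum>b\<in>B. cost (r i) (fA a i + fB b i))"
    by (intro sum.cong refl sum.swap)
  also have "\<dots> = (\<Sum>i<n. \<Sum>a\<in>A. \<Sum>b\<in>B. cost (r i) (fA a i + fB b i))" by (rule sum.swap)
  also have "\<dots> \<le> (\<Sum>i<n. 3 / 2 * (real (card A) * real (card B)))"
    unfolding r_def using A B xa yb by (intro sum_mono sum_cost_le) auto
  finally have avg: "(\<Sum>a\<in>A. \<Sum>b\<in>B. L (output_word n (fA a) (fB b))) \<le> 3 / 2 * real n * (real (card A) * real (card B))"
    by simp
  let ?out = "\<lambda>(a, b). output_word n (fA a) (fB b)"
  define H where "H = {p \<in> A \<times> B. M < L (?out p)}"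
  have finAB: "finite (A \<times> B)" using A B by simp
  have "real (card H) * M = (\<Sum>p\<in>H. M)" by simp
  also have "\<dots> \<le> (\<Sum>p\<in>H. L (?out p))" by (intro sum_mono) (auto simp: H_def)
  also have "\<dots> \<le> (\<Sum>p\<in>A \<times> B. L (?out p))" using finAB L0 by (intro sum_mono2) (auto simp: H_def)
  also have "\<dots> = (\<Sum>a\<in>A. \<Sum>b\<in>B. L (output_word n (fA a) (fB b)))"
    by (simp add: sum.cartesian_product case_prod_unfold)
  finally have "real (card H) * M \<le> 3 / 2 * real n * (real (card A) * real (card B))" using avg by linarith
  then have "real n * (real (card H) * (3 / 2 + \<delta>)) \<le> real n * (3 / 2 * (real (card A) * real (card B)))"
    unfolding M_def by (simp only: mult_ac)
  then have "real (card H) * (3 / 2 + \<delta>) \<le> 3 / 2 * (real (card A) * real (card B))"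
    using \<open>n > 0\<close> by (simp only: mult_le_cancel_left_pos of_nat_0_less_iff)
  then have H: "real (card H) \<le> (3 / 2) / (3 / 2 + \<delta>) * (real (card A) * real (card B))"
    using \<open>\<delta> > 0\<close> by (simp add: pos_le_divide_eq algebra_simps)
  define Z where "Z = ?out ` (G - H)"
  have Zsub: "Z \<subseteq> words outputs n"
    using G(1) fA fB output_word_in_words unfolding Z_def by (auto split: prod.splits)
  have w0: "0 \<le> weight (r i) z" for i z using r[of i] by (auto simp: weight_def)
  have "(\<Sum>z\<in>words outputs n. \<Prod>i<n. weight (r i) (z i)) = (\<Prod>i<n. \<Sum>z\<in>outputs. weight (r i) z)"
    unfolding words_def by (rule prod_sum_PiE[symmetric]) (auto simp: outputs_def)
  also have "\<dots> = 1" by (intro prod.neutral) (auto simp: outputs_def weight_def field_simps)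
  finally have total: "(\<Sum>z\<in>words outputs n. \<Prod>i<n. weight (r i) (z i)) = 1" .
  have "real (card Z) * 2 powr (- M) = (\<Sum>z\<in>Z. 2 powr (- M))" by simp
  also have "\<dots> \<le> (\<Sum>z\<in>Z. \<Prod>i<n. weight (r i) (z i))"
  proof (rule sum_mono)
    fix z assume "z \<in> Z"
    then obtain a b where ab: "(a, b) \<in> G - H" "z = output_word n (fA a) (fB b)" unfolding Z_def by auto
    then have m: "a \<in> A" "b \<in> B" using G(1) by auto
    have "L z \<le> M" using ab m by (auto simp: H_def)
    have "(\<Prod>i<n. weight (r i) (z i)) = (\<Prod>i<n. 2 powr (- cost (r i) (z i)))"
      using pairs[OF m] by (intro prod.cong) (auto simp: ab(2) output_word_def)
    also have "\<dots> = 2 powr (- L z)" by (simp add: L_def powr_sum sum_negf[symmetric])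
    finally show "2 powr (- M) \<le> (\<Prod>i<n. weight (r i) (z i))" using \<open>L z \<le> M\<close> by simp
  qed
  also have "\<dots> \<le> (\<Sum>z\<in>words outputs n. \<Prod>i<n. weight (r i) (z i))"
    using Zsub w0 by (intro sum_mono2 prod_nonneg) (auto simp: words_def outputs_def intro: finite_PiE)
  finally have Z: "real (card Z) \<le> 2 powr M" unfolding total by (simp add: powr_minus field_simps)
  have finG: "finite G" using G(1) finAB finite_subset by blast
  have "inj_on ?out (G - H)" by (rule inj_on_subset[OF G(2)]) auto
  then have cZ: "card Z = card (G - H)" unfolding Z_def by (rule card_image)
  have "finite H" using finAB by (simp add: H_def)
  then have "card G \<le> card ((G - H) \<union> H)" using finG by (intro card_mono) auto
  also have "\<dots> \<le> card (G - H) + card H" by (rule card_Un_le)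
  finally have "card G \<le> card (G - H) + card H" .
  then show ?thesis using Z H unfolding cZ M_def by linarith
qed

lemma card_words_inputs: "card (words inputs n) = 2 ^ n"
  by (simp add: words_def inputs_def card_PiE numeral_2_eq_2)

lemma output_word_commute: "output_word n x y = output_word n y x"
  by (simp add: output_word_def add.commute)

text \<open>For fixed b the output depends on a only through the codeword, so distinct outputs force
  distinct pairs of codeword and b.\<close>

lemma good_pairs_single_bound:
  assumes fin: "finite A" "finite B"
    and fA: "\<And>a. a \<in> A \<Longrightarrow> fA a \<in> words inputs n"
    and G: "G \<subseteq> A \<times> B" "inj_on (\<lambda>(a, b). output_word n (fA a) (fB b)) G"
  shows "card G \<le> 2 ^ n * card B"
proof -
  have "card G \<le> card (words inputs n \<times> B)"
  proof (rule card_inj_on_le[of "\<lambda>(a, b). (fA a, b)"])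
    show "inj_on (\<lambda>(a, b). (fA a, b)) G"
      using G(2) unfolding inj_on_def by fastforce
  qed (use G(1) fA fin words_finite_nonempty in auto)
  then show ?thesis by (simp add: card_cartesian_product card_words_inputs)
qed

text \<open>\<open>G\<close> consists of the correctly decoded pairs; on them the decoder inverts
  the output map, which is therefore injective.\<close>

lemma mac_code_good_pairs:
  assumes code: "mac_code NA NB n fA fB \<phi>" and N: "NA \<ge> 1" "NB \<ge> 1"
  obtains G where "G \<subseteq> {1..NA} \<times> {1..NB}" "inj_on (\<lambda>(a, b). output_word n (fA a) (fB b)) G"
    "(1 - err_mac erasure_mac NA NB n fA fB \<phi>) * (real NA * real NB) \<le> real (card G)"
    "\<And>a. a \<in> {1..NA} \<Longrightarrow> fA a \<in> words inputs n" "\<And>b. b \<in> {1..NB} \<Longrightarrow> fB b \<in> words inputs n"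
proof -
  have f: "fA a \<in> words inputs n" if "a \<in> {1..NA}" for a using code that by (auto simp: mac_code_def)
  have g: "fB a \<in> words inputs n" if "a \<in> {1..NB}" for a using code that by (auto simp: mac_code_def)
  define G where "G = {p \<in> {1..NA} \<times> {1..NB}. \<phi> (output_word n (fA (fst p)) (fB (snd p))) = p}"
  have "err_mac erasure_mac NA NB n fA fB \<phi> = 1 / (real NA * real NB) *
     (\<Sum>a\<in>{1..NA}. \<Sum>b\<in>{1..NB}. 1 - of_bool (\<phi> (output_word n (fA a) (fB b)) = (a, b)))"
    unfolding err_mac_def by (intro arg_cong[of _ _ "\<lambda>s. 1 / (real NA * real NB) * s"] sum.cong refl)
      (simp add: prob_erasure_mac f g)
  also have "(\<Sum>a\<in>{1..NA}. \<Sum>b\<in>{1..NB}. 1 - of_bool (\<phi> (output_word n (fA a) (fB b)) = (a, b)))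
     = real NA * real NB - (\<Sum>p\<in>{1..NA} \<times> {1..NB}. of_bool (\<phi> (output_word n (fA (fst p)) (fB (snd p))) = p))"
    unfolding sum_subtractf sum.cartesian_product case_prod_unfold prod.collapse by simp
  also have "(\<Sum>p\<in>{1..NA} \<times> {1..NB}. of_bool (\<phi> (output_word n (fA (fst p)) (fB (snd p))) = p)) = real (card G)"
    unfolding G_def by (rule sum_of_bool_card) simp
  finally have e: "(1 - err_mac erasure_mac NA NB n fA fB \<phi>) * (real NA * real NB) = real (card G)"
    using N by (simp add: field_simps)
  show thesis
  proof (rule that[of G])
    show "inj_on (\<lambda>(a, b). output_word n (fA a) (fB b)) G"
      by (rule inj_on_inverseI[of _ \<phi>]) (auto simp: G_def)
  qed (use e f g in \<open>auto simp: G_def\<close>)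
qed

lemma mac_achievable_converse:
  assumes "mac_achievable erasure_mac a b"
  shows "0 \<le> a" "0 \<le> b" "a \<le> 1" "b \<le> 1" "a + b \<le> 3 / 2"
proof -
  show ab: "0 \<le> a" "0 \<le> b" using assms by (auto simp: mac_achievable_def)
  obtain fA fB \<phi> where code: "\<And>n. n \<ge> 1 \<Longrightarrow> mac_code (num_messages a n) (num_messages b n) n (fA n) (fB n) (\<phi> n)"
    and lim: "(\<lambda>n. err_mac erasure_mac (num_messages a n) (num_messages b n) n (fA n) (fB n) (\<phi> n)) \<longlonglongrightarrow> 0"
    using assms unfolding mac_achievable_def by blast
  let ?e = "\<lambda>n. err_mac erasure_mac (num_messages a n) (num_messages b n) n (fA n) (fB n) (\<phi> n)"
  let ?NA = "\<lambda>n. real (num_messages a n)" and ?NB = "\<lambda>n. real (num_messages b n)"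
  note NA = num_messages_bounds[OF ab(1)] and NB = num_messages_bounds[OF ab(2)]
  have half: "\<forall>\<^sub>F n in sequentially. ?e n < 1 / 2"
    using order_tendstoD(2)[OF lim, of "1 / 2"] by simp
  have single: "R \<le> 1" if "\<forall>\<^sub>F n in sequentially. real (num_messages R n) \<le> 2 * 2 ^ n" "R \<ge> 0" for R
  proof (rule ccontr)
    assume "\<not> R \<le> 1"
    then have "\<forall>\<^sub>F n :: nat in sequentially. 4 < 2 powr (real n * (R - 1))" by real_asymp
    then have "\<forall>\<^sub>F n :: nat in sequentially. False" using that(1)
    proof eventually_elim
      case (elim n)
      have "2 powr (real n * R) = 2 powr (real n * (R - 1)) * 2 powr real n"
        unfolding powr_add[symmetric] by (simp add: algebra_simps)
      also have "\<dots> = 2 powr (real n * (R - 1)) * 2 ^ n" by (simp add: powr_realpow)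
      finally have "2 powr (real n * R) > 4 * 2 ^ n" using elim(1) by simp
      then show False using num_messages_bounds(3)[OF that(2), of n] elim(2) by linarith
    qed
    then show False by simp
  qed
  show "a \<le> 1"
  proof (rule single[OF _ ab(1)])
    show "\<forall>\<^sub>F n in sequentially. ?NA n \<le> 2 * 2 ^ n"
      using half eventually_ge_at_top[of 1]
    proof eventually_elim
      case (elim n)
      obtain G where G: "G \<subseteq> {1..num_messages a n} \<times> {1..num_messages b n}"
        "inj_on (\<lambda>(a, b). output_word n (fA n a) (fB n b)) G"
        "(1 - ?e n) * (?NA n * ?NB n) \<le> real (card G)"
        "\<And>u. u \<in> {1..num_messages a n} \<Longrightarrow> fA n u \<in> words inputs n" "\<And>u. u \<in> {1..num_messages b n} \<Longrightarrow> fB n u \<in> words inputs n"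
        by (rule mac_code_good_pairs[OF code[OF elim(2)] NA(1) NB(1)]) blast
      have "1 / 2 * (?NA n * ?NB n) \<le> (1 - ?e n) * (?NA n * ?NB n)"
        using elim(1) by (intro mult_right_mono) auto
      also have "\<dots> \<le> real (card G)" by (rule G(3))
      also have "\<dots> \<le> real (2 ^ n * card {1..num_messages b n})"
        unfolding of_nat_le_iff by (rule good_pairs_single_bound[OF _ _ G(4) G(1,2)]) auto
      finally have "?NB n * (?NA n) \<le> ?NB n * (2 * 2 ^ n)" by (simp add: algebra_simps)
      then show ?case using NB(1)[of n] by (subst (asm) mult_le_cancel_left_pos) auto
    qed
  qed
  show "b \<le> 1"
  proof (rule single[OF _ ab(2)])
    show "\<forall>\<^sub>F n in sequentially. ?NB n \<le> 2 * 2 ^ n"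
      using half eventually_ge_at_top[of 1]
    proof eventually_elim
      case (elim n)
      obtain G where G: "G \<subseteq> {1..num_messages a n} \<times> {1..num_messages b n}"
        "inj_on (\<lambda>(a, b). output_word n (fA n a) (fB n b)) G"
        "(1 - ?e n) * (?NA n * ?NB n) \<le> real (card G)"
        "\<And>u. u \<in> {1..num_messages a n} \<Longrightarrow> fA n u \<in> words inputs n" "\<And>u. u \<in> {1..num_messages b n} \<Longrightarrow> fB n u \<in> words inputs n"
        by (rule mac_code_good_pairs[OF code[OF elim(2)] NA(1) NB(1)]) blast
      have "inj_on (\<lambda>(b, a). output_word n (fB n b) (fA n a)) (prod.swap ` G)"
        using G(2) unfolding inj_on_def by (auto simp: output_word_commute[of n "fB n _"])
      then have "card (prod.swap ` G) \<le> 2 ^ n * card {1..num_messages a n}"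
        using G(1) by (intro good_pairs_single_bound[OF finite_atLeastAtMost finite_atLeastAtMost G(5)]) auto
      then have cG: "card G \<le> 2 ^ n * card {1..num_messages a n}" by (simp add: card_image)
      have "1 / 2 * (?NA n * ?NB n) \<le> (1 - ?e n) * (?NA n * ?NB n)"
        using elim(1) by (intro mult_right_mono) auto
      also have "\<dots> \<le> real (card G)" by (rule G(3))
      also have "\<dots> \<le> real (2 ^ n * card {1..num_messages a n})"
        unfolding of_nat_le_iff by (rule cG)
      finally have "?NA n * (?NB n) \<le> ?NA n * (2 * 2 ^ n)" by (simp add: algebra_simps)
      then show ?case using NA(1)[of n] by (subst (asm) mult_le_cancel_left_pos) auto
    qed
  qed
  show "a + b \<le> 3 / 2"
  proof (rule ccontr)
    assume "\<not> a + b \<le> 3 / 2"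
    define \<delta> where "\<delta> = (a + b - 3 / 2) / 2"
    have \<delta>: "\<delta> > 0" using \<open>\<not> a + b \<le> 3 / 2\<close> by (simp add: \<delta>_def)
    \<comment> \<open>Correct pairs make up at least 1 - \<kappa> / 2 of all pairs, expensive ones
      at most 1 - \<kappa>, so a fraction \<kappa> / 2 is cheap. There are at least 2^((3/2 + 2 *
      \<delta>) n) / 4 pairs but at most 2^((3/2 + \<delta>) n) cheap ones, which fails once
      2^(\<delta> n) > 8 / \<kappa>.\<close>
    define \<kappa> where "\<kappa> = \<delta> / (3 / 2 + \<delta>)"
    have \<kappa>: "\<kappa> > 0" "(3 / 2) / (3 / 2 + \<delta>) = 1 - \<kappa>" using \<delta> by (auto simp: \<kappa>_def field_simps)
    have "\<forall>\<^sub>F n in sequentially. ?e n < \<kappa> / 2"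
      using order_tendstoD(2)[OF lim, of "\<kappa> / 2"] \<kappa> by simp
    moreover have "\<forall>\<^sub>F n :: nat in sequentially. 8 / \<kappa> < 2 powr (\<delta> * real n)" using \<delta> by real_asymp
    ultimately have "\<forall>\<^sub>F n :: nat in sequentially. False"
      using eventually_ge_at_top[of 1]
    proof eventually_elim
      case (elim n)
      obtain G where G: "G \<subseteq> {1..num_messages a n} \<times> {1..num_messages b n}"
        "inj_on (\<lambda>(a, b). output_word n (fA n a) (fB n b)) G"
        "(1 - ?e n) * (?NA n * ?NB n) \<le> real (card G)"
        "\<And>u. u \<in> {1..num_messages a n} \<Longrightarrow> fA n u \<in> words inputs n" "\<And>u. u \<in> {1..num_messages b n} \<Longrightarrow> fB n u \<in> words inputs n"
        by (rule mac_code_good_pairs[OF code[OF elim(3)] NA(1) NB(1)]) blast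
      have "(1 - \<kappa> / 2) * (?NA n * ?NB n) \<le> (1 - ?e n) * (?NA n * ?NB n)"
        using elim(1) by (intro mult_right_mono) auto
      also have "\<dots> \<le> real (card G)" by (rule G(3))
      also have "\<dots> \<le> (3 / 2) / (3 / 2 + \<delta>) * (real (card {1..num_messages a n}) * real (card {1..num_messages b n})) + 2 powr ((3 / 2 + \<delta>) * real n)"
        using NA(1)[of n] NB(1)[of n] elim(3) \<delta> by (intro good_pairs_sum_bound[OF _ _ _ _ G(4,5,1,2)]) auto
      finally have "\<kappa> / 2 * (?NA n * ?NB n) \<le> 2 powr ((3 / 2 + \<delta>) * real n)"
        unfolding \<kappa>(2) by (simp add: algebra_simps)
      moreover have "2 powr (real n * a) * 2 powr (real n * b) \<le> (2 * ?NA n) * (2 * ?NB n)"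
        by (intro mult_mono NA(3) NB(3)) auto
      then have "\<kappa> / 8 * (2 powr (real n * a) * 2 powr (real n * b)) \<le> \<kappa> / 8 * (4 * (?NA n * ?NB n))"
        using \<kappa>(1) by (intro mult_left_mono) auto
      ultimately have "\<kappa> / 8 * (2 powr (real n * a) * 2 powr (real n * b)) \<le> 2 powr ((3 / 2 + \<delta>) * real n)" by simp
      also have "2 powr (real n * a) * 2 powr (real n * b) = 2 powr (\<delta> * real n) * 2 powr ((3 / 2 + \<delta>) * real n)"
        unfolding powr_add[symmetric] by (rule arg_cong[of _ _ "(powr) 2"]) (simp add: \<delta>_def field_simps)
      finally have "(\<kappa> / 8 * 2 powr (\<delta> * real n)) * 2 powr ((3 / 2 + \<delta>) * real n) \<le> 1 * 2 powr ((3 / 2 + \<delta>) * real n)"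
        by (simp add: mult.assoc)
      then have "\<kappa> / 8 * 2 powr (\<delta> * real n) \<le> 1" by (rule mult_right_le_imp_le) simp
      then show False using elim(2) \<kappa>(1) by (simp add: field_simps)
    qed
    then show False by simp
  qed
qed

subsection \<open>The capacity regions\<close>

lemma err_honest_bounds:
  "0 \<le> err_honest W NA NB n fA fB \<phi>" "err_honest W NA NB n fA fB \<phi> \<le> err_adv_id W NA NB n fA fB \<phi>"
proof -
  show "0 \<le> err_honest W NA NB n fA fB \<phi>"
    unfolding err_honest_def by (intro mult_nonneg_nonneg sum_nonneg) auto
  show "err_honest W NA NB n fA fB \<phi> \<le> err_adv_id W NA NB n fA fB \<phi>"
    unfolding err_adv_id_def by (intro Max_ge) auto
qed

lemma adv_id_achievable_imp_mac_achievable: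
  assumes "adv_id_achievable W a b"
  shows "mac_achievable W a b"
proof -
  have ab: "0 \<le> a" "0 \<le> b" using assms by (auto simp: adv_id_achievable_def)
  obtain fA fB \<phi> where code: "\<And>n. n \<ge> 1 \<Longrightarrow> adv_id_code (num_messages a n) (num_messages b n) n (fA n) (fB n) (\<phi> n)"
    and lim: "(\<lambda>n. err_adv_id W (num_messages a n) (num_messages b n) n (fA n) (fB n) (\<phi> n)) \<longlonglongrightarrow> 0"
    using assms unfolding adv_id_achievable_def by blast
  define \<psi> where "\<psi> n z = (case \<phi> n z of Messages p \<Rightarrow> p | _ \<Rightarrow> (1, 1))" for n z
  have "mac_code (num_messages a n) (num_messages b n) n (fA n) (fB n) (\<psi> n)" if "n \<ge> 1" for n
    using code[OF that] num_messages_bounds(1)[OF ab(1), of n] num_messages_bounds(1)[OF ab(2), of n]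
    unfolding adv_id_code_def mac_code_def \<psi>_def by (fastforce simp: Pi_iff split: decision.splits)
  moreover have "(\<lambda>n. err_mac W (num_messages a n) (num_messages b n) n (fA n) (fB n) (\<psi> n)) \<longlonglongrightarrow> 0"
  proof (rule tendsto_sandwich[OF _ _ tendsto_const lim])
    show "\<forall>\<^sub>F n in sequentially. 0 \<le> err_mac W (num_messages a n) (num_messages b n) n (fA n) (fB n) (\<psi> n)"
      unfolding err_mac_def by (intro always_eventually allI mult_nonneg_nonneg sum_nonneg) auto
    have "err_mac W NA NB n f g (\<psi> n) \<le> err_honest W NA NB n f g (\<phi> n)" for NA NB n f g
      unfolding err_mac_def err_honest_def
      by (intro mult_left_mono sum_mono measure_pmf.finite_measure_mono) (auto simp: \<psi>_def)
    then show "\<forall>\<^sub>F n in sequentially. err_mac W (num_messages a n) (num_messages b n) n (fA n) (fB n) (\<psi> n)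
        \<le> err_adv_id W (num_messages a n) (num_messages b n) n (fA n) (fB n) (\<phi> n)"
      using err_honest_bounds(2) order_trans by (intro always_eventually allI) blast
  qed
  ultimately show ?thesis unfolding mac_achievable_def using ab by blast
qed

text \<open>For each error bound suitable codes exist only from some length on, while achievability
  asks for one sequence of codes. Choosing at every length a code within 1 / (n + 1) of the least
  possible error provides it.\<close>

lemma adv_id_achievable_interior:
  assumes "0 < a" "a < 1" "0 < b" "b < 1" "a + b < 3 / 2"
  shows "adv_id_achievable erasure_mac a b"
proof -
  let ?NA = "num_messages a" and ?NB = "num_messages b"
  let ?err = "\<lambda>n (fA, fB, \<phi>). err_adv_id erasure_mac (?NA n) (?NB n) n fA fB \<phi>"
  define S where "S n = {(fA, fB, \<phi>). adv_id_code (?NA n) (?NB n) n fA fB \<phi>}" for n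
  have "(\<lambda>_. to_word n [], \<lambda>_. to_word n [], \<lambda>_. Adversary_A) \<in> S n" for n
    using to_word_in_words by (simp add: S_def adv_id_code_def)
  then have ne: "?err n ` S n \<noteq> {}" for n by blast
  have nonneg: "0 \<le> ?err n c" for n c
    using err_honest_bounds order_trans by (cases c) (simp, blast)
  have bdd: "bdd_below (?err n ` S n)" for n using nonneg by (intro bdd_belowI[of _ 0]) blast
  have "\<exists>c\<in>S n. ?err n c < Inf (?err n ` S n) + 1 / real (Suc n)" for n
  proof -
    have "Inf (?err n ` S n) < Inf (?err n ` S n) + 1 / real (Suc n)" by simp
    from cInf_lessD[OF ne this] show ?thesis by blast
  qed
  then obtain c where c: "\<And>n. c n \<in> S n" "\<And>n. ?err n (c n) < Inf (?err n ` S n) + 1 / real (Suc n)" by metis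
  have "(\<lambda>n. ?err n (c n)) \<longlonglongrightarrow> 0"
  proof (rule order_tendstoI)
    fix u :: real assume "u < 0"
    then show "\<forall>\<^sub>F n in sequentially. u < ?err n (c n)"
      using nonneg by (intro always_eventually allI) (rule less_le_trans)
  next
    fix u :: real assume u: "0 < u"
    then have "\<forall>\<^sub>F n in sequentially. 1 / real (Suc n) < u / 2" by real_asymp
    moreover have "u / 4 > 0" using u by simp
    note id_code_exact_rate[OF assms this]
    ultimately show "\<forall>\<^sub>F n in sequentially. ?err n (c n) < u"
    proof eventually_elim
      case (elim n)
      obtain fA fB \<phi> where f: "adv_id_code (?NA n) (?NB n) n fA fB \<phi>"
        "err_adv_id erasure_mac (?NA n) (?NB n) n fA fB \<phi> \<le> 2 * (u / 4)"
        using adv_id_code_of_id_code[OF elim(2)] num_messages_bounds(1) assms by (meson less_imp_le)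
      have "(fA, fB, \<phi>) \<in> S n" using f(1) by (simp add: S_def)
      then have "Inf (?err n ` S n) \<le> ?err n (fA, fB, \<phi>)" by (intro cInf_lower[OF _ bdd] imageI)
      then show ?case using f(2) c(2)[of n] elim(1) by simp
    qed
  qed
  moreover have "adv_id_code (?NA n) (?NB n) n (fst (c n)) (fst (snd (c n))) (snd (snd (c n)))" for n
    using c(1)[of n] by (auto simp: S_def)
  ultimately show ?thesis
    unfolding adv_id_achievable_def using assms
    by (intro conjI exI[of _ "\<lambda>n. fst (c n)"] exI[of _ "\<lambda>n. fst (snd (c n))"] exI[of _ "\<lambda>n. snd (snd (c n))"])
       (auto simp: case_prod_unfold)
qed

theorem mainTheorem6:
  shows "adv_id_capacity_region erasure_mac = mac_capacity_region erasure_mac"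
proof
  show "adv_id_capacity_region erasure_mac \<subseteq> mac_capacity_region erasure_mac"
    unfolding adv_id_capacity_region_def mac_capacity_region_def
    using adv_id_achievable_imp_mac_achievable by (intro closure_mono) auto
  have "(a, b) \<in> closure {(a, b). adv_id_achievable erasure_mac a b}" if mac: "mac_achievable erasure_mac a b" for a b
  proof -
    note ab = mac_achievable_converse[OF mac]
    \<comment> \<open>The pair is moved slightly towards (1/4, 1/4), which satisfies every bound
      strictly; so do the convex combinations, and they converge back to the pair.\<close>
    define t where "t k = 1 / (real k + 2)" for k :: nat
    define A where "A k = (1 - t k) * a + t k * (1 / 4)" for k
    define B where "B k = (1 - t k) * b + t k * (1 / 4)" for k
    have t: "0 < t k" "t k < 1" for k by (auto simp: t_def)
    have pos: "0 < (1 - t k) * x + t k * (1 / 4)" if "0 \<le> x" for k x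
      using t[of k] that by (intro add_nonneg_pos) auto
    have less: "(1 - t k) * x + t k * u < w" if "x \<le> w" "u < w" for k x u w
    proof -
      have "(1 - t k) * x + t k * u < (1 - t k) * w + t k * w"
        using t[of k] that by (intro add_le_less_mono mult_left_mono mult_strict_left_mono) auto
      then show ?thesis by (simp add: algebra_simps)
    qed
    have "A k + B k = (1 - t k) * (a + b) + t k * (1 / 2)" for k by (simp add: A_def B_def algebra_simps)
    then have "adv_id_achievable erasure_mac (A k) (B k)" for k
      using less[of "a + b" "3 / 2" "1 / 2" k] ab pos less[of _ 1 "1 / 4"]
      by (intro adv_id_achievable_interior) (auto simp: A_def B_def)
    moreover have "t \<longlonglongrightarrow> 0" unfolding t_def by real_asymp
    then have "A \<longlonglongrightarrow> (1 - 0) * a + 0 * (1 / 4)" "B \<longlonglongrightarrow> (1 - 0) * b + 0 * (1 / 4)"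
      unfolding A_def B_def by (intro tendsto_intros; assumption)+
    then have "(\<lambda>k. (A k, B k)) \<longlonglongrightarrow> (a, b)" by (intro tendsto_Pair) auto
    ultimately show ?thesis unfolding closure_sequential by (intro exI[of _ "\<lambda>k. (A k, B k)"]) auto
  qed
  then have "{(a, b). mac_achievable erasure_mac a b} \<subseteq> closure {(a, b). adv_id_achievable erasure_mac a b}"
    by auto
  then show "mac_capacity_region erasure_mac \<subseteq> adv_id_capacity_region erasure_mac"
    unfolding adv_id_capacity_region_def mac_capacity_region_def by (intro closure_minimal) auto
qed

end
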